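(* Let $b\ge1$ and $0<\alpha<1$. Let $D^{FC}_\alpha$ be the random variable with distribution $\Pr(D^{FC}_\alpha=k)=\frac1\alpha\int_0^\alpha\Pr(U_\beta=k)\,d\beta$, $k\ge0$. Then its probability generating function is $$\psi_{FC}(q;\alpha)=\frac1\alpha\int_0^\alpha\psi_U(q;\beta)\,d\beta=\frac1\alpha\int_0^\alpha\frac{T_0(b\beta)}{1-q}\prod_{\ell=0}^{b-1}\bigl(1-\zeta_\ell(q;\beta)\bigr)\,d\beta=\frac1\alpha\int_0^\alpha\frac{b(1-\beta)\prod_{\ell=0}^{b-1}(1-\zeta_\ell(q;\beta))}{(1-q)\prod_{\ell=1}^{b-1}(1-\zeta_\ell(1;\beta))}\,d\beta.$$ Moreover, for the exact model, as $m,n\to\infty$ with $n/(bm)\to\alpha$, $D^{FC}_{m,n}\to D^{FC}_\alpha$ in distribution with convergence of all moments, and for some $\delta>0$ the probability generating function of $D^{FC}_{m,n}$ converges to $\psi_{FC}(q;\alpha)$ uniformly for $|q|\le1+\delta$.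
   Context: $T(z)=\sum_{n\ge1}n^{n-1}z^n/n!$, $\omega=e^{2\pi i/b}$; for $0<\beta<1$ and $|q|\le(e^{\beta-1}/\beta)^b$, $\zeta_\ell(q;\beta)=T(\omega^\ell\beta e^{-\beta}q^{1/b})/\beta$ (fixed choice of $q^{1/b}$, with $1^{1/b}=1$; products over all $\ell$ do not depend on it); $T_0(b\beta)=b(1-\beta)/\prod_{\ell=1}^{b-1}(1-\zeta_\ell(1;\beta))$. $U_\beta$: in the infinite Poisson model with parameter $\beta$ (buckets $i\in\mathbb Z$ of capacity $b$, $X_i$ i.i.d. Poisson($\beta b$) keys with hash address $i$, $H_i=b+\max_{j<i}\sum_{k=j+1}^i(X_k-b)$, bucket $i$ full iff $H_i\ge b$), $U_\beta$ is the number of full buckets among $0,1,\dots$ before the first non-full bucket $\ge0$; $\psi_U(q;\beta)=\mathbb E\,q^{U_\beta}$. Exact model: $m$ cyclically arranged buckets of capacity $b$, $n\le bm$ keys with independent uniform hash addresses inserted one by one by linear probing with the first-come-first-served rule (each key placed in the first non-full bucket from its hash address cyclically and never moved); $D^{FC}_{m,n}$ is the displacement (number of buckets passed beyond its hash address) of a uniformly random key. *)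

theory Defs
  imports "HOL-Probability.Probability"
begin

section \<open>Analytic ingredients\<close>

text \<open>The series starts at exponent 1, so it is indexed by the predecessor of the exponent.\<close>

definition tree_T :: "complex \<Rightarrow> complex" where
  "tree_T z = (\<Sum>n. of_nat (Suc n ^ n) * z ^ Suc n / fact (Suc n))"

definition omega :: "nat \<Rightarrow> complex" where
  "omega b = exp (2 * of_real pi * \<i> / of_nat b)"

text \<open>The argument \<open>r\<close> is the chosen branch of the \<open>b\<close>-th root, i.e. \<open>r q\<close> plays the role of
  \<open>q\<close> to the power \<open>1/b\<close>.\<close>

definition zeta :: "nat \<Rightarrow> (complex \<Rightarrow> complex) \<Rightarrow> nat \<Rightarrow> complex \<Rightarrow> real \<Rightarrow> complex" where
  "zeta b r l q \<beta> =
     tree_T (omega b ^ l * of_real (\<beta> * exp (- \<beta>)) * r q) / of_real \<beta>"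

text \<open>The defining formula is for the argument \<open>u = b\<beta>\<close>, hence \<open>\<beta> = u / b\<close>.\<close>

definition T0 :: "nat \<Rightarrow> (complex \<Rightarrow> complex) \<Rightarrow> real \<Rightarrow> complex" where
  "T0 b r u = (let \<beta> = u / real b in
     of_real (real b * (1 - \<beta>)) / (\<Prod>l = 1..<b. 1 - zeta b r l 1 \<beta>))"


section \<open>The infinite Poisson model\<close>

text \<open>A sample point \<open>X\<close> assigns to each bucket \<open>i\<close> the number \<open>X i\<close> of keys hashed to it.\<close>

definition poisson_model :: "nat \<Rightarrow> real \<Rightarrow> (int \<Rightarrow> nat) measure" where
  "poisson_model b \<beta> = PiM UNIV (\<lambda>_. measure_pmf (poisson_pmf (\<beta> * real b)))"

text \<open>On \<^typ>\<open>int\<close>, the supremum of a nonempty set that is bounded above is its maximum. For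
  \<open>0 < \<beta> < 1\<close> the partial sums below are almost surely bounded above; on the exceptional null
  event the value is irrelevant.\<close>

definition H :: "nat \<Rightarrow> (int \<Rightarrow> nat) \<Rightarrow> int \<Rightarrow> int" where
  "H b X i = int b + (SUP j\<in>{..<i}. \<Sum>k\<in>{j+1..i}. (int (X k) - int b))"

definition full :: "nat \<Rightarrow> (int \<Rightarrow> nat) \<Rightarrow> int \<Rightarrow> bool" where
  "full b X i \<longleftrightarrow> H b X i \<ge> int b"

text \<open>The index of the first non-full bucket among \<open>0, 1, \<dots>\<close> is the number of full buckets
  preceding it. It exists almost surely.\<close>

definition U :: "nat \<Rightarrow> (int \<Rightarrow> nat) \<Rightarrow> nat" where
  "U b X = (LEAST k. \<not> full b X (int k))"

definition psi_U :: "nat \<Rightarrow> complex \<Rightarrow> real \<Rightarrow> complex" where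
  "psi_U b q \<beta> = (\<integral>X. q ^ U b X \<partial>poisson_model b \<beta>)"


section \<open>The limiting displacement\<close>

definition D_FC_lim :: "nat \<Rightarrow> real \<Rightarrow> nat pmf" where
  "D_FC_lim b \<alpha> = embed_pmf (\<lambda>k.
     (1 / \<alpha>) * (LBINT \<beta>=0..\<alpha>. \<P>(X in poisson_model b \<beta>. U b X = k)))"

definition pgf :: "nat pmf \<Rightarrow> complex \<Rightarrow> complex" where
  "pgf D q = measure_pmf.expectation D (\<lambda>k. q ^ k)"

definition psi_FC :: "nat \<Rightarrow> complex \<Rightarrow> real \<Rightarrow> complex" where
  "psi_FC b q \<alpha> = pgf (D_FC_lim b \<alpha>) q"


section \<open>The exact model\<close>

text \<open>Buckets are \<open>0, \<dots>, m - 1\<close>. Given the current loads \<open>L\<close> and the hash addresses of the keys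
  still to be inserted, \<open>fc_displacements b m L hs\<close> lists the displacements of these keys in
  order of insertion; a key that is placed is never moved.\<close>

primrec fc_displacements :: "nat \<Rightarrow> nat \<Rightarrow> (nat \<Rightarrow> nat) \<Rightarrow> nat list \<Rightarrow> nat list" where
  "fc_displacements b m L [] = []"
| "fc_displacements b m L (h # hs) =
     (let d = (LEAST d. L ((h + d) mod m) < b);
          i = (h + d) mod m
      in d # fc_displacements b m (L(i := Suc (L i))) hs)"

definition hash_sequences :: "nat \<Rightarrow> nat \<Rightarrow> nat list set" where
  "hash_sequences m n = {hs. length hs = n \<and> set hs \<subseteq> {..<m}}"

text \<open>Meaningful for \<open>1 \<le> n \<le> b * m\<close>: there must be a key to choose and room for all keys.
  The uniform distribution on \<open>hash_sequences m n\<close> makes the addresses independent and uniform.\<close>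

definition D_FC :: "nat \<Rightarrow> nat \<Rightarrow> nat \<Rightarrow> nat pmf" where
  "D_FC b m n = do {
     hs \<leftarrow> pmf_of_set (hash_sequences m n);
     j \<leftarrow> pmf_of_set {..<n};
     return_pmf (fc_displacements b m (\<lambda>_. 0) hs ! j)
   }"

definition real_law :: "nat pmf \<Rightarrow> real measure" where
  "real_law D = distr (measure_pmf D) borel real"

end

theory Submission
  imports Defs "HOL-Complex_Analysis.Complex_Analysis" "HOL-Real_Asymp.Real_Asymp"
begin

text \<open>
  Fix \<open>\<beta> < 1\<close> and let \<open>S\<close> be the random walk with increments \<open>X - b\<close>, where \<open>X\<close> is Poisson with mean \<open>b \<beta>\<close>,
  and \<open>\<tau>\<close> the first time at which \<open>S\<close> is negative. Since \<open>b + S \<tau>\<close> takes only the values \<open>0, \<dots>, b - 1\<close>,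
  optional stopping of \<open>q\<^sup>n z\<^bsup>S n\<^esup>\<close> says that each of the \<open>b\<close> numbers \<open>\<zeta>\<close>, which solve
  \<open>z\<^sup>b = q exp (b \<beta> (z - 1))\<close>, is a root of one monic polynomial of degree \<open>b\<close>; evaluating that polynomial
  at \<open>1\<close> gives \<open>1 - E q\<^sup>\<tau> = \<Prod>(1 - \<zeta>)\<close>. In the Poisson model, \<open>P(U = k) - P(U = k + 1)\<close> is the probability that a
  non-full bucket is followed by exactly \<open>k\<close> full ones, hence \<open>P(U = k)\<close> is proportional to \<open>P(\<tau> > k)\<close>.

  In the exact model the \<open>j\<close>-th key sees the configuration left by the first \<open>j - 1\<close> keys, which does not depend on
  their order of arrival: a bucket is full iff some window of \<open>l\<close> buckets ending there received at least \<open>b l\<close>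
  keys. Long windows are exponentially unlikely by a Chernoff bound, uniformly in the load, and counts in a bounded
  window become independent Poisson variables. Averaging over \<open>j\<close> turns into the integral over \<open>\<beta>\<close>, and
  the geometric tails give convergence of moments and of generating functions beyond the unit disc.
\<close>

text \<open>The Chernoff rate \<open>load_ratio b \<beta>\<close> is the reciprocal of
  \<open>(exp (\<beta> - 1) / \<beta>) ^ b\<close>, so the disc on which the roots are controlled is
  also the one on which the tail bounds converge. Optional stopping is legitimate because the tilt
  \<open>1 / \<beta>\<close> bounds all roots and makes the martingale on the surviving paths decay
  geometrically. Two places need care. At \<open>q = 1\<close> both sides of the product formula
  vanish; the normalising constant, which is the mean of \<tau>, is obtained as a limit along a
  curve on which one root is explicit. And the mixture over \<beta> must converge on the whole
  closed disc belonging to \<alpha>, although the tail estimates for the individual \<beta>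
  degenerate as \<beta> approaches \<alpha>; there the product formula itself provides the uniform
  bound. Windows and runs are treated for arbitrary counts on the integers, the counts on the cycle
  being extended periodically, so that the same deterministic lemmas serve both models.\<close>

unbundle no vec_syntax

section \<open>The tree function\<close>

text \<open>The \<open>N\<close>-th finite difference kills polynomials of degree below
  \<open>N\<close>. The shift \<open>c\<close> is free because absorbing a factor \<open>k\<close>
  into the binomial coefficient replaces it by \<open>1 + c\<close>.\<close>

lemma sum_alternating_binomial_power:
  fixes c :: "'a::comm_ring_1"
  assumes "m < N"
  shows "(\<Sum>k\<le>N. (-1)^k * of_nat (N choose k) * (of_nat k + c)^m) = 0"
  using assms
proof (induction m arbitrary: N c)
  case 0
  then show ?case using choose_alternating_sum[of N] by simp
next
  case (Suc m)
  then obtain M where N: "N = Suc M" and mM: "m < M" by (cases N) auto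
  have "(\<Sum>k\<le>N. (-1)^k * of_nat (N choose k) * (of_nat k * (of_nat k + c)^m))
      = (\<Sum>k\<le>M. (-1)^Suc k * of_nat (Suc k * (N choose Suc k)) * (of_nat k + (1 + c))^m)"
    unfolding N by (subst sum.atMost_Suc_shift) (simp add: algebra_simps)
  also have "\<dots> = (\<Sum>k\<le>M. - of_nat N * ((-1)^k * of_nat (M choose k) * (of_nat k + (1 + c))^m))"
    unfolding N Suc_times_binomial
    by (rule sum.cong) (simp_all add: algebra_simps)
  also have "\<dots> = 0"
    using Suc.IH[OF mM, of "1 + c"] by (simp add: sum_distrib_left[symmetric] sum_negf)
  finally have 1: "(\<Sum>k\<le>N. (-1)^k * of_nat (N choose k) * (of_nat k * (of_nat k + c)^m)) = 0" .
  have 2: "(\<Sum>k\<le>N. (-1)^k * of_nat (N choose k) * (of_nat k + c)^m) = 0"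
    using Suc.IH[of N c] Suc.prems by simp
  have "(\<Sum>k\<le>N. (-1)^k * of_nat (N choose k) * (of_nat k + c)^Suc m)
     = (\<Sum>k\<le>N. (-1)^k * of_nat (N choose k) * (of_nat k * (of_nat k + c)^m))
       + c * (\<Sum>k\<le>N. (-1)^k * of_nat (N choose k) * (of_nat k + c)^m)"
    unfolding sum_distrib_left sum.distrib[symmetric]
    by (rule sum.cong) (auto simp: algebra_simps)
  then show ?case using 1 2 by simp
qed

definition tree_fps :: "complex fps" where
  "tree_fps = Abs_fps (\<lambda>n. if n = 0 then 0 else of_nat (n ^ (n - 1)) / fact n)"

text \<open>Lagrange inversion by hand: for \<open>N \<ge> 2\<close> the coefficient of order
  \<open>N\<close> is, up to the factor \<open>(-1)^N / fact N\<close>, an alternating binomial sum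
  of \<open>i ^ (N - 1)\<close>, hence zero.\<close>

lemma tree_fps_compose: "tree_fps oo (fps_X * fps_exp (-1)) = fps_X"
proof (rule fps_ext)
  fix N :: nat
  have pw: "((fps_X * fps_exp (-1)) ^ i :: complex fps) $ N = (- of_nat i) ^ (N - i) / fact (N - i)"
    if "i \<le> N" for i
    using that by (simp add: power_mult_distrib fps_exp_power_mult fps_X_power_mult_nth)
  show "(tree_fps oo (fps_X * fps_exp (-1))) $ N = fps_X $ N"
  proof (cases "N \<le> 1")
    case True
    then have "N = 0 \<or> N = 1" by auto
    then show ?thesis
      by (auto simp: fps_compose_nth tree_fps_def)
  next
    case False
    have "(tree_fps oo (fps_X * fps_exp (-1))) $ N
        = (\<Sum>i\<le>N. tree_fps $ i * ((- of_nat i) ^ (N - i) / fact (N - i)))"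
      unfolding fps_compose_nth atLeast0AtMost by (rule sum.cong) (auto simp: pw)
    also have "\<dots> = (\<Sum>i\<le>N. (-1)^N / fact N *
        ((-1)^i * of_nat (N choose i) * (of_nat i + 0)^(N - 1)))"
    proof (rule sum.cong[OF refl])
      fix i assume "i \<in> {..N}"
      then have i: "i \<le> N" by simp
      show "tree_fps $ i * ((- of_nat i) ^ (N - i) / fact (N - i))
          = (-1)^N / fact N * ((-1)^i * of_nat (N choose i) * (of_nat i + 0)^(N - 1) :: complex)"
      proof (cases "i = 0")
        case True
        \<comment> \<open>Here \<open>N \<ge> 2\<close>, so \<open>0 ^ (N - 1) = 0\<close> matches
          the vanishing constant coefficient of \<open>tree_fps\<close>.\<close>
        with False show ?thesis by (simp add: tree_fps_def zero_power)
      next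
        case i0: False
        have 1: "(-1)^N * (-1)^i = ((-1)^(N-i) :: complex)"
          using i by (metis (no_types, lifting) minus_one_power_iff even_add le_add_diff_inverse mult.commute mult_minus_left mult_minus_right mult_1 minus_minus)
        have 2: "(of_nat i :: complex)^(N - 1) = of_nat i ^ (i - 1) * of_nat i ^ (N - i)"
          using i i0 by (simp add: power_add[symmetric])
        have 3: "(- of_nat i :: complex) ^ (N - i) = (-1)^(N-i) * of_nat i ^ (N - i)"
          by (rule power_minus)
        have 4: "of_nat (N choose i) = (fact N / (fact i * fact (N - i)) :: complex)"
          using i by (rule binomial_fact)
        have "(-1)^N / fact N * ((-1)^i * of_nat (N choose i) * (of_nat i + 0)^(N - 1) :: complex)
           = ((-1)^N * (-1)^i) / fact N * of_nat (N choose i) * of_nat i^(N - 1)" by simp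
        then show ?thesis unfolding 1 2 3 4
          using i0 by (simp add: tree_fps_def divide_simps)
      qed
    qed
    also have "\<dots> = (-1)^N / fact N *
        (\<Sum>i\<le>N. ((-1)^i * of_nat (N choose i) * (of_nat i + 0)^(N - 1)))"
      by (simp add: sum_distrib_left)
    also have "\<dots> = 0"
      using sum_alternating_binomial_power[of "N-1" N "0::complex"] False by simp
    finally show ?thesis using False by simp
  qed
qed

text \<open>A left compositional inverse of a series with nonzero linear coefficient is its
  two-sided inverse. This is the side that yields the functional equation of the tree
  function.\<close>

lemma fps_compose_tree: "(fps_X * fps_exp (-1)) oo tree_fps = fps_X"
proof -
  let ?F = "fps_X * fps_exp (-1) :: complex fps"
  have 0: "?F $ 0 = 0" "?F $ 1 \<noteq> 0" by auto
  have T0: "tree_fps $ 0 = 0" by (simp add: tree_fps_def)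
  have I0: "fps_inv ?F $ 0 = 0" by (simp add: fps_inv_def)
  have "tree_fps = tree_fps oo (?F oo fps_inv ?F)"
    using fps_inv_right[OF 0] by simp
  also have "\<dots> = (tree_fps oo ?F) oo fps_inv ?F"
    using I0 by (simp add: fps_compose_assoc)
  also have "\<dots> = fps_inv ?F"
    unfolding tree_fps_compose using I0 by simp
  finally have "tree_fps = fps_inv ?F" .
  then show ?thesis using fps_inv_right[OF 0] by simp
qed

text \<open>A single term of the exponential series at \<open>Suc n\<close>. This replaces
  Stirling's formula in the estimate of the radius of convergence.\<close>

lemma power_le_exp_fact: "real (Suc n ^ n) / fact (Suc n) \<le> exp (real (Suc n))"
proof -
  let ?f = "\<lambda>k. inverse (fact k) * real (Suc n) ^ k"
  have "real (Suc n ^ n) / fact (Suc n) \<le> ?f (Suc n)"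
    by (simp add: divide_simps)
  also have "\<dots> \<le> (\<Sum>k. ?f k)"
    using sum_le_suminf[OF summable_exp, of "{Suc n}" "real (Suc n)"] by simp
  finally show ?thesis by (simp add: exp_def)
qed

lemma tree_fps_radius: "fps_conv_radius tree_fps \<ge> ereal (exp (-1))"
  unfolding fps_conv_radius_def
proof (rule conv_radius_geI_ex')
  fix x :: real assume x: "0 < x" "ereal x < ereal (exp (-1))"
  have lt: "exp 1 * x < 1"
    using x by (simp add: exp_minus field_simps)
  show "summable (\<lambda>n. tree_fps $ n * of_real x ^ n)"
  proof (rule summable_comparison_test)
    show "summable (\<lambda>n. (exp 1 * x) ^ n)"
      using lt x by (simp add: summable_geometric)
    show "\<exists>N. \<forall>n\<ge>N. norm (tree_fps $ n * of_real x ^ n) \<le> (exp 1 * x) ^ n"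
    proof (intro exI[of _ 0] allI impI)
      fix n
      have "norm (tree_fps $ n) \<le> exp (real n)"
        using power_le_exp_fact[of "n - 1"]
        by (cases n) (auto simp: tree_fps_def norm_divide norm_power simp del: fact_Suc of_nat_Suc)
      then show "norm (tree_fps $ n * of_real x ^ n) \<le> (exp 1 * x) ^ n"
        using x by (simp add: norm_mult norm_power power_mult_distrib exp_of_nat_mult[symmetric] mult_right_mono)
    qed
  qed
qed

section \<open>The tree function on the open disc of radius \<open>exp (-1)\<close>\<close>

lemma tree_T_eq_eval_fps:
  assumes "norm z < exp (-1)"
  shows "tree_T z = eval_fps tree_fps z" and "summable (\<lambda>n. of_nat (Suc n ^ n) * norm z ^ Suc n / fact (Suc n))"
proof -
  have lt: "ereal (norm z) < fps_conv_radius tree_fps"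
    using assms tree_fps_radius by (meson ereal_less_eq(3) less_ereal.simps(1) order_less_le_trans)
  then have s: "summable (\<lambda>n. tree_fps $ n * z ^ n)"
    by (rule summable_fps)
  show "tree_T z = eval_fps tree_fps z"
    using suminf_split_head[OF s] by (simp add: eval_fps_def tree_T_def tree_fps_def algebra_simps)
  have "summable (\<lambda>n. norm (tree_fps $ n * z ^ n))"
    by (rule norm_summable_fps[OF lt])
  then have "summable (\<lambda>n. norm (tree_fps $ Suc n * z ^ Suc n))"
    by (subst summable_Suc_iff)
  moreover have "norm (tree_fps $ Suc n * z ^ Suc n) = of_nat (Suc n ^ n) * norm z ^ Suc n / fact (Suc n)" for n
    by (simp add: tree_fps_def norm_mult norm_divide norm_power del: of_nat_Suc power_Suc)
  ultimately show "summable (\<lambda>n. of_nat (Suc n ^ n) * norm z ^ Suc n / fact (Suc n))"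
    by simp
qed

lemma tree_T_holomorphic: "tree_T holomorphic_on ball 0 (exp (-1))"
proof -
  have "ball 0 (exp (-1)) \<subseteq> eball 0 (fps_conv_radius tree_fps)"
    using tree_fps_radius by (auto simp: in_eball_iff) (meson ereal_less_eq(3) less_ereal.simps(1) order_less_le_trans)
  then have "eval_fps tree_fps holomorphic_on ball 0 (exp (-1))"
    by (rule holomorphic_on_eval_fps)
  then show ?thesis
    by (rule holomorphic_transform) (simp add: tree_T_eq_eval_fps)
qed

text \<open>The formal identity gives equality near 0 only; both sides are holomorphic on the disc,
  so analytic continuation extends it.\<close>

lemma tree_T_equation:
  assumes "norm z < exp (-1)"
  shows "tree_T z * exp (- tree_T z) = z"
proof -
  have pos: "0 < fps_conv_radius tree_fps"
    using tree_fps_radius by (rule order.strict_trans2[rotated]) simp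
  have T: "eval_fps tree_fps has_fps_expansion tree_fps"
    using pos by (simp add: has_fps_expansion_def)
  have F: "(\<lambda>x. x * exp (- x)) has_fps_expansion (fps_X * fps_exp (-1) :: complex fps)"
    by (intro fps_expansion_intros)
  have "((\<lambda>x. x * exp (- x)) \<circ> eval_fps tree_fps) has_fps_expansion fps_X"
    using has_fps_expansion_compose[OF F T] by (simp add: fps_compose_tree) (simp add: tree_fps_def)
  then have "\<forall>\<^sub>F z in nhds 0. eval_fps tree_fps z * exp (- eval_fps tree_fps z) = z"
    by (auto simp: has_fps_expansion_def elim!: eventually_mono)
  moreover have "\<forall>\<^sub>F z in nhds 0. z \<in> ball (0::complex) (exp (-1))"
    by (rule eventually_nhds_in_open) auto
  ultimately have "\<forall>\<^sub>F z in nhds 0. z \<in> ball 0 (exp (-1)) \<and> tree_T z * exp (- tree_T z) = z"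
    by eventually_elim (simp add: tree_T_eq_eval_fps)
  then obtain S where S: "open S" "0 \<in> S" "\<And>z. z \<in> S \<Longrightarrow> z \<in> ball 0 (exp (-1)) \<and> tree_T z * exp (- tree_T z) = z"
    unfolding eventually_nhds by blast
  show ?thesis
  proof (rule analytic_continuation_open[of S "ball 0 (exp (-1))" "\<lambda>z. tree_T z * exp (- tree_T z)" "\<lambda>z. z"])
    show "(\<lambda>z. tree_T z * exp (- tree_T z)) holomorphic_on ball 0 (exp (-1))"
      by (intro holomorphic_intros tree_T_holomorphic)
  qed (use S assms in auto)
qed

section \<open>The tree function on the real axis\<close>

definition tree_real :: "real \<Rightarrow> real" where
  "tree_real x = Re (tree_T (of_real x))"

lemma tree_T_of_real:
  assumes "0 \<le> x" "x < exp (-1)"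
  shows "tree_T (of_real x) = of_real (tree_real x)"
    and "tree_real x = (\<Sum>n. of_nat (Suc n ^ n) * x ^ Suc n / fact (Suc n))"
proof -
  have s: "summable (\<lambda>n. of_nat (Suc n ^ n) * x ^ Suc n / fact (Suc n))"
    using tree_T_eq_eval_fps(2)[of "of_real x"] assms by simp
  have "tree_T (of_real x) = (\<Sum>n. of_real (of_nat (Suc n ^ n) * x ^ Suc n / fact (Suc n)))"
    by (simp add: tree_T_def)
  also have "\<dots> = of_real (\<Sum>n. of_nat (Suc n ^ n) * x ^ Suc n / fact (Suc n))"
    by (rule suminf_of_real[OF s, symmetric])
  finally have *: "tree_T (of_real x) = of_real (\<Sum>n. of_nat (Suc n ^ n) * x ^ Suc n / fact (Suc n))" .
  show "tree_real x = (\<Sum>n. of_nat (Suc n ^ n) * x ^ Suc n / fact (Suc n))"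
    unfolding tree_real_def * by simp
  then show "tree_T (of_real x) = of_real (tree_real x)" using * by simp
qed

lemma norm_tree_T_le:
  assumes "norm z < exp (-1)"
  shows "norm (tree_T z) \<le> tree_real (norm z)"
proof -
  have n: "norm (of_nat (Suc n ^ n) * z ^ Suc n / fact (Suc n)) = of_nat (Suc n ^ n) * norm z ^ Suc n / fact (Suc n)" for n
    by (simp add: norm_mult norm_divide norm_power del: of_nat_Suc power_Suc)
  show ?thesis
    using summable_norm[of "\<lambda>n. of_nat (Suc n ^ n) * z ^ Suc n / fact (Suc n)"] tree_T_eq_eval_fps(2)[OF assms] assms
    unfolding tree_T_def n by (simp add: tree_T_of_real(2))
qed

lemma tree_real_nonneg:
  assumes "0 \<le> x" "x < exp (-1)" shows "0 \<le> tree_real x"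
  using order_trans[OF norm_ge_zero norm_tree_T_le[of "of_real x"]] assms by simp

lemma tree_real_equation:
  assumes "0 \<le> x" "x < exp (-1)"
  shows "tree_real x * exp (- tree_real x) = x"
proof -
  have "complex_of_real (tree_real x * exp (- tree_real x)) = of_real x"
    using tree_T_equation[of "of_real x"] assms tree_T_of_real(1)[OF assms]
    by (simp add: exp_of_real[symmetric])
  then show ?thesis using of_real_eq_iff by blast
qed

lemma tree_T_continuous: "continuous_on (ball 0 (exp (-1))) tree_T"
  by (rule holomorphic_on_imp_continuous_on[OF tree_T_holomorphic])

text \<open>Otherwise continuity would produce a point \<open>y \<le> x\<close> with value 1, and
  there the functional equation forces \<open>y = exp (-1)\<close>.\<close>

lemma tree_real_less_1:
  assumes "0 \<le> x" "x < exp (-1)"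
  shows "tree_real x < 1"
proof (rule ccontr)
  assume "\<not> tree_real x < 1"
  moreover have "tree_real 0 = 0"
    using tree_real_equation[of 0] by simp
  moreover have "continuous_on {0..x} tree_real"
    unfolding tree_real_def using assms
    by (intro continuous_intros continuous_on_compose2[OF tree_T_continuous]) auto
  ultimately obtain y where y: "0 \<le> y" "y \<le> x" "tree_real y = 1"
    using IVT'[of tree_real 0 1 x] assms by auto
  then show False
    using tree_real_equation[of y] assms by simp
qed

lemma mult_exp_neg_strict_mono:
  fixes x y :: real
  assumes "x < y" "y \<le> 1"
  shows "x * exp (- x) < y * exp (- y)"
proof (rule DERIV_pos_imp_increasing_open[OF assms(1)])
  fix z assume z: "x < z" "z < y"
  have "((\<lambda>x. x * exp (- x)) has_real_derivative (1 - z) * exp (- z)) (at z)"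
    by (auto intro!: derivative_eq_intros simp: algebra_simps)
  then show "\<exists>D. ((\<lambda>x. x * exp (- x)) has_real_derivative D) (at z) \<and> 0 < D"
    using z assms by (intro exI[of _ "(1 - z) * exp (- z)"]) auto
qed (intro continuous_intros)

text \<open>Both sides solve the same equation below 1, where \<open>u * exp (- u)\<close> is
  strictly increasing. It makes the root with \<open>l = 0\<close> explicit for suitable real
  arguments.\<close>

lemma tree_real_inverse:
  assumes "0 \<le> u" "u < 1"
  shows "tree_real (u * exp (- u)) = u"
proof -
  have x: "0 \<le> u * exp (-u)" "u * exp (-u) < exp (-1)"
    using assms mult_exp_neg_strict_mono[of u 1] by auto
  let ?y = "tree_real (u * exp (- u))"
  have "?y * exp (- ?y) = u * exp (- u)" "?y < 1"
    using tree_real_equation[OF x] tree_real_less_1[OF x] by auto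
  then show ?thesis
    using mult_exp_neg_strict_mono[of ?y u] mult_exp_neg_strict_mono[of u ?y] assms by fastforce
qed

text \<open>The linear bound comes from \<open>T = x * exp T\<close> with \<open>T < 1\<close>. It
  keeps \<open>tree_T z / \<beta>\<close> bounded when \<open>z\<close> is of order \<beta>,
  uniformly as \<beta> tends to 0.\<close>

lemma norm_tree_T_less_1:
  assumes "norm z < exp (-1)"
  shows "norm (tree_T z) < 1" "norm (tree_T z) \<le> exp 1 * norm z"
proof -
  have t: "tree_real (norm z) < 1" "tree_real (norm z) \<ge> 0"
    using assms by (auto intro: tree_real_less_1 tree_real_nonneg)
  show "norm (tree_T z) < 1"
    using norm_tree_T_le[OF assms] t by simp
  have "tree_real (norm z) = norm z * exp (tree_real (norm z))"
    using tree_real_equation[of "norm z"] assms by (simp add: exp_minus field_simps)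
  also have "\<dots> \<le> norm z * exp 1"
    using t by (intro mult_left_mono) auto
  finally show "norm (tree_T z) \<le> exp 1 * norm z"
    using norm_tree_T_le[OF assms] by (simp add: mult.commute)
qed

section \<open>A killed random walk and its kernel equation\<close>

text \<open>The minimum over \<open>z > 0\<close> of the mean of \<open>z ^ (X - b)\<close> for
  \<open>X\<close> Poisson with mean \<open>b * \<beta>\<close>, attained at
  \<open>z = 1 / \<beta>\<close>.\<close>

definition load_ratio :: "nat \<Rightarrow> real \<Rightarrow> real" where
  "load_ratio b \<beta> = (\<beta> * exp (1 - \<beta>)) ^ b"

lemma mult_exp_one_minus_less_1:
  assumes "0 < \<beta>" "\<beta> < (1::real)"
  shows "\<beta> * exp (1 - \<beta>) < 1"
  using mult_exp_neg_strict_mono[of \<beta> 1] assms by (simp add: exp_diff exp_minus field_simps)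

lemma load_ratio_pos: "0 < \<beta> \<Longrightarrow> 0 < load_ratio b \<beta>"
  by (simp add: load_ratio_def)

lemma load_ratio_less_1:
  assumes "0 < \<beta>" "\<beta> < 1" "b \<ge> 1"
  shows "load_ratio b \<beta> < 1"
  unfolding load_ratio_def
  using mult_exp_one_minus_less_1[OF assms(1,2)] assms by (intro power_less_one_iff[THEN iffD2]) auto

text \<open>A closed formula instead of a \<open>pmf\<close>: it is continuous in \<beta> on the
  whole line, and measurability in \<beta> is derived from that.\<close>

definition pois :: "nat \<Rightarrow> real \<Rightarrow> nat \<Rightarrow> real" where
  "pois b \<beta> k = (\<beta> * real b) ^ k / fact k * exp (- (\<beta> * real b))"

text \<open>The state of the walk with increments \<open>X - b\<close> is its current height; the walk is killed when it becomes
  negative, and \<open>walk_step\<close> describes the height plus \<open>b\<close> after one more increment.\<close>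

fun survive :: "nat \<Rightarrow> real \<Rightarrow> nat \<Rightarrow> nat \<Rightarrow> real" where
  "survive b \<beta> 0 s = (if s = 0 then 1 else 0)"
| "survive b \<beta> (Suc n) s = (\<Sum>r\<le>s + b. survive b \<beta> n r * pois b \<beta> (s + b - r))"

definition walk_step :: "nat \<Rightarrow> real \<Rightarrow> nat \<Rightarrow> nat \<Rightarrow> real" where
  "walk_step b \<beta> n y = (\<Sum>r\<le>y. survive b \<beta> n r * pois b \<beta> (y - r))"

definition survive_gf :: "nat \<Rightarrow> real \<Rightarrow> nat \<Rightarrow> 'a \<Rightarrow> 'a::{real_normed_field,banach}" where
  "survive_gf b \<beta> n z = (\<Sum>s. of_real (survive b \<beta> n s) * z ^ s)"

text \<open>The probability that \<tau> exceeds \<open>n\<close>; summed over \<open>n\<close> it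
  gives the mean of \<tau>.\<close>

definition survival :: "nat \<Rightarrow> real \<Rightarrow> nat \<Rightarrow> real" where
  "survival b \<beta> n = (\<Sum>s. survive b \<beta> n s)"

section \<open>Generating functions of the killed walk\<close>

lemma survive_Suc_eq_walk_step: "survive b \<beta> (Suc n) s = walk_step b \<beta> n (s + b)"
  by (simp add: walk_step_def)

lemma pois_nonneg: "0 \<le> \<beta> \<Longrightarrow> 0 \<le> pois b \<beta> k"
  by (simp add: pois_def)

lemma survive_nonneg: "0 \<le> \<beta> \<Longrightarrow> 0 \<le> survive b \<beta> n s"
  by (induction n arbitrary: s) (auto intro!: sum_nonneg mult_nonneg_nonneg pois_nonneg)

lemma walk_step_nonneg: "0 \<le> \<beta> \<Longrightarrow> 0 \<le> walk_step b \<beta> n s"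
  by (auto simp: walk_step_def intro!: sum_nonneg mult_nonneg_nonneg pois_nonneg survive_nonneg)

lemma pois_gf:
  fixes z :: "'a::{real_normed_field,banach}"
  shows "(\<lambda>k. of_real (pois b \<beta> k) * z ^ k) sums exp (of_real (\<beta> * real b) * (z - 1))"
proof -
  have "(\<lambda>k. (of_real (\<beta> * real b) * z) ^ k /\<^sub>R fact k) sums exp (of_real (\<beta> * real b) * z)"
    by (rule exp_converges)
  then have "(\<lambda>k. (of_real (\<beta> * real b) * z) ^ k /\<^sub>R fact k * exp (- of_real (\<beta> * real b)))
      sums (exp (of_real (\<beta> * real b) * z) * exp (- of_real (\<beta> * real b)))"
    by (rule sums_mult2)
  also have "(\<lambda>k. (of_real (\<beta> * real b) * z) ^ k /\<^sub>R fact k * exp (- of_real (\<beta> * real b))) =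
     (\<lambda>k. of_real (pois b \<beta> k) * z ^ k)"
    by (intro ext) (simp add: pois_def power_mult_distrib scaleR_conv_of_real exp_of_real[symmetric] field_simps)
  also have "exp (of_real (\<beta> * real b) * z) * exp (- of_real (\<beta> * real b)) = exp (of_real (\<beta> * real b) * (z - 1))"
    by (simp add: exp_add[symmetric] algebra_simps)
  finally show ?thesis .
qed

context
  fixes b :: nat and \<beta> :: real
  assumes \<beta>0: "0 \<le> \<beta>"
begin

lemma summable_pois: "summable (\<lambda>k. norm (of_real (pois b \<beta> k) * (z::'a::{real_normed_field,banach}) ^ k))"
  using sums_summable[OF pois_gf[of b \<beta> "norm z"]] pois_nonneg[OF \<beta>0] by (simp add: norm_mult norm_power)

text \<open>Summability is a hypothesis here because it is itself proved by induction through this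
  Cauchy product; \<open>walk_step_sums\<close> discharges it.\<close>

lemma walk_step_sums_aux:
  fixes z :: "'a::{real_normed_field,banach}"
  assumes "summable (\<lambda>s. norm (of_real (survive b \<beta> n s) * z ^ s))"
  shows "(\<lambda>y. of_real (walk_step b \<beta> n y) * z ^ y)
     sums (survive_gf b \<beta> n z * exp (of_real (\<beta> * real b) * (z - 1)))"
proof -
  have "(\<lambda>k. \<Sum>i\<le>k. (of_real (survive b \<beta> n i) * z ^ i) * (of_real (pois b \<beta> (k - i)) * z ^ (k - i)))
     sums ((\<Sum>k. of_real (survive b \<beta> n k) * z ^ k) * (\<Sum>k. of_real (pois b \<beta> k) * z ^ k))"
    by (rule Cauchy_product_sums[OF assms summable_pois])
  also have "(\<lambda>k. \<Sum>i\<le>k. (of_real (survive b \<beta> n i) * z ^ i) * (of_real (pois b \<beta> (k - i)) * z ^ (k - i)))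
     = (\<lambda>y. of_real (walk_step b \<beta> n y) * z ^ y)"
  proof
    fix k
    have "(of_real (survive b \<beta> n i) * z ^ i) * (of_real (pois b \<beta> (k - i)) * z ^ (k - i))
       = of_real (survive b \<beta> n i * pois b \<beta> (k - i)) * z ^ k" if "i \<le> k" for i
      using that by (simp add: power_add[symmetric] mult_ac)
    then show "(\<Sum>i\<le>k. (of_real (survive b \<beta> n i) * z ^ i) * (of_real (pois b \<beta> (k - i)) * z ^ (k - i)))
       = of_real (walk_step b \<beta> n k) * z ^ k"
      unfolding walk_step_def of_real_sum sum_distrib_right by (intro sum.cong) auto
  qed
  also have "(\<Sum>k. of_real (pois b \<beta> k) * z ^ k) = exp (of_real (\<beta> * real b) * (z - 1))"
    using pois_gf by (rule sums_unique[symmetric])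
  finally show ?thesis by (simp add: survive_gf_def)
qed

lemma summable_survive_real:
  assumes "0 \<le> (x::real)"
  shows "summable (\<lambda>s. survive b \<beta> n s * x ^ s)"
proof (cases "x = 0")
  case True
  then show ?thesis by (intro summable_finite[of "{0}"]) auto
next
  case False
  with assms have x: "x > 0" by simp
  show ?thesis
  proof (induction n)
    case 0
    show ?case by (rule summable_finite[of "{0}"]) auto
  next
    case (Suc n)
    have "summable (\<lambda>y. walk_step b \<beta> n y * x ^ y)"
      using sums_summable[OF walk_step_sums_aux[of n x]] Suc survive_nonneg[OF \<beta>0] x by simp
    \<comment> \<open>Dropping the first \<open>b\<close> terms is the killing; dividing by
      \<open>x ^ b\<close> undoes the shift by \<open>b\<close>, which is why \<open>x = 0\<close>
      was treated apart.\<close>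
    then have "summable (\<lambda>s. walk_step b \<beta> n (s + b) * x ^ (s + b) * inverse (x ^ b))"
      by (intro summable_mult2 summable_ignore_initial_segment)
    also have "(\<lambda>s. walk_step b \<beta> n (s + b) * x ^ (s + b) * inverse (x ^ b))
        = (\<lambda>s. survive b \<beta> (Suc n) s * x ^ s)"
      using x by (intro ext) (simp add: survive_Suc_eq_walk_step power_add del: survive.simps)
    finally show ?case .
  qed
qed

lemma summable_survive:
  "summable (\<lambda>s. norm (of_real (survive b \<beta> n s) * (z::'a::{real_normed_field,banach}) ^ s))"
  using summable_survive_real[of "norm z" n] survive_nonneg[OF \<beta>0] by (simp add: norm_mult norm_power)

lemmas walk_step_sums = walk_step_sums_aux[OF summable_survive]

text \<open>One increment multiplies by the Poisson generating function. The coefficients below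
  \<open>b\<close> are the mass that is killed; the others, shifted by \<open>b\<close>, form the
  next state.\<close>

lemma survive_gf_Suc:
  fixes z :: "'a::{real_normed_field,banach}"
  shows "survive_gf b \<beta> n z * exp (of_real (\<beta> * real b) * (z - 1))
    = z ^ b * survive_gf b \<beta> (Suc n) z + (\<Sum>j<b. of_real (walk_step b \<beta> n j) * z ^ j)"
proof -
  let ?f = "\<lambda>y. of_real (walk_step b \<beta> n y) * z ^ y"
  have "survive_gf b \<beta> n z * exp (of_real (\<beta> * real b) * (z - 1)) = suminf ?f"
    by (rule sums_unique[OF walk_step_sums])
  also have "\<dots> = (\<Sum>s. ?f (s + b)) + sum ?f {..<b}"
    by (rule suminf_split_initial_segment[OF sums_summable[OF walk_step_sums]])
  also have "(\<Sum>s. ?f (s + b)) = (\<Sum>s. z ^ b * (of_real (survive b \<beta> (Suc n) s) * z ^ s))"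
    by (simp add: survive_Suc_eq_walk_step power_add mult_ac del: survive.simps)
  also have "\<dots> = z ^ b * survive_gf b \<beta> (Suc n) z"
    unfolding survive_gf_def
    by (rule suminf_mult) (rule summable_norm_cancel[OF summable_survive])
  finally show ?thesis .
qed

lemma survive_gf_0: "survive_gf b \<beta> 0 z = 1"
proof -
  have "survive_gf b \<beta> 0 z = (\<Sum>s\<in>{0}. of_real (survive b \<beta> 0 s) * z ^ s)"
    unfolding survive_gf_def by (rule suminf_finite) auto
  then show ?thesis by simp
qed

lemma norm_survive_gf_le:
  fixes z :: "'a::{real_normed_field,banach}"
  assumes "norm z \<le> x"
  shows "norm (survive_gf b \<beta> n z) \<le> survive_gf b \<beta> n x"
proof -
  have "norm (survive_gf b \<beta> n z) \<le> (\<Sum>s. norm (of_real (survive b \<beta> n s) * z ^ s))"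
    unfolding survive_gf_def by (rule summable_norm[OF summable_survive])
  also have "\<dots> \<le> (\<Sum>s. survive b \<beta> n s * x ^ s)"
    using summable_survive[of n z] order_trans[OF norm_ge_zero assms]
    by (intro suminf_le summable_survive_real)
      (auto simp: norm_mult norm_power survive_nonneg[OF \<beta>0] intro!: mult_left_mono power_mono assms)
  finally show ?thesis by (simp add: survive_gf_def)
qed

lemma survival_eq_gf: "survival b \<beta> n = survive_gf b \<beta> n (1::real)"
  by (simp add: survival_def survive_gf_def)

lemma survival_nonneg: "0 \<le> survival b \<beta> n"
  using order_trans[OF norm_ge_zero norm_survive_gf_le[of "1::real" 1 n]] by (simp add: survival_eq_gf)

lemma survival_0: "survival b \<beta> 0 = 1"
  by (simp add: survival_eq_gf survive_gf_0)

text \<open>The one-step identity at \<open>z = 1\<close>: the mass killed by the next increment is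
  the probability of \<open>\<tau> = n + 1\<close>.\<close>

lemma survival_diff: "survival b \<beta> n - survival b \<beta> (Suc n) = (\<Sum>j<b. walk_step b \<beta> n j)"
  using survive_gf_Suc[of n "1::real"] by (simp add: survival_eq_gf)

lemma walk_step_le_survival: "j < b \<Longrightarrow> walk_step b \<beta> n j \<le> survival b \<beta> n"
  using survival_diff[of n] survival_nonneg[of "Suc n"] walk_step_nonneg[OF \<beta>0]
    member_le_sum[of j "{..<b}" "walk_step b \<beta> n"] by simp

end

text \<open>Tilting by \<open>1/\<beta>\<close> is the optimal choice in the Chernoff bound.\<close>

lemma survive_gf_tilted_le:
  assumes "0 < \<beta>"
  shows "survive_gf b \<beta> n (1 / \<beta>) \<le> load_ratio b \<beta> ^ n"
proof (induction n)
  case 0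
  show ?case using assms by (simp add: survive_gf_0)
next
  case (Suc n)
  \<comment> \<open>Discarding the nonnegative killed mass turns the one-step identity into an
    inequality.\<close>
  have "(1 / \<beta>) ^ b * survive_gf b \<beta> (Suc n) (1 / \<beta>)
      \<le> survive_gf b \<beta> n (1 / \<beta>) * exp (\<beta> * real b * (1 / \<beta> - 1))"
    using survive_gf_Suc[of \<beta> b n "1 / \<beta>"] assms
      sum_nonneg[of "{..<b}" "\<lambda>j. walk_step b \<beta> n j * (1 / \<beta>) ^ j"] walk_step_nonneg[of \<beta> b n]
    by (simp del: survive.simps)
  also have "\<beta> * real b * (1 / \<beta> - 1) = real b * (1 - \<beta>)"
    using assms by (simp add: field_simps)
  finally have "survive_gf b \<beta> (Suc n) (1 / \<beta>) \<le> survive_gf b \<beta> n (1 / \<beta>) * load_ratio b \<beta>"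
    using assms exp_of_nat_mult[of b "1 - \<beta>"]
    by (simp add: load_ratio_def power_mult_distrib power_one_over field_simps)
  also have "\<dots> \<le> load_ratio b \<beta> ^ n * load_ratio b \<beta>"
    using Suc load_ratio_pos[OF assms] by (intro mult_right_mono) (auto simp: less_imp_le)
  finally show ?case by (simp add: mult.commute)
qed

lemma survival_le:
  assumes "0 < \<beta>" "\<beta> < 1"
  shows "survival b \<beta> n \<le> load_ratio b \<beta> ^ n"
  using norm_survive_gf_le[of \<beta> "1::real" "1 / \<beta>" b n] survive_gf_tilted_le[of \<beta> b n] assms
    survival_nonneg[of \<beta> b n]
  by (simp add: survival_eq_gf)

lemma summable_survival:
  fixes q :: "'a::{real_normed_field,banach}"
  assumes "0 < \<beta>" "\<beta> < 1" "norm q * load_ratio b \<beta> < 1"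
  shows "summable (\<lambda>n. norm (of_real (survival b \<beta> n) * q ^ n))"
proof (rule summable_comparison_test)
  show "summable (\<lambda>n. (norm q * load_ratio b \<beta>) ^ n)"
    using assms load_ratio_pos[of \<beta> b] by (intro summable_geometric) (simp add: abs_mult)
  show "\<exists>N. \<forall>n\<ge>N. norm (norm (of_real (survival b \<beta> n) * q ^ n)) \<le> (norm q * load_ratio b \<beta>) ^ n"
  proof (intro exI[of _ 0] allI impI)
    fix n
    have "norm (norm (of_real (survival b \<beta> n) * q ^ n)) = survival b \<beta> n * norm q ^ n"
      using survival_nonneg[of \<beta> b n] assms by (simp add: norm_mult norm_power)
    also have "\<dots> \<le> load_ratio b \<beta> ^ n * norm q ^ n"
      by (intro mult_right_mono survival_le assms) auto
    finally show "norm (norm (of_real (survival b \<beta> n) * q ^ n)) \<le> (norm q * load_ratio b \<beta>) ^ n"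
      by (simp add: power_mult_distrib mult.commute)
  qed
qed

lemma summable_walk_step:
  fixes q :: complex
  assumes \<beta>: "0 < \<beta>" "\<beta> < 1" and q: "norm q * load_ratio b \<beta> < 1" and j: "j < b"
  shows "summable (\<lambda>n. q ^ Suc n * of_real (walk_step b \<beta> n j))"
proof (rule summable_comparison_test)
  show "summable (\<lambda>n. norm q * norm (of_real (survival b \<beta> n) * q ^ n))"
    by (intro summable_mult summable_survival[OF assms(1-3)])
  show "\<exists>N. \<forall>n\<ge>N. norm (q ^ Suc n * of_real (walk_step b \<beta> n j))
      \<le> norm q * norm (of_real (survival b \<beta> n) * q ^ n)"
  proof (intro exI[of _ 0] allI impI)
    fix n
    have "norm (q ^ Suc n * of_real (walk_step b \<beta> n j)) = norm q ^ Suc n * walk_step b \<beta> n j"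
      using walk_step_nonneg[of \<beta> b n j] \<beta> by (simp add: norm_mult norm_power)
    also have "\<dots> \<le> norm q ^ Suc n * survival b \<beta> n"
      using \<beta> by (intro mult_left_mono walk_step_le_survival[OF _ j]) auto
    also have "\<dots> = norm q * norm (of_real (survival b \<beta> n) * q ^ n)"
      using survival_nonneg[of \<beta> b n] \<beta> by (simp add: norm_mult norm_power)
    finally show "norm (q ^ Suc n * of_real (walk_step b \<beta> n j))
      \<le> norm q * norm (of_real (survival b \<beta> n) * q ^ n)" .
  qed
qed

text \<open>A root \<open>z\<close> of \<open>z\<^sup>b = q exp (b \<beta> (z - 1))\<close> turns \<open>q\<^sup>n z\<^bsup>S n\<^esup>\<close> into a martingale;
  optional stopping at the first negative position of the walk gives a polynomial equation for \<open>z\<close>.\<close>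

lemma kernel_equation:
  fixes z q :: complex
  assumes \<beta>: "0 < \<beta>" "\<beta> < 1" and q: "norm q * load_ratio b \<beta> < 1" and z: "norm z \<le> 1 / \<beta>"
    and root: "z ^ b = q * exp (of_real (\<beta> * real b) * (z - 1))"
  shows "z ^ b = (\<Sum>j<b. (\<Sum>n. q ^ Suc n * of_real (walk_step b \<beta> n j)) * z ^ j)"
proof -
  \<comment> \<open>The part of the martingale carried by the paths with \<open>\<tau> > n\<close>,
    multiplied by \<open>z ^ b\<close>. Its decrements are the contributions of the paths stopped at
    time \<open>n + 1\<close>.\<close>
  define a where "a n = q ^ n * z ^ b * survive_gf b \<beta> n z" for n
  have diff: "a n - a (Suc n) = (\<Sum>j<b. q ^ Suc n * of_real (walk_step b \<beta> n j) * z ^ j)" for n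
  proof -
    have "a n = q ^ Suc n * (survive_gf b \<beta> n z * exp (of_real (\<beta> * real b) * (z - 1)))"
      unfolding a_def root by simp
    also have "\<dots> = a (Suc n) + q ^ Suc n * (\<Sum>j<b. of_real (walk_step b \<beta> n j) * z ^ j)"
      using \<beta> by (subst survive_gf_Suc) (auto simp: a_def algebra_simps simp del: survive.simps)
    finally show ?thesis by (simp add: sum_distrib_left mult_ac)
  qed
  \<comment> \<open>As \<open>norm z \<le> 1 / \<beta>\<close>, the tilted bound applies and the
    surviving part decays like \<open>(norm q * load_ratio b \<beta>) ^ n\<close>.\<close>
  have "a \<longlonglongrightarrow> 0"
  proof (rule tendsto_norm_zero_cancel, rule tendsto_sandwich[OF _ _ tendsto_const])
    have "(\<lambda>n. (norm q * load_ratio b \<beta>) ^ n) \<longlonglongrightarrow> 0"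
      using q load_ratio_pos[OF \<beta>(1), of b] by (intro LIMSEQ_realpow_zero) auto
    then show "(\<lambda>n. norm z ^ b * (norm q * load_ratio b \<beta>) ^ n) \<longlonglongrightarrow> 0"
      by (rule tendsto_mult_right_zero)
    show "\<forall>\<^sub>F n in sequentially. norm (a n) \<le> norm z ^ b * (norm q * load_ratio b \<beta>) ^ n"
    proof (rule always_eventually, rule allI)
      fix n
      have "norm (survive_gf b \<beta> n z) \<le> load_ratio b \<beta> ^ n"
        using norm_survive_gf_le[OF _ z, of \<beta> b n] survive_gf_tilted_le[OF \<beta>(1), of b n] \<beta> by simp
      then have "norm (a n) \<le> norm q ^ n * norm z ^ b * load_ratio b \<beta> ^ n"
        unfolding a_def norm_mult norm_power by (intro mult_left_mono) auto
      then show "norm (a n) \<le> norm z ^ b * (norm q * load_ratio b \<beta>) ^ n"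
        by (simp add: power_mult_distrib mult_ac)
    qed
  qed simp
  then have "(\<lambda>n. a n - a (Suc n)) sums (a 0 - 0)"
    by (rule telescope_sums')
  then have "z ^ b = (\<Sum>n. \<Sum>j<b. q ^ Suc n * of_real (walk_step b \<beta> n j) * z ^ j)"
    using \<beta> unfolding diff by (simp add: sums_iff a_def survive_gf_0)
  also have "\<dots> = (\<Sum>j<b. \<Sum>n. q ^ Suc n * of_real (walk_step b \<beta> n j) * z ^ j)"
    by (intro suminf_sum summable_mult2 summable_walk_step[OF \<beta> q]) auto
  also have "\<dots> = (\<Sum>j<b. (\<Sum>n. q ^ Suc n * of_real (walk_step b \<beta> n j)) * z ^ j)"
    by (intro sum.cong refl suminf_mult2[symmetric] summable_walk_step[OF \<beta> q]) auto
  finally show ?thesis .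
qed

text \<open>The difference of two monic polynomials of degree \<open>b\<close> has degree below
  \<open>b\<close>, so \<open>b\<close> distinct common roots force it to vanish.\<close>

lemma monic_poly_eq_prod_roots:
  fixes c :: "nat \<Rightarrow> complex"
  assumes inj: "inj_on \<zeta> {..<b}"
    and root: "\<And>l. l < b \<Longrightarrow> \<zeta> l ^ b = (\<Sum>j<b. c j * \<zeta> l ^ j)"
  shows "x ^ b - (\<Sum>j<b. c j * x ^ j) = (\<Prod>l<b. x - \<zeta> l)"
proof -
  define P where "P = monom 1 b - (\<Sum>j<b. monom (c j) j)"
  define Q where "Q = (\<Prod>l<b. [:- \<zeta> l, 1:])"
  have P: "poly P y = y ^ b - (\<Sum>j<b. c j * y ^ j)" for y
    by (simp add: P_def poly_sum poly_monom)
  have Q: "poly Q y = (\<Prod>l<b. y - \<zeta> l)" for y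
    by (simp add: Q_def poly_prod)
  have degQ: "degree Q = b"
    unfolding Q_def by (subst degree_prod_eq_sum_degree) auto
  have leadQ: "coeff Q b = 1"
  proof -
    have "lead_coeff Q = 1" unfolding Q_def by (subst lead_coeff_prod) auto
    then show ?thesis by (simp add: degQ)
  qed
  have "P = Q"
  proof (rule ccontr)
    assume "P \<noteq> Q"
    then have nz: "P - Q \<noteq> 0" by simp
    have coeff0: "coeff (P - Q) i = 0" if "i \<ge> b" for i
      using that leadQ degQ by (cases "i = b") (auto simp: P_def coeff_sum coeff_eq_0)
    have deg: "degree (P - Q) < b"
    proof (rule ccontr)
      assume "\<not> degree (P - Q) < b"
      with coeff0[of "degree (P - Q)"] nz show False by (simp del: coeff_diff)
    qed
    have "\<zeta> ` {..<b} \<subseteq> {x. poly (P - Q) x = 0}"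
      by (auto simp: P Q root intro!: prod_zero)
    then have "card (\<zeta> ` {..<b}) \<le> card {x. poly (P - Q) x = 0}"
      by (intro card_mono poly_roots_finite nz)
    also have "\<dots> \<le> degree (P - Q)"
      by (rule card_poly_roots_bound[OF nz])
    finally have "b \<le> degree (P - Q)" using inj by (simp add: card_image)
    with deg show False by simp
  qed
  then show ?thesis unfolding P[symmetric] Q[symmetric] by simp
qed

section \<open>The roots of the kernel equation and the product formula\<close>

lemma omega_power_eq_1: "b \<ge> 1 \<Longrightarrow> omega b ^ b = 1"
  by (simp add: omega_def exp_of_nat_mult[symmetric])

lemma norm_omega_power: "norm (omega b ^ l) = 1"
  by (simp add: omega_def norm_power)

lemma inj_omega_power:
  assumes "b \<ge> 1" shows "inj_on (\<lambda>l. omega b ^ l) {..<b}"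
proof (rule inj_onI)
  fix k l assume kl: "k \<in> {..<b}" "l \<in> {..<b}" "omega b ^ k = omega b ^ l"
  have "omega b ^ k = exp (2 * of_real pi * \<i> * of_nat k / of_nat b)" for k
    by (simp add: omega_def exp_of_nat_mult[symmetric] mult_ac)
  with kl complex_root_unity_eq[of b k l] assms show "k = l" by simp
qed

text \<open>For \<open>|w| < exp (\<beta> - 1) / \<beta>\<close> the roots of the kernel equation with \<open>q = w\<^sup>b\<close> are the numbers \<open>\<zeta>\<close>.\<close>

theorem survival_gf_product:
  fixes w :: complex
  assumes \<beta>: "0 < \<beta>" "\<beta> < 1" and b: "b \<ge> 1" and w: "norm w < exp (\<beta> - 1) / \<beta>"
  shows "norm (w ^ b) * load_ratio b \<beta> < 1"
    and "(1 - w ^ b) * (\<Sum>n. of_real (survival b \<beta> n) * (w ^ b) ^ n)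
       = (\<Prod>l<b. 1 - tree_T (omega b ^ l * of_real (\<beta> * exp (- \<beta>)) * w) / of_real \<beta>)"
proof -
  have "norm w * (\<beta> * exp (1 - \<beta>)) < 1"
    using w \<beta> by (simp add: exp_diff field_simps)
  moreover have "0 \<le> norm w * (\<beta> * exp (1 - \<beta>))" using \<beta> by simp
  ultimately have "(norm w * (\<beta> * exp (1 - \<beta>))) ^ b < 1"
    using b by (subst power_less_one_iff) auto
  then show q: "norm (w ^ b) * load_ratio b \<beta> < 1"
    by (simp add: load_ratio_def norm_power power_mult_distrib)
  define q where "q = w ^ b"
  define W where "W l = omega b ^ l * of_real (\<beta> * exp (- \<beta>)) * w" for l
  define \<zeta> where "\<zeta> l = tree_T (W l) / of_real \<beta>" for l
  have normW: "norm (W l) < exp (-1)" for l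
  proof -
    have "norm (W l) = \<beta> * exp (- \<beta>) * norm w"
      unfolding W_def norm_mult norm_omega_power norm_of_real using \<beta> by simp
    also have "\<dots> < \<beta> * exp (- \<beta>) * (exp (\<beta> - 1) / \<beta>)"
      using w \<beta> by (intro mult_strict_left_mono) auto
    also have "\<dots> = exp (-1)"
      using \<beta> by (simp add: exp_add[symmetric])
    finally show ?thesis .
  qed
  have eq: "of_real \<beta> * \<zeta> l = tree_T (W l)" for l
    using \<beta> by (simp add: \<zeta>_def)
  have z1: "norm (\<zeta> l) \<le> 1 / \<beta>" for l
    using norm_tree_T_less_1(1)[OF normW, of l] \<beta> by (simp add: \<zeta>_def norm_divide divide_right_mono)
  have root: "\<zeta> l ^ b = q * exp (of_real (\<beta> * real b) * (\<zeta> l - 1))" for l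
  proof -
    have "of_real \<beta> * \<zeta> l = W l * exp (of_real \<beta> * \<zeta> l)"
      using tree_T_equation[OF normW, of l] unfolding eq by (simp add: exp_minus field_simps)
    also have "\<dots> = of_real \<beta> * (omega b ^ l * w * exp (of_real \<beta> * (\<zeta> l - 1)))"
    proof -
      have "W l = omega b ^ l * w * of_real \<beta> * exp (- of_real \<beta>)"
        by (simp add: W_def exp_of_real[symmetric])
      moreover have "exp (of_real \<beta> * (\<zeta> l - 1)) = exp (- of_real \<beta>) * exp (of_real \<beta> * \<zeta> l)"
        by (simp add: exp_add[symmetric] algebra_simps)
      ultimately show ?thesis by simp
    qed
    finally have "\<zeta> l = omega b ^ l * w * exp (of_real \<beta> * (\<zeta> l - 1))"
      using \<beta> by simp
    \<comment> \<open>The \<open>b\<close>-th power removes \<open>omega b ^ l\<close>, so all the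
      \<open>\<zeta> l\<close> solve one and the same equation.\<close>
    then have "\<zeta> l ^ b = (omega b ^ l * w * exp (of_real \<beta> * (\<zeta> l - 1))) ^ b" by simp
    also have "\<dots> = (omega b ^ b) ^ l * q * exp (of_nat b * (of_real \<beta> * (\<zeta> l - 1)))"
      by (simp add: q_def power_mult_distrib exp_of_nat_mult power_mult[symmetric] mult.commute)
    finally show ?thesis using b by (simp add: omega_power_eq_1 mult_ac)
  qed
  have smq: "summable (\<lambda>n. of_real (survival b \<beta> n) * q ^ n)"
    using q by (intro summable_norm_cancel[OF summable_survival[OF \<beta>]]) (simp add: q_def)
  have smq': "summable (\<lambda>n. of_real (survival b \<beta> (Suc n)) * q ^ Suc n)"
    using summable_ignore_initial_segment[OF smq, of 1] by simp
  show "(1 - w ^ b) * (\<Sum>n. of_real (survival b \<beta> n) * (w ^ b) ^ n)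
       = (\<Prod>l<b. 1 - tree_T (omega b ^ l * of_real (\<beta> * exp (- \<beta>)) * w) / of_real \<beta>)"
  \<comment> \<open>At \<open>w = 0\<close> all roots coincide and counting distinct roots fails,
    but both sides are 1.\<close>
  proof (cases "w = 0")
    case True
    have T0: "tree_T 0 = 0" using tree_T_equation[of 0] by simp
    have "(\<Sum>n. of_real (survival b \<beta> n) * (w ^ b) ^ n) = (\<Sum>n\<in>{0}. complex_of_real (survival b \<beta> n) * 0 ^ n)"
      using True b by (subst suminf_finite[of "{0}"]) (auto simp: zero_power)
    then show ?thesis using True b \<beta> by (simp add: survival_0 T0 zero_power)
  next
    case False
    \<comment> \<open>The functional equation recovers \<open>W l\<close> from
      \<open>tree_T (W l)\<close>, so distinct arguments have distinct values.\<close>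
    have inj: "inj_on \<zeta> {..<b}"
    proof (rule inj_onI)
      fix k l assume kl: "k \<in> {..<b}" "l \<in> {..<b}" "\<zeta> k = \<zeta> l"
      then have "tree_T (W k) = tree_T (W l)"
        unfolding eq[symmetric] by (simp only:)
      then have "tree_T (W k) * exp (- tree_T (W k)) = tree_T (W l) * exp (- tree_T (W l))"
        by (simp only:)
      then have "W k = W l"
        unfolding tree_T_equation[OF normW] .
      then have "omega b ^ k = omega b ^ l" using False \<beta> by (simp add: W_def)
      then show "k = l" using inj_omega_power[OF b] kl by (auto dest: inj_onD)
    qed
    define c where "c j = (\<Sum>n. q ^ Suc n * of_real (walk_step b \<beta> n j))" for j
    \<comment> \<open>The monic polynomial at 1. The sum of its coefficients \<open>c j\<close>
      collects \<open>q ^ Suc n\<close> over all ways of being killed at time \<open>n + 1\<close>,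
      that is, the mean of \<open>q\<close> to the power \<tau>.\<close>
    have "(\<Prod>l<b. 1 - \<zeta> l) = 1 - (\<Sum>j<b. c j)"
      using monic_poly_eq_prod_roots[OF inj, of c 1] kernel_equation[OF \<beta> _ z1 root] q
      by (simp add: c_def q_def)
    also have "(\<Sum>j<b. c j) = (\<Sum>n. \<Sum>j<b. q ^ Suc n * of_real (walk_step b \<beta> n j))"
      unfolding c_def using q by (intro suminf_sum[symmetric] summable_walk_step[OF \<beta>]) (auto simp: q_def)
    also have "\<dots> = (\<Sum>n. q * (of_real (survival b \<beta> n) * q ^ n) - of_real (survival b \<beta> (Suc n)) * q ^ Suc n)"
    proof (rule suminf_cong)
      fix n
      have "(\<Sum>j<b. q ^ Suc n * complex_of_real (walk_step b \<beta> n j))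
         = q ^ Suc n * of_real (survival b \<beta> n - survival b \<beta> (Suc n))"
        using \<beta> by (simp add: survival_diff sum_distrib_left)
      then show "(\<Sum>j<b. q ^ Suc n * complex_of_real (walk_step b \<beta> n j))
         = q * (of_real (survival b \<beta> n) * q ^ n) - of_real (survival b \<beta> (Suc n)) * q ^ Suc n"
        by (simp add: algebra_simps)
    qed
    also have "\<dots> = q * (\<Sum>n. of_real (survival b \<beta> n) * q ^ n) - (\<Sum>n. of_real (survival b \<beta> (Suc n)) * q ^ Suc n)"
      unfolding suminf_mult[OF smq, symmetric]
      by (rule suminf_diff[symmetric, OF summable_mult[OF smq] smq'])
    also have "(\<Sum>n. of_real (survival b \<beta> (Suc n)) * q ^ Suc n) = (\<Sum>n. of_real (survival b \<beta> n) * q ^ n) - 1"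
      using suminf_split_head[OF smq] \<beta> by (simp add: survival_0)
    finally show ?thesis
      by (simp add: q_def \<zeta>_def W_def algebra_simps)
  qed
qed

text \<open>At \<open>q = 1\<close> the product formula reads \<open>0 = 0\<close>, because the root
  with \<open>l = 0\<close> is 1. Along \<open>q = s u ^ b\<close> with
  \<open>s u = u * exp (\<beta> - u) / \<beta>\<close> this root equals \<open>u / \<beta>\<close>;
  dividing by \<open>1 - u / \<beta>\<close> and letting \<open>u\<close> tend to \<beta> turns
  \<open>1 - q\<close> into the factor \<open>b * (1 - \<beta>)\<close>.\<close>

lemma survival_sum_eq:
  assumes \<beta>: "0 < \<beta>" "\<beta> < 1" and b: "b \<ge> 1"
  shows "of_real (real b * (1 - \<beta>)) * (\<Sum>n. of_real (survival b \<beta> n))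
     = (\<Prod>l=1..<b. 1 - tree_T (omega b ^ l * of_real (\<beta> * exp (- \<beta>))) / of_real \<beta>)"
proof -
  define s where "s u = u * exp (\<beta> - u) / \<beta>" for u :: real
  define V where "V q = (\<Sum>n. complex_of_real (survival b \<beta> n) * q ^ n)" for q
  define P where "P w = (\<Prod>l=1..<b. 1 - tree_T (omega b ^ l * of_real (\<beta> * exp (- \<beta>)) * w) / of_real \<beta>)" for w :: complex
  let ?F = "at_left \<beta>"
  have s\<beta>: "s \<beta> = 1" using \<beta> by (simp add: s_def)
  have "isCont s \<beta>" unfolding s_def using \<beta> by (intro continuous_intros) auto
  then have slim: "(s \<longlongrightarrow> 1) ?F"
    unfolding isCont_def s\<beta> by (rule filterlim_mono) (auto simp: at_le)
  have wlim: "((\<lambda>u. complex_of_real (s u)) \<longlongrightarrow> 1) ?F"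
    using tendsto_of_real[OF slim] by simp
  have qlim: "((\<lambda>u. complex_of_real (s u) ^ b) \<longlongrightarrow> 1) ?F"
    using tendsto_power[OF wlim, of b] by simp
  have lr: "load_ratio b \<beta> < 1" "0 < load_ratio b \<beta>"
    using load_ratio_less_1[OF \<beta> b] load_ratio_pos[OF \<beta>(1)] by auto
  have "isCont V 1"
    unfolding V_def
  proof (rule isCont_powser)
    \<comment> \<open>A radius of convergence beyond 1: the midpoint between 1 and
      \<open>1 / load_ratio b \<beta>\<close>.\<close>
    let ?K = "complex_of_real ((1 / load_ratio b \<beta> + 1) / 2)"
    have K: "norm ?K = (1 / load_ratio b \<beta> + 1) / 2" using lr by (simp only: norm_of_real) simp
    then show "norm (1::complex) < norm ?K" unfolding K using lr by (simp add: field_simps)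
    have "norm ?K * load_ratio b \<beta> < 1" unfolding K using lr by (simp add: field_simps)
    then show "summable (\<lambda>n. complex_of_real (survival b \<beta> n) * ?K ^ n)"
      by (rule summable_norm_cancel[OF summable_survival[OF \<beta>]])
  qed
  then have Vlim: "((\<lambda>u. V (complex_of_real (s u) ^ b)) \<longlongrightarrow> V 1) ?F"
    using qlim by (rule isCont_tendsto_compose)
  have Plim: "((\<lambda>u. P (complex_of_real (s u))) \<longlongrightarrow> P 1) ?F"
    unfolding P_def
  proof (intro tendsto_intros)
    fix l
    let ?c = "omega b ^ l * complex_of_real (\<beta> * exp (- \<beta>))"
    have "norm ?c < exp (-1)"
      unfolding norm_mult norm_omega_power norm_of_real using mult_exp_neg_strict_mono[of \<beta> 1] \<beta> by simp
    then have "isCont tree_T (?c * 1)"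
      using tree_T_continuous by (intro continuous_on_interior[of "ball 0 (exp (-1))"]) (auto simp: interior_open)
    then show "((\<lambda>u. tree_T (?c * complex_of_real (s u))) \<longlongrightarrow> tree_T (?c * 1)) ?F"
      by (rule isCont_tendsto_compose) (intro tendsto_intros wlim)
  qed (use \<beta> in auto)
  have "((\<lambda>u. 1 - s u ^ b) has_real_derivative - (real b * (1 / \<beta> - 1))) (at \<beta>)"
  proof -
    have "(s has_real_derivative 1 / \<beta> - 1) (at \<beta>)"
      unfolding s_def using \<beta> by (auto intro!: derivative_eq_intros simp: field_simps)
    from DERIV_diff[OF DERIV_const[of 1] DERIV_power[OF this, of b]] show ?thesis
      by (simp add: s\<beta>)
  qed
  then have "((\<lambda>u. 1 - s u ^ b) has_real_derivative - (real b * (1 / \<beta> - 1))) (at_left \<beta>)"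
    by (rule DERIV_subset) simp
  \<comment> \<open>As \<open>s \<beta> = 1\<close>, this is the difference quotient at \<beta>;
    times \<open>- \<beta>\<close> it becomes
    \<open>(1 - s u ^ b) / (1 - u / \<beta>)\<close>.\<close>
  then have "((\<lambda>u. (1 - s u ^ b) / (u - \<beta>)) \<longlongrightarrow> - (real b * (1 / \<beta> - 1))) ?F"
    by (simp add: has_field_derivative_iff s\<beta>)
  then have "((\<lambda>u. - \<beta> * ((1 - s u ^ b) / (u - \<beta>))) \<longlongrightarrow> - \<beta> * - (real b * (1 / \<beta> - 1))) ?F"
    by (rule tendsto_mult_left)
  also have "- \<beta> * - (real b * (1 / \<beta> - 1)) = real b * (1 - \<beta>)" using \<beta> by (simp add: field_simps)
  finally have Dlim: "((\<lambda>u. complex_of_real (- \<beta> * ((1 - s u ^ b) / (u - \<beta>)))) \<longlongrightarrow> of_real (real b * (1 - \<beta>))) ?F"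
    by (rule tendsto_of_real)
  have "\<forall>\<^sub>F u in ?F. u \<in> {0<..<\<beta>}"
    using \<beta> by (intro eventually_at_left_real) auto
  then have "\<forall>\<^sub>F u in ?F. complex_of_real (- \<beta> * ((1 - s u ^ b) / (u - \<beta>))) * V (complex_of_real (s u) ^ b)
     = P (complex_of_real (s u))"
  proof eventually_elim
    case (elim u)
    have su: "\<beta> * exp (- \<beta>) * s u = u * exp (- u)"
      using \<beta> by (simp add: s_def exp_diff exp_minus field_simps)
    have su0: "0 < s u" using elim \<beta> by (simp add: s_def)
    have "\<beta> * exp (- \<beta>) * s u < exp (-1)"
      unfolding su using mult_exp_neg_strict_mono[of u 1] elim \<beta> by simp
    then have "norm (complex_of_real (s u)) < exp (\<beta> - 1) / \<beta>"
      using \<beta> su0 by (simp add: exp_diff exp_minus field_simps)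
    from survival_gf_product(2)[OF \<beta> b this]
    have "(1 - of_real (s u) ^ b) * V (of_real (s u) ^ b)
       = (\<Prod>l<b. 1 - tree_T (omega b ^ l * of_real (\<beta> * exp (- \<beta>)) * of_real (s u)) / of_real \<beta>)"
      by (simp add: V_def)
    also have "{..<b} = insert 0 {1..<b}" using b by auto
    also have "(\<Prod>l\<in>insert 0 {1..<b}. 1 - tree_T (omega b ^ l * of_real (\<beta> * exp (- \<beta>)) * of_real (s u)) / of_real \<beta>)
       = (1 - tree_T (of_real (\<beta> * exp (- \<beta>) * s u)) / of_real \<beta>) * P (of_real (s u))"
      by (simp add: P_def)
    also have "tree_T (of_real (\<beta> * exp (- \<beta>) * s u)) = of_real u"
      unfolding su using elim \<beta> mult_exp_neg_strict_mono[of u 1]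
      by (subst tree_T_of_real(1)) (auto simp: tree_real_inverse)
    also have "1 - complex_of_real u / of_real \<beta> = of_real ((\<beta> - u) / \<beta>)"
      using \<beta> by (simp add: field_simps)
    finally have *: "(1 - of_real (s u) ^ b) * V (of_real (s u) ^ b) = of_real ((\<beta> - u) / \<beta>) * P (of_real (s u))" .
    have "complex_of_real (- \<beta> * ((1 - s u ^ b) / (u - \<beta>))) * V (complex_of_real (s u) ^ b)
       = of_real (\<beta> / (\<beta> - u)) * ((1 - of_real (s u) ^ b) * V (of_real (s u) ^ b))"
      using elim by (simp add: divide_simps) (simp add: algebra_simps)
    also have "\<dots> = P (complex_of_real (s u))"
      unfolding * using elim \<beta> by (simp add: divide_simps)
    finally show ?case .
  qed
  then have "((\<lambda>u. P (complex_of_real (s u))) \<longlongrightarrow> of_real (real b * (1 - \<beta>)) * V 1) ?F"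
    using tendsto_mult[OF Dlim Vlim] by (rule Lim_transform_eventually[rotated])
  then have "of_real (real b * (1 - \<beta>)) * V 1 = P 1"
    using Plim by (rule tendsto_unique[rotated]) simp
  then show ?thesis by (simp add: V_def P_def)
qed

section \<open>Measurability of the walk in \<beta>\<close>

lemma continuous_survive: "continuous_on UNIV (\<lambda>\<beta>. survive b \<beta> n s)"
  by (induction n arbitrary: s) (auto simp: pois_def intro!: continuous_intros)

lemma measurable_survival [measurable]: "(\<lambda>\<beta>. survival b \<beta> n) \<in> borel_measurable borel"
proof -
  have [measurable]: "(\<lambda>\<beta>. survive b \<beta> n s) \<in> borel_measurable borel" for s
    by (rule borel_measurable_continuous_onI[OF continuous_survive])
  show ?thesis unfolding survival_def by measurable
qed

section \<open>The infinite Poisson model\<close>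

text \<open>Windows are lists read backwards from bucket \<open>i\<close>: shorter windows with the
  same end are prefixes, \<open>drop\<close> moves the end to the left, and independent counts have
  the law \<open>replicate_pmf\<close>.\<close>

definition past :: "(int \<Rightarrow> nat) \<Rightarrow> int \<Rightarrow> nat \<Rightarrow> nat list" where
  "past X i w = map (\<lambda>t. X (i - int t)) [0..<w]"

definition win :: "(int \<Rightarrow> nat) \<Rightarrow> int \<Rightarrow> nat \<Rightarrow> nat" where
  "win X i l = sum_list (past X i l)"

text \<open>When the supremum in \<open>H\<close> is finite, \<open>H b X i \<ge> b\<close> says
  that some window ending at \<open>i\<close> holds at least \<open>b\<close> keys per bucket. In
  this form fullness makes sense for any counts on the integers, in particular for periodic
  ones.\<close>

definition overfull :: "nat \<Rightarrow> (int \<Rightarrow> nat) \<Rightarrow> int \<Rightarrow> bool" where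
  "overfull b X i \<longleftrightarrow> (\<exists>l\<ge>1. b * l \<le> win X i l)"

definition overfull_upto :: "nat \<Rightarrow> nat \<Rightarrow> (int \<Rightarrow> nat) \<Rightarrow> int \<Rightarrow> bool" where
  "overfull_upto b L X i \<longleftrightarrow> (\<exists>l\<in>{1..L}. b * l \<le> win X i l)"

definition run :: "nat \<Rightarrow> nat \<Rightarrow> (int \<Rightarrow> nat) \<Rightarrow> int \<Rightarrow> bool" where
  "run b k X h \<longleftrightarrow> (\<forall>i<k. overfull b X (h + int i))"

definition run_upto :: "nat \<Rightarrow> nat \<Rightarrow> nat \<Rightarrow> (int \<Rightarrow> nat) \<Rightarrow> int \<Rightarrow> bool" where
  "run_upto b L k X h \<longleftrightarrow> (\<forall>i<k. overfull_upto b L X (h + int i))"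

text \<open>\<open>run_upto\<close> as a predicate on the finite list of the \<open>k + L\<close>
  counts read backwards from the last bucket of the run; bucket \<open>h + i\<close> sits at
  position \<open>k - 1 - i\<close>.\<close>

definition list_run :: "nat \<Rightarrow> nat \<Rightarrow> nat \<Rightarrow> nat list \<Rightarrow> bool" where
  "list_run b L k ys \<longleftrightarrow> (\<forall>i<k. \<exists>l\<in>{1..L}. b * l \<le> sum_list (take l (drop (k - 1 - i) ys)))"

text \<open>The most recent increment is the head of the list.\<close>

primrec stays :: "nat \<Rightarrow> nat list \<Rightarrow> bool" where
  "stays b [] = True"
| "stays b (x # xs) \<longleftrightarrow> stays b xs \<and> b * Suc (length xs) \<le> x + sum_list xs"

section \<open>Windows and runs for arbitrary counts\<close>

lemma length_past [simp]: "length (past X i w) = w"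
  by (simp add: past_def)

lemma past_add: "past X i (a + c) = past X i a @ past X (i - int a) c"
  by (rule nth_equalityI) (auto simp: past_def nth_append intro!: arg_cong[of _ _ X])

lemma past_Suc: "past X i (Suc w) = X i # past X (i - 1) w"
  using past_add[of X i 1 w] by (simp add: past_def)

lemma take_past: "l \<le> w \<Longrightarrow> take l (past X i w) = past X i l"
  using past_add[of X i l "w - l"] by simp

lemma drop_past: "l \<le> w \<Longrightarrow> drop l (past X i w) = past X (i - int l) (w - l)"
  using past_add[of X i l "w - l"] by simp

lemma win_add: "win X i (a + c) = win X i a + win X (i - int a) c"
  by (simp add: win_def past_add)

lemma overfull_iff_upto: "overfull b X i \<longleftrightarrow> (\<exists>L. overfull_upto b L X i)"
  unfolding overfull_def overfull_upto_def by (meson atLeastAtMost_iff order_refl)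

lemma overfull_upto_mono: "overfull_upto b L X i \<Longrightarrow> L \<le> L' \<Longrightarrow> overfull_upto b L' X i"
  unfolding overfull_upto_def by auto

lemma run_upto_mono: "run_upto b L k X h \<Longrightarrow> L \<le> L' \<Longrightarrow> run_upto b L' k X h"
  unfolding run_upto_def using overfull_upto_mono by blast

lemma run_upto_imp_run: "run_upto b L k X h \<Longrightarrow> run b k X h"
  unfolding run_upto_def run_def using overfull_iff_upto by blast

lemma run_iff_upto: "run b k X h \<longleftrightarrow> (\<exists>L. run_upto b L k X h)"
proof
  assume "run b k X h"
  then have "\<forall>i\<in>{..<k}. \<exists>L. overfull_upto b L X (h + int i)"
    by (auto simp: run_def overfull_iff_upto)
  then obtain L where L: "\<And>i. i < k \<Longrightarrow> overfull_upto b (L i) X (h + int i)"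
    by (metis lessThan_iff)
  have "run_upto b (\<Sum>i<k. L i) k X h"
    unfolding run_upto_def
    by (auto intro!: overfull_upto_mono[OF L] member_le_sum)
  then show "\<exists>L. run_upto b L k X h" ..
qed (auto intro: run_upto_imp_run)

lemma run_upto_iff_list_run: "run_upto b L k X h \<longleftrightarrow> list_run b L k (past X (h + int k - 1) (k + L))"
proof -
  have "sum_list (take l (drop (k - 1 - i) (past X (h + int k - 1) (k + L)))) = win X (h + int i) l"
    if "i < k" "l \<in> {1..L}" for i l
    using that by (simp add: drop_past take_past win_def of_nat_diff algebra_simps)
  then show ?thesis
    unfolding run_upto_def overfull_upto_def list_run_def
    by (intro all_cong1 imp_cong bex_cong) auto
qed

text \<open>The window of the last bucket either covers the run or leaves a shorter run on its left,
  whose window is glued to it. A long run thus costs one long crowded window, which gives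
  exponential tails.\<close>

lemma run_imp_win:
  assumes "run b k X h" "k \<ge> 1"
  shows "\<exists>N\<ge>k. b * N \<le> win X (h + int k - 1) N"
  using assms
proof (induction k rule: less_induct)
  case (less k)
  have "overfull b X (h + int (k - 1))"
    using less.prems(1)[unfolded run_def, rule_format, of "k - 1"] less.prems(2) by simp
  then obtain l where l: "l \<ge> 1" "b * l \<le> win X (h + int k - 1) l"
    using less.prems by (auto simp: overfull_def of_nat_diff algebra_simps)
  show ?case
  proof (cases "l \<ge> k")
    case False
    have "\<exists>N\<ge>k - l. b * N \<le> win X (h + int (k - l) - 1) N"
      using False l less.prems by (intro less.IH) (auto simp: run_def)
    then obtain N where N: "N \<ge> k - l" "b * N \<le> win X (h + int (k - l) - 1) N" by blast
    then have "b * (l + N) \<le> win X (h + int k - 1) (l + N)"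
    proof -
      have "h + int (k - l) - 1 = h + int k - 1 - int l"
        using False by (simp add: of_nat_diff)
      then have "b * N \<le> win X (h + int k - 1 - int l) N"
        using N(2) by (simp only:)
      then show ?thesis
        using l(2) unfolding win_add distrib_left by (rule add_mono[rotated])
    qed
    then show ?thesis using N by (intro exI[of _ "l + N"]) auto
  qed (use l in auto)
qed

text \<open>A crowded window reaching back beyond bucket 1 can be cut there: its part ending at the
  non-full bucket 0 holds fewer than \<open>b\<close> keys per bucket, so the remaining part is
  crowded as well.\<close>

lemma run_iff_stays:
  assumes "\<not> overfull b X 0"
  shows "run b k X 1 \<longleftrightarrow> stays b (past X (int k) k)"
proof (induction k)
  case 0
  show ?case by (simp add: run_def past_def)
next
  case (Suc k)
  have sum: "X (int (Suc k)) + sum_list (past X (int k) k) = win X (int (Suc k)) (Suc k)"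
    by (simp add: win_def past_Suc)
  have "b * Suc k \<le> win X (int (Suc k)) (Suc k)" if r: "run b (Suc k) X 1"
  proof -
    obtain N where N: "N \<ge> Suc k" "b * N \<le> win X (int (Suc k)) N"
      using run_imp_win[OF r] by auto
    then obtain c where c: "N = Suc k + c" by (metis le_iff_add)
    have N: "b * Suc k + b * c \<le> win X (int (Suc k)) (Suc k) + win X 0 c"
      using N(2) unfolding c win_add distrib_left by (simp only: diff_self)
    have "c = 0 \<or> win X 0 c < b * c"
      using assms unfolding overfull_def not_less[symmetric] by (cases c) auto
    then show ?thesis using N by (auto simp: win_def past_def)
  qed
  moreover have "overfull b X (1 + int k)" if "b * Suc k \<le> win X (int (Suc k)) (Suc k)"
    using that unfolding overfull_def by (intro exI[of _ "Suc k"]) (auto simp: add.commute)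
  moreover have "run b (Suc k) X 1 \<longleftrightarrow> run b k X 1 \<and> overfull b X (1 + int k)"
    by (auto simp: run_def less_Suc_eq)
  ultimately have "run b (Suc k) X 1 \<longleftrightarrow> run b k X 1 \<and> b * Suc k \<le> win X (int (Suc k)) (Suc k)"
    by blast
  moreover have "past X (int (Suc k)) (Suc k) = X (int (Suc k)) # past X (int k) k"
    by (simp add: past_Suc)
  ultimately show ?case
    by (simp only: stays.simps length_past sum Suc.IH)
qed

section \<open>Finite sequences of independent Poisson counts\<close>

lemma pois_eq_pmf: "0 < \<beta> \<Longrightarrow> b \<ge> 1 \<Longrightarrow> pmf (poisson_pmf (\<beta> * real b)) k = pois b \<beta> k"
  by (simp add: pois_def)

lemma replicate_pmf_Suc_pair:
  "replicate_pmf (Suc n) p = map_pmf (\<lambda>(x, xs). x # xs) (pair_pmf p (replicate_pmf n p))"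
  by (simp add: map_pmf_def pair_pmf_def bind_assoc_pmf bind_return_pmf)

lemma replicate_pmf_add_pair:
  "replicate_pmf (m + n) p = map_pmf (\<lambda>(xs, ys). xs @ ys) (pair_pmf (replicate_pmf m p) (replicate_pmf n p))"
  by (simp add: replicate_pmf_distrib map_pmf_def pair_pmf_def bind_assoc_pmf bind_return_pmf)

lemma pmf_replicate_pmf:
  "pmf (replicate_pmf n p) xs = (if length xs = n then \<Prod>t<n. pmf p (xs ! t) else 0)"
proof (induction n arbitrary: xs)
  case 0
  show ?case by (auto simp: pmf_return)
next
  case (Suc n)
  show ?case
  proof (cases xs)
    case Nil
    then have "xs \<notin> set_pmf (replicate_pmf (Suc n) p)" by (auto simp: set_replicate_pmf)
    then show ?thesis using Nil by (simp add: set_pmf_iff del: replicate_pmf.simps)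
  next
    case (Cons y ys)
    have "pmf (replicate_pmf (Suc n) p) ((\<lambda>(x, xs). x # xs) (y, ys)) = pmf p y * pmf (replicate_pmf n p) ys"
      unfolding replicate_pmf_Suc_pair by (subst pmf_map_inj') (auto simp: inj_def pmf_pair)
    then show ?thesis
      using Cons by (simp add: Suc.IH prod.lessThan_Suc_shift del: replicate_pmf.simps prod.lessThan_Suc)
  qed
qed

lemma prob_replicate_pmf_append:
  fixes p :: "'a::countable pmf"
  shows "measure_pmf.prob (replicate_pmf (m + n) p) {xs. P (take m xs) \<and> Q (drop m xs)}
   = measure_pmf.prob (replicate_pmf m p) {xs. P xs} * measure_pmf.prob (replicate_pmf n p) {xs. Q xs}"
proof -
  have "measure_pmf.prob (replicate_pmf (m + n) p) {xs. P (take m xs) \<and> Q (drop m xs)}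
     = measure_pmf.prob (pair_pmf (replicate_pmf m p) (replicate_pmf n p))
         ((\<lambda>(xs, ys). xs @ ys) -` {xs. P (take m xs) \<and> Q (drop m xs)})"
    by (simp add: replicate_pmf_add_pair)
  also have "\<dots> = measure_pmf.prob (pair_pmf (replicate_pmf m p) (replicate_pmf n p)) ({xs. P xs} \<times> {xs. Q xs})"
    by (rule measure_pmf.finite_measure_eq_AE) (auto simp: AE_measure_pmf_iff set_replicate_pmf)
  finally show ?thesis
    by (subst (asm) measure_pmf_prob_product) auto
qed

lemma load_ratio_eq_tilt:
  assumes "0 < \<beta>"
  shows "load_ratio b \<beta> = \<beta> ^ b * exp (\<beta> * real b * (1 / \<beta> - 1))"
proof -
  have "\<beta> * real b * (1 / \<beta> - 1) = real b * (1 - \<beta>)" using assms by (simp add: field_simps)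
  then show ?thesis
    unfolding load_ratio_def by (simp only: power_mult_distrib exp_of_nat_mult)
qed

text \<open>Chernoff's bound: Markov's inequality for \<open>z ^ sum_list xs\<close> with
  \<open>z = 1 / \<beta>\<close>.\<close>

lemma prob_replicate_poisson_ge:
  assumes \<beta>: "0 < \<beta>" "\<beta> < 1" and b: "b \<ge> 1"
  shows "measure_pmf.prob (replicate_pmf n (poisson_pmf (\<beta> * real b))) {xs. b * n \<le> sum_list xs}
     \<le> load_ratio b \<beta> ^ n"
proof -
  let ?p = "poisson_pmf (\<beta> * real b)"
  define z where "z = 1 / \<beta>"
  have z: "z > 1" using \<beta> by (simp add: z_def)
  define E where "E = exp (\<beta> * real b * (z - 1))"
  have E: "E \<ge> 0" by (simp add: E_def)
  have 1: "(\<integral>\<^sup>+x. ennreal (z ^ x) \<partial>measure_pmf ?p) = ennreal E"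
  proof -
    have "(\<lambda>k. pois b \<beta> k * z ^ k) sums E"
      using pois_gf[of b \<beta> z] by (simp add: E_def)
    then have "(\<Sum>k. ennreal (pois b \<beta> k * z ^ k)) = ennreal E"
      using \<beta> z by (intro suminf_ennreal_eq) (auto intro!: mult_nonneg_nonneg pois_nonneg)
    moreover have "(\<integral>\<^sup>+x. ennreal (z ^ x) \<partial>measure_pmf ?p) = (\<Sum>k. ennreal (pois b \<beta> k * z ^ k))"
      using \<beta> b z unfolding nn_integral_measure_pmf nn_integral_count_space_nat
      by (intro suminf_cong) (simp add: pois_eq_pmf ennreal_mult[symmetric] pois_nonneg del: pmf_poisson)
    ultimately show ?thesis by simp
  qed
  have 2: "(\<integral>\<^sup>+xs. ennreal (z ^ sum_list xs) \<partial>measure_pmf (replicate_pmf n ?p)) = ennreal (E ^ n)"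
  proof (induction n)
    case (Suc n)
    have "(\<integral>\<^sup>+xs. ennreal (z ^ sum_list xs) \<partial>measure_pmf (replicate_pmf (Suc n) ?p))
       = (\<integral>\<^sup>+x. \<integral>\<^sup>+xs. ennreal (z ^ x) * ennreal (z ^ sum_list xs) \<partial>measure_pmf (replicate_pmf n ?p) \<partial>measure_pmf ?p)"
      using z by (simp add: nn_integral_bind_pmf power_add ennreal_mult)
    also have "\<dots> = ennreal E * ennreal (E ^ n)"
      by (simp add: nn_integral_cmult Suc nn_integral_multc 1)
    finally show ?case using E by (simp add: ennreal_mult)
  qed simp
  have "ennreal (z ^ (b * n)) * emeasure (measure_pmf (replicate_pmf n ?p)) {xs. b * n \<le> sum_list xs}
     = (\<integral>\<^sup>+xs. ennreal (z ^ (b * n)) * indicator {xs. b * n \<le> sum_list xs} xs \<partial>measure_pmf (replicate_pmf n ?p))"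
    by (subst nn_integral_cmult_indicator) auto
  also have "\<dots> \<le> (\<integral>\<^sup>+xs. ennreal (z ^ sum_list xs) \<partial>measure_pmf (replicate_pmf n ?p))"
    using z by (intro nn_integral_mono) (auto simp: indicator_def intro!: ennreal_leI power_increasing)
  finally have "z ^ (b * n) * measure_pmf.prob (replicate_pmf n ?p) {xs. b * n \<le> sum_list xs} \<le> E ^ n"
    unfolding 2 using z E by (simp add: measure_pmf.emeasure_eq_measure ennreal_mult[symmetric])
  moreover have "load_ratio b \<beta> * z ^ b = E"
    using \<beta> unfolding load_ratio_eq_tilt[OF \<beta>(1)] E_def z_def by (simp add: power_one_over)
  then have "load_ratio b \<beta> ^ n * z ^ (b * n) = E ^ n"
    by (simp only: power_mult power_mult_distrib[symmetric])
  ultimately have "measure_pmf.prob (replicate_pmf n ?p) {xs. b * n \<le> sum_list xs} * z ^ (b * n)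
      \<le> load_ratio b \<beta> ^ n * z ^ (b * n)"
    by (simp add: mult.commute)
  then show ?thesis
    using z by (simp only: mult_le_cancel_right) (auto simp: not_less)
qed

lemma stays_imp_sum: "stays b xs \<Longrightarrow> b * length xs \<le> sum_list xs"
  by (cases xs) auto

text \<open>Conditioning on the most recent increment reproduces the recursion of
  \<open>survive\<close>: from height \<open>r\<close> the height \<open>s\<close> is reached by a
  count of \<open>s + b - r\<close>.\<close>

lemma survive_eq_prob:
  assumes \<beta>: "0 < \<beta>" and b: "b \<ge> 1"
  shows "survive b \<beta> n s =
    measure_pmf.prob (replicate_pmf n (poisson_pmf (\<beta> * real b))) {xs. stays b xs \<and> sum_list xs = b * n + s}"
proof (induction n arbitrary: s)
  case 0
  show ?case by simp
next
  case (Suc n)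
  let ?p = "poisson_pmf (\<beta> * real b)"
  define A where "A r = {s + b - r} \<times> {xs. stays b xs \<and> sum_list xs = b * n + r}" for r
  have "measure_pmf.prob (replicate_pmf (Suc n) ?p) {xs. stays b xs \<and> sum_list xs = b * Suc n + s}
     = measure_pmf.prob (pair_pmf ?p (replicate_pmf n ?p))
         ((\<lambda>(x, xs). x # xs) -` {xs. stays b xs \<and> sum_list xs = b * Suc n + s})"
    unfolding replicate_pmf_Suc_pair by simp
  also have "\<dots> = measure_pmf.prob (pair_pmf ?p (replicate_pmf n ?p)) (\<Union>r\<in>{..s+b}. A r)"
  proof (rule measure_pmf.finite_measure_eq_AE)
    show "AE x in measure_pmf (pair_pmf ?p (replicate_pmf n ?p)).
       x \<in> (\<lambda>(x, xs). x # xs) -` {xs. stays b xs \<and> sum_list xs = b * Suc n + s} \<longleftrightarrow> x \<in> (\<Union>r\<in>{..s+b}. A r)"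
      unfolding AE_measure_pmf_iff
    proof
      fix y assume y: "y \<in> set_pmf (pair_pmf ?p (replicate_pmf n ?p))"
      obtain x xs where yx: "y = (x, xs)" by force
      with y have len: "length xs = n" by (auto simp: set_replicate_pmf)
      \<comment> \<open>A surviving path has \<open>b * n \<le> sum_list xs\<close>, so the
        truncated difference is the true height before the last increment.\<close>
      have "x \<le> s + b" "sum_list xs = b * n + (sum_list xs - b * n)" "sum_list xs - b * n \<le> s + b"
          "x = s + b - (sum_list xs - b * n)"
        if "stays b xs" "x + sum_list xs = b * Suc n + s"
        using that stays_imp_sum[of b xs] len by auto
      then show "y \<in> (\<lambda>(x, xs). x # xs) -` {xs. stays b xs \<and> sum_list xs = b * Suc n + s} \<longleftrightarrow> y \<in> (\<Union>r\<in>{..s+b}. A r)"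
        using len unfolding yx A_def by (auto intro!: bexI[of _ "sum_list xs - b * n"])
    qed
  qed auto
  also have "\<dots> = (\<Sum>r\<le>s+b. measure_pmf.prob (pair_pmf ?p (replicate_pmf n ?p)) (A r))"
    by (rule measure_pmf.finite_measure_finite_Union) (auto simp: disjoint_family_on_def A_def)
  also have "\<dots> = (\<Sum>r\<le>s+b. pois b \<beta> (s + b - r) * survive b \<beta> n r)"
    unfolding A_def Suc.IH using assms
    by (intro sum.cong refl, subst measure_pmf_prob_product)
      (auto simp: measure_pmf_single pois_eq_pmf simp del: pmf_poisson)
  finally show ?case by (simp add: mult.commute)
qed

lemma survival_eq_prob:
  assumes \<beta>: "0 < \<beta>" and b: "b \<ge> 1"
  shows "survival b \<beta> n = measure_pmf.prob (replicate_pmf n (poisson_pmf (\<beta> * real b))) {xs. stays b xs}"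
proof -
  let ?P = "replicate_pmf n (poisson_pmf (\<beta> * real b))"
  have "(\<lambda>s. measure_pmf.prob ?P {xs. stays b xs \<and> sum_list xs = b * n + s})
    sums measure_pmf.prob ?P (\<Union>s. {xs. stays b xs \<and> sum_list xs = b * n + s})"
    by (rule measure_pmf.finite_measure_UNION) (auto simp: disjoint_family_on_def)
  also have "measure_pmf.prob ?P (\<Union>s. {xs. stays b xs \<and> sum_list xs = b * n + s}) = measure_pmf.prob ?P {xs. stays b xs}"
  proof (rule measure_pmf.finite_measure_eq_AE)
    show "AE xs in measure_pmf ?P. xs \<in> (\<Union>s. {xs. stays b xs \<and> sum_list xs = b * n + s}) \<longleftrightarrow> xs \<in> {xs. stays b xs}"
      unfolding AE_measure_pmf_iff
    proof
      fix xs assume "xs \<in> set_pmf ?P"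
      then have len: "length xs = n" by (auto simp: set_replicate_pmf)
      have "stays b xs \<Longrightarrow> sum_list xs = b * n + (sum_list xs - b * n)"
        using stays_imp_sum[of b xs] len by simp
      then show "xs \<in> (\<Union>s. {xs. stays b xs \<and> sum_list xs = b * n + s}) \<longleftrightarrow> xs \<in> {xs. stays b xs}"
        by blast
    qed
  qed auto
  finally show ?thesis
    unfolding survival_def using assms by (simp add: survive_eq_prob[symmetric] sums_iff)
qed

section \<open>Runs of full buckets in the infinite model\<close>

locale poisson_buckets =
  fixes b :: nat and \<beta> :: real
  assumes b: "b \<ge> 1" and \<beta>0: "0 < \<beta>" and \<beta>1: "\<beta> < 1"
begin

abbreviation "p \<equiv> poisson_pmf (\<beta> * real b)"
abbreviation "M \<equiv> poisson_model b \<beta>"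
abbreviation "\<theta> \<equiv> load_ratio b \<beta>"

lemma space_M [simp]: "space M = UNIV"
  by (simp add: poisson_model_def space_PiM)

sublocale P: product_prob_space "\<lambda>_. measure_pmf p" "UNIV :: int set"
  by standard

sublocale prob_space M
  unfolding poisson_model_def by (rule P.prob_space_axioms)

lemma component_measurable [measurable]: "(\<lambda>X. X i) \<in> measurable M (count_space UNIV)"
proof -
  have "(\<lambda>X. X i) \<in> measurable M (measure_pmf p)"
    unfolding poisson_model_def by (rule measurable_component_singleton) simp
  then show ?thesis
    by (subst measurable_cong_sets[OF refl, of _ "measure_pmf p"]) auto
qed

lemma past_measurable [measurable]: "(\<lambda>X. past X i w) \<in> measurable M (count_space UNIV)"
proof (induction w arbitrary: i)
  case 0
  show ?case by (simp add: past_def)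
next
  case (Suc w)
  note [measurable] = Suc
  show ?case unfolding past_Suc by measurable
qed

lemma win_measurable [measurable]: "(\<lambda>X. win X i l) \<in> measurable M (count_space UNIV)"
  unfolding win_def by measurable

lemma overfull_upto_measurable [measurable]: "Measurable.pred M (\<lambda>X. overfull_upto b L X i)"
  unfolding overfull_upto_def by measurable

lemma overfull_measurable [measurable]: "Measurable.pred M (\<lambda>X. overfull b X i)"
  unfolding overfull_def by measurable

lemma run_measurable [measurable]: "Measurable.pred M (\<lambda>X. run b k X h)"
  unfolding run_def by measurable

lemma run_upto_measurable [measurable]: "Measurable.pred M (\<lambda>X. run_upto b L k X h)"
  unfolding run_upto_def by measurable

lemma eventsI:
  assumes "Measurable.pred M P"
  shows "{X. P X} \<in> events"
proof -
  have "{X \<in> space M. P X} \<in> events" using assms by measurable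
  then show ?thesis by simp
qed

text \<open>The right-hand side does not mention \<open>i\<close>; stationarity of the model is used
  through this identity.\<close>

lemma distr_past: "distr M (count_space UNIV) (\<lambda>X. past X i w) = measure_pmf (replicate_pmf w p)"
proof (rule measure_eqI_countable[where A=UNIV])
  fix xs :: "nat list"
  have "emeasure (distr M (count_space UNIV) (\<lambda>X. past X i w)) {xs} = emeasure M {X. past X i w = xs}"
    by (subst emeasure_distr) (auto intro!: arg_cong[where f="emeasure M"])
  also have "\<dots> = ennreal (pmf (replicate_pmf w p) xs)"
  proof (cases "length xs = w")
    case False
    then have "{X. past X i w = xs} = {}" by auto
    then show ?thesis using False by (simp add: pmf_replicate_pmf)
  next
    case True
    let ?J = "(\<lambda>t. i - int t) ` {..<w}"
    have "{X. past X i w = xs} = {X. \<forall>t<w. X (i - int t) = xs ! t}"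
      using True by (auto simp: past_def list_eq_iff_nth_eq)
    also have "\<dots> = {X \<in> space (PiM UNIV (\<lambda>_. measure_pmf p)). \<forall>j\<in>?J. X j \<in> {xs ! nat (i - j)}}"
      by (auto simp: space_PiM)
    finally have "emeasure M {X. past X i w = xs} = (\<Prod>j\<in>?J. emeasure (measure_pmf p) {xs ! nat (i - j)})"
      unfolding poisson_model_def by (simp only:) (rule P.emeasure_PiM_Collect, auto)
    also have "\<dots> = (\<Prod>t<w. ennreal (pmf p (xs ! t)))"
      by (subst prod.reindex) (auto simp: inj_on_def emeasure_pmf_single)
    finally show ?thesis
      using True by (simp add: pmf_replicate_pmf prod_ennreal)
  qed
  finally show "emeasure (distr M (count_space UNIV) (\<lambda>X. past X i w)) {xs} = emeasure (replicate_pmf w p) {xs}"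
    by (simp add: emeasure_pmf_single)
qed auto

lemma prob_past: "prob {X. P (past X i w)} = measure_pmf.prob (replicate_pmf w p) {xs. P xs}"
proof -
  have "prob {X. P (past X i w)} = measure (distr M (count_space UNIV) (\<lambda>X. past X i w)) {xs. P xs}"
    by (subst measure_distr) (auto simp: vimage_def)
  then show ?thesis by (simp add: distr_past)
qed

lemma \<theta>_bounds: "0 < \<theta>" "\<theta> < 1"
  using load_ratio_pos[OF \<beta>0] load_ratio_less_1[OF \<beta>0 \<beta>1 b] by auto

lemma prob_win_ge: "prob {X. b * N \<le> win X i N} \<le> \<theta> ^ N"
  unfolding win_def using prob_past[of "\<lambda>xs. b * N \<le> sum_list xs" i N]
    prob_replicate_poisson_ge[OF \<beta>0 \<beta>1 b, of N] by simp

lemma prob_ex_win_ge: "prob {X. \<exists>N\<ge>k. b * N \<le> win X i N} \<le> \<theta> ^ k / (1 - \<theta>)"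
proof -
  have ge: "(\<lambda>N. \<theta> ^ (N + k)) sums (\<theta> ^ k / (1 - \<theta>))"
    using sums_mult2[OF geometric_sums[of \<theta>], of "\<theta> ^ k"] \<theta>_bounds by (simp add: power_add)
  have le: "prob {X. b * (N + k) \<le> win X i (N + k)} \<le> \<theta> ^ (N + k)" for N
    by (rule prob_win_ge)
  have sm: "summable (\<lambda>N. prob {X. b * (N + k) \<le> win X i (N + k)})"
    by (rule summable_comparison_test[OF _ sums_summable[OF ge]]) (use le in auto)
  have "{X. \<exists>N\<ge>k. b * N \<le> win X i N} = (\<Union>N. {X. b * (N + k) \<le> win X i (N + k)})"
    by (auto simp: le_iff_add add.commute)
  also have "prob \<dots> \<le> (\<Sum>N. prob {X. b * (N + k) \<le> win X i (N + k)})"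
  proof (rule finite_measure_subadditive_countably[OF _ sm])
    have "{X \<in> space M. b * (N + k) \<le> win X i (N + k)} \<in> events" for N by measurable
    then show "range (\<lambda>N. {X. b * (N + k) \<le> win X i (N + k)}) \<subseteq> events" by auto
  qed
  also have "\<dots> \<le> (\<Sum>N. \<theta> ^ (N + k))"
    by (rule suminf_le[OF le sm sums_summable[OF ge]])
  also have "\<dots> = \<theta> ^ k / (1 - \<theta>)" using ge by (simp add: sums_iff)
  finally show ?thesis .
qed

definition run_prob :: "nat \<Rightarrow> real" where "run_prob k = prob {X. run b k X 0}"

lemma prob_run_upto: "prob {X. run_upto b L k X h} = measure_pmf.prob (replicate_pmf (k + L) p) {ys. list_run b L k ys}"
  unfolding run_upto_iff_list_run by (rule prob_past)

lemma events_run [simp]: "{X. run b k X h} \<in> events" "{X. run_upto b L k X h} \<in> events" "{X. overfull b X h} \<in> events"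
  "{X. overfull_upto b L X h} \<in> events" "{X. P (past X h w)} \<in> events"
  by (rule eventsI, measurable)+

text \<open>A run depends on the infinite past. Translation invariance is read off the truncated
  events, which see finite lists only, and passes to the increasing limit.\<close>

lemma prob_run: "prob {X. run b k X h} = run_prob k"
proof -
  have "(\<lambda>L. prob {X. run_upto b L k X h}) \<longlonglongrightarrow> prob {X. run b k X h}" for h
  proof -
    have "(\<lambda>L. prob {X. run_upto b L k X h}) \<longlonglongrightarrow> prob (\<Union>L. {X. run_upto b L k X h})"
      by (rule finite_Lim_measure_incseq) (auto simp: incseq_def intro: run_upto_mono)
    also have "(\<Union>L. {X. run_upto b L k X h}) = {X. run b k X h}"
      by (auto simp: run_iff_upto)
    finally show ?thesis .
  qed
  from this[of h] this[of 0] show ?thesis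
    unfolding prob_run_upto run_prob_def by (rule LIMSEQ_unique)
qed

lemma run_prob_le: "run_prob k \<le> \<theta> ^ k / (1 - \<theta>)"
proof (cases "k = 0")
  case True
  have "run_prob k \<le> 1" by (simp add: run_prob_def)
  also have "1 \<le> \<theta> ^ k / (1 - \<theta>)" using True \<theta>_bounds by simp
  finally show ?thesis .
next
  case False
  have "{X \<in> space M. \<exists>N\<ge>k. b * N \<le> win X (0 + int k - 1) N} \<in> events" by measurable
  then have "run_prob k \<le> prob {X. \<exists>N\<ge>k. b * N \<le> win X (0 + int k - 1) N}"
    unfolding run_prob_def
  proof (intro finite_measure_mono subsetI)
    fix X assume "X \<in> {X. run b k X 0}"
    then show "X \<in> {X. \<exists>N\<ge>k. b * N \<le> win X (0 + int k - 1) N}"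
      using run_imp_win[of b k X 0] False by simp
  qed simp
  also have "\<dots> \<le> \<theta> ^ k / (1 - \<theta>)" by (rule prob_ex_win_ge)
  finally show ?thesis .
qed

lemma run_prob_truncation: "run_prob k - prob {X. run_upto b L k X 0} \<le> real k * (\<theta> ^ Suc L / (1 - \<theta>))"
proof -
  have ev: "{X. \<exists>N\<ge>Suc L. b * N \<le> win X i N} \<in> events" for i
    by (rule eventsI) measurable
  have "run_prob k - prob {X. run_upto b L k X 0} = prob ({X. run b k X 0} - {X. run_upto b L k X 0})"
    unfolding run_prob_def by (rule finite_measure_Diff[symmetric]) (auto intro: run_upto_imp_run)
  also have "\<dots> \<le> prob (\<Union>i\<in>{..<k}. {X. \<exists>N\<ge>Suc L. b * N \<le> win X (int i) N})"
  proof (rule finite_measure_mono)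
    show "{X. run b k X 0} - {X. run_upto b L k X 0} \<subseteq> (\<Union>i\<in>{..<k}. {X. \<exists>N\<ge>Suc L. b * N \<le> win X (int i) N})"
    proof
      fix X assume "X \<in> {X. run b k X 0} - {X. run_upto b L k X 0}"
      then obtain i where i: "i < k" "overfull b X (int i)" "\<not> overfull_upto b L X (int i)"
        by (auto simp: run_def run_upto_def)
      then obtain l where "l \<ge> 1" "b * l \<le> win X (int i) l" by (auto simp: overfull_def)
      moreover from this have "l \<ge> Suc L" using i(3) by (force simp: overfull_upto_def)
      ultimately show "X \<in> (\<Union>i\<in>{..<k}. {X. \<exists>N\<ge>Suc L. b * N \<le> win X (int i) N})"
        using i(1) by blast
    qed
  qed (use ev in auto)
  also have "\<dots> \<le> (\<Sum>i<k. prob {X. \<exists>N\<ge>Suc L. b * N \<le> win X (int i) N})"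
    using ev by (intro finite_measure_subadditive_finite) auto
  also have "\<dots> \<le> (\<Sum>i<k. \<theta> ^ Suc L / (1 - \<theta>))"
    by (intro sum_mono prob_ex_win_ge)
  finally show ?thesis by simp
qed

text \<open>Independence of the buckets up to 0 from those in \<open>1, ..., k\<close>. Fullness of
  bucket 0 involves infinitely many buckets, so the factorisation is proved with windows of length
  at most \<open>L\<close> and \<open>L\<close> tends to infinity.\<close>

lemma prob_not_overfull_stays:
  "prob {X. \<not> overfull b X 0 \<and> stays b (past X (int k) k)} = prob {X. \<not> overfull b X 0} * survival b \<beta> k"
proof -
  have A: "{X. \<not> overfull_upto b L X 0 \<and> stays b (past X (int k) k)} \<in> events" for L
    by (rule eventsI) measurable
  have B: "{X. \<not> overfull_upto b L X 0} \<in> events" for L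
    by (rule eventsI) measurable
  define Q where "Q L ys \<longleftrightarrow> \<not> (\<exists>l\<in>{1..L}. b * l \<le> sum_list (take l ys))" for L ys
  have Q: "\<not> overfull_upto b L X 0 \<longleftrightarrow> Q L (past X 0 L)" for L X
    unfolding overfull_upto_def Q_def win_def by (auto simp: take_past)
  have fin: "prob {X. \<not> overfull_upto b L X 0 \<and> stays b (past X (int k) k)}
      = prob {X. \<not> overfull_upto b L X 0} * survival b \<beta> k" for L
  proof -
    have "{X. \<not> overfull_upto b L X 0 \<and> stays b (past X (int k) k)}
       = {X. stays b (take k (past X (int k) (k + L))) \<and> Q L (drop k (past X (int k) (k + L)))}"
      unfolding Q by (auto simp: take_past drop_past)
    then have "prob {X. \<not> overfull_upto b L X 0 \<and> stays b (past X (int k) k)}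
       = measure_pmf.prob (replicate_pmf (k + L) p) {xs. stays b (take k xs) \<and> Q L (drop k xs)}"
      using prob_past[of "\<lambda>xs. stays b (take k xs) \<and> Q L (drop k xs)"] by simp
    also have "\<dots> = survival b \<beta> k * measure_pmf.prob (replicate_pmf L p) {xs. Q L xs}"
      using \<beta>0 b by (simp add: prob_replicate_pmf_append survival_eq_prob)
    also have "measure_pmf.prob (replicate_pmf L p) {xs. Q L xs} = prob {X. \<not> overfull_upto b L X 0}"
      unfolding Q by (rule prob_past[symmetric])
    finally show ?thesis by simp
  qed
  have "(\<lambda>L. prob {X. \<not> overfull_upto b L X 0 \<and> stays b (past X (int k) k)})
     \<longlonglongrightarrow> prob (\<Inter>L. {X. \<not> overfull_upto b L X 0 \<and> stays b (past X (int k) k)})"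
    by (rule finite_Lim_measure_decseq) (use A overfull_upto_mono in \<open>auto simp: decseq_def\<close>)
  also have "(\<Inter>L. {X. \<not> overfull_upto b L X 0 \<and> stays b (past X (int k) k)})
     = {X. \<not> overfull b X 0 \<and> stays b (past X (int k) k)}"
    by (auto simp: overfull_iff_upto)
  finally have 1: "(\<lambda>L. prob {X. \<not> overfull_upto b L X 0} * survival b \<beta> k)
     \<longlonglongrightarrow> prob {X. \<not> overfull b X 0 \<and> stays b (past X (int k) k)}" by (simp add: fin)
  have "(\<lambda>L. prob {X. \<not> overfull_upto b L X 0}) \<longlonglongrightarrow> prob (\<Inter>L. {X. \<not> overfull_upto b L X 0})"
    by (rule finite_Lim_measure_decseq) (use B overfull_upto_mono in \<open>auto simp: decseq_def\<close>)
  also have "(\<Inter>L. {X. \<not> overfull_upto b L X 0}) = {X. \<not> overfull b X 0}"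
    by (auto simp: overfull_iff_upto)
  finally have "(\<lambda>L. prob {X. \<not> overfull_upto b L X 0} * survival b \<beta> k)
     \<longlonglongrightarrow> prob {X. \<not> overfull b X 0} * survival b \<beta> k"
    by (rule tendsto_mult_right)
  then show ?thesis using 1 LIMSEQ_unique by blast
qed

lemma prob_not_overfull_run:
  "prob {X. \<not> overfull b X 0 \<and> run b k X 1} = run_prob k - run_prob (Suc k)"
proof -
  have "run b (Suc k) X 0 \<longleftrightarrow> overfull b X 0 \<and> run b k X 1" for X
    unfolding run_def by (auto simp: less_Suc_eq_0_disj add.commute)
  then have "{X. \<not> overfull b X 0 \<and> run b k X 1} = {X. run b k X 1} - {X. run b (Suc k) X 0}"
    and sub: "{X. run b (Suc k) X 0} \<subseteq> {X. run b k X 1}" by auto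
  then show ?thesis
    by (simp add: finite_measure_Diff[OF _ _ sub] prob_run)
qed

text \<open>If bucket \<open>0\<close> is not full, nothing overflows into bucket \<open>1\<close>, so the buckets from \<open>1\<close> on are full exactly
  as long as the walk started there stays nonnegative.\<close>

lemma run_prob_diff: "run_prob k - run_prob (Suc k) = (1 - run_prob 1) * survival b \<beta> k"
proof -
  have "{X. \<not> overfull b X 0 \<and> run b k X 1} = {X. \<not> overfull b X 0 \<and> stays b (past X (int k) k)}" for k
    using run_iff_stays by blast
  then have *: "run_prob k - run_prob (Suc k) = prob {X. \<not> overfull b X 0} * survival b \<beta> k" for k
    using prob_not_overfull_run[of k] prob_not_overfull_stays[of k] by simp
  have "run_prob 0 = 1" by (simp add: run_prob_def run_def prob_space[unfolded space_M])
  then have "prob {X. \<not> overfull b X 0} = 1 - run_prob 1"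
    using *[of 0] \<beta>0 by (simp add: survival_0)
  with * show ?thesis by simp
qed

lemma run_prob_0: "run_prob 0 = 1"
  by (simp add: run_prob_def run_def prob_space[unfolded space_M])

lemma run_prob_tendsto_0: "run_prob \<longlonglongrightarrow> 0"
proof (rule tendsto_sandwich[OF _ _ tendsto_const])
  show "(\<lambda>k. \<theta> ^ k / (1 - \<theta>)) \<longlonglongrightarrow> 0"
    using \<theta>_bounds by (intro tendsto_divide_zero LIMSEQ_realpow_zero) auto
qed (auto simp: run_prob_le intro!: always_eventually, simp add: run_prob_def)

lemma run_diff_sums: "(\<lambda>k. run_prob k - run_prob (Suc k)) sums 1"
  using telescope_sums'[OF run_prob_tendsto_0] by (simp add: run_prob_0)

text \<open>This makes the supremum in \<open>H\<close> almost surely one over a set bounded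
  above.\<close>

lemma AE_eventually_win_less: "AE X in M. \<exists>N. \<forall>l\<ge>N. win X i l < b * l"
proof (rule AE_I')
  let ?A = "\<lambda>k. {X. \<exists>N\<ge>k. b * N \<le> win X i N}"
  have ev: "?A k \<in> events" for k
    by (rule eventsI) measurable
  have "(\<lambda>k. prob (?A k)) \<longlonglongrightarrow> prob (\<Inter>k. ?A k)"
    by (rule finite_Lim_measure_decseq) (use ev in \<open>auto simp: decseq_def intro: order_trans\<close>)
  moreover have "(\<lambda>k. prob (?A k)) \<longlonglongrightarrow> 0"
  proof (rule tendsto_sandwich[OF _ _ tendsto_const])
    show "(\<lambda>k. \<theta> ^ k / (1 - \<theta>)) \<longlonglongrightarrow> 0"
      using \<theta>_bounds by (intro tendsto_divide_zero LIMSEQ_realpow_zero) auto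
  qed (auto simp: prob_ex_win_ge)
  ultimately have "prob (\<Inter>k. ?A k) = 0" by (rule LIMSEQ_unique)
  moreover have "(\<Inter>k. ?A k) \<in> events" using ev by auto
  ultimately show "(\<Inter>k. ?A k) \<in> null_sets M" by (simp add: null_sets_def emeasure_eq_measure)
  show "{X \<in> space M. \<not> (\<exists>N. \<forall>l\<ge>N. win X i l < b * l)} \<subseteq> (\<Inter>k. ?A k)"
    by (auto simp: not_less)
qed

lemma AE_ex_not_overfull: "AE X in M. \<exists>k. \<not> overfull b X (int k)"
proof -
  define Z where "Z = (\<Inter>k. {X. run b k X 0})"
  have "(\<lambda>k. prob {X. run b k X 0}) \<longlonglongrightarrow> prob Z"
    unfolding Z_def
  proof (rule finite_Lim_measure_decseq)
    show "decseq (\<lambda>k. {X. run b k X 0})" by (auto simp: decseq_def run_def)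
  qed auto
  then have "prob Z = 0"
    using run_prob_tendsto_0 unfolding run_prob_def by (rule LIMSEQ_unique)
  moreover have "Z \<in> events"
    unfolding Z_def by (intro sets.countable_INT image_subsetI events_run) auto
  ultimately have "Z \<in> null_sets M" by (simp add: null_sets_def emeasure_eq_measure)
  moreover have "{X \<in> space M. \<not> (\<exists>k. \<not> overfull b X (int k))} \<subseteq> Z"
    by (auto simp: Z_def run_def)
  ultimately show ?thesis by (rule AE_I')
qed

section \<open>From the definition by suprema to windows, and the law of \<open>U\<close>\<close>

lemma H_eq: "H b X i = int b + (SUP l\<in>{1..}. int (win X i l) - int b * int l)"
proof -
  have "(\<lambda>j. \<Sum>k\<in>{j+1..i}. (int (X k) - int b)) ` {..<i} = (\<lambda>l. int (win X i l) - int b * int l) ` {1..}"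
  proof -
    have "(\<Sum>k\<in>{i - int l + 1..i}. (int (X k) - int b)) = int (win X i l) - int b * int l" for l
    proof -
      have "(\<Sum>k\<in>{i - int l + 1..i}. (int (X k) - int b)) = (\<Sum>t<l. int (X (i - int t)) - int b)"
        by (rule sum.reindex_bij_witness[of _ "\<lambda>t. i - int t" "\<lambda>k. nat (i - k)"]) auto
      also have "\<dots> = int (win X i l) - int b * int l"
        by (simp add: win_def past_def sum_list_sum_nth sum_subtractf atLeast0LessThan)
      finally show ?thesis .
    qed
    note * = this
    have "{..<i} = (\<lambda>l. i - int l) ` {1..}"
    proof (intro equalityI subsetI)
      fix j assume "j \<in> {..<i}"
      then show "j \<in> (\<lambda>l. i - int l) ` {1..}" by (intro image_eqI[of _ _ "nat (i - j)"]) auto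
    qed auto
    then show ?thesis by (simp add: image_image *)
  qed
  then show ?thesis by (simp add: H_def)
qed

text \<open>In the integers, negative terms are at most -1, so a supremum can be nonnegative only if
  some term is.\<close>

lemma full_iff_overfull:
  assumes "bdd_above ((\<lambda>l. int (win X i l) - int b * int l) ` {1..})"
  shows "full b X i \<longleftrightarrow> overfull b X i"
proof -
  let ?f = "\<lambda>l. int (win X i l) - int b * int l"
  have "full b X i \<longleftrightarrow> (SUP l\<in>{1..}. ?f l) \<ge> 0" by (simp add: full_def H_eq)
  also have "\<dots> \<longleftrightarrow> (\<exists>l\<ge>1. ?f l \<ge> 0)"
  proof
    assume *: "(SUP l\<in>{1..}. ?f l) \<ge> 0"
    show "\<exists>l\<ge>1. ?f l \<ge> 0"
    proof (rule ccontr)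
      assume "\<not> (\<exists>l\<ge>1. ?f l \<ge> 0)"
      then have "(SUP l\<in>{1..}. ?f l) \<le> -1" by (intro cSUP_least) force+
      with * show False by simp
    qed
  next
    assume "\<exists>l\<ge>1. ?f l \<ge> 0"
    then obtain l where "l \<ge> 1" "?f l \<ge> 0" by blast
    moreover from this have "?f l \<le> (SUP l\<in>{1..}. ?f l)" by (intro cSUP_upper assms) auto
    ultimately show "(SUP l\<in>{1..}. ?f l) \<ge> 0" by linarith
  qed
  also have "\<dots> \<longleftrightarrow> overfull b X i"
    unfolding overfull_def by (simp add: of_nat_mult[symmetric] del: of_nat_mult)
  finally show ?thesis .
qed

text \<open>On the null event where the partial sums are unbounded, \<open>Sup\<close> has a fixed unspecified value; this is
  all that measurability of \<open>full\<close> needs there.\<close>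

lemma int_Sup_not_bdd: "\<not> bdd_above S \<Longrightarrow> Sup (S :: int set) = (THE x. False)"
  unfolding Sup_int_def by (metis bdd_above.I)

lemma full_measurable [measurable]: "Measurable.pred M (\<lambda>X. full b X i)"
proof -
  define B where "B X \<longleftrightarrow> bdd_above ((\<lambda>l. int (win X i l) - int b * int l) ` {1..})" for X
  have eq: "B = (\<lambda>X. \<exists>B. \<forall>l. 1 \<le> l \<longrightarrow> int (win X i l) - int b * int l \<le> B)"
    by (auto simp: B_def bdd_above_def fun_eq_iff)
  have [measurable]: "(\<lambda>X. int (win X i l) - int b * int l) \<in> measurable M (count_space UNIV)" for l
    by (rule measurable_compose[OF win_measurable[of i l], of "\<lambda>w. int w - int b * int l"]) simp
  have [measurable]: "Measurable.pred M B" unfolding eq by measurable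
  have "full b X i \<longleftrightarrow> (B X \<and> overfull b X i) \<or> (\<not> B X \<and> (THE x::int. False) \<ge> 0)" for X
  proof (cases "B X")
    case True
    then show ?thesis using full_iff_overfull[of X i] by (simp add: B_def)
  next
    case False
    then have "full b X i \<longleftrightarrow> (THE x::int. False) \<ge> 0"
      unfolding B_def by (simp add: full_def H_eq int_Sup_not_bdd)
    then show ?thesis using False by simp
  qed
  then have "(\<lambda>X. full b X i) = (\<lambda>X. (B X \<and> overfull b X i) \<or> (\<not> B X \<and> (THE x::int. False) \<ge> 0))"
    by blast
  moreover have "Measurable.pred M (\<lambda>X. (B X \<and> overfull b X i) \<or> (\<not> B X \<and> (THE x::int. False) \<ge> 0))"
    by measurable
  ultimately show ?thesis by (simp only:)
qed

lemma U_measurable [measurable]: "U b \<in> measurable M (count_space UNIV)"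
  unfolding U_def by measurable

lemma prob_U: "prob {X. U b X = k} = run_prob k - run_prob (Suc k)"
proof -
  have bdd: "bdd_above ((\<lambda>l. int (win X i l) - int b * int l) ` {1..})"
    if "\<exists>N. \<forall>l\<ge>N. win X i l < b * l" for X i
  proof -
    from that obtain N where N: "\<And>l. l \<ge> N \<Longrightarrow> win X i l < b * l" by blast
    \<comment> \<open>Long windows give negative values; the finitely many short ones are bounded by
      the sum of their counts.\<close>
    have "int (win X i l) - int b * int l \<le> (\<Sum>l<N. int (win X i l))" for l
    proof (cases "l < N")
      case True
      then have "int (win X i l) \<le> (\<Sum>l<N. int (win X i l))"
        by (intro member_le_sum) auto
      moreover have "0 \<le> int b * int l" by simp
      ultimately show ?thesis by linarith
    next
      case False
      then have "int (win X i l) < int b * int l"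
        using N[of l] by (simp add: of_nat_mult[symmetric] del: of_nat_mult)
      moreover have "0 \<le> (\<Sum>l<N. int (win X i l))" by (simp add: sum_nonneg)
      ultimately show ?thesis by linarith
    qed
    then show ?thesis by (intro bdd_aboveI2) auto
  qed
  have "AE X in M. \<forall>i. \<exists>N. \<forall>l\<ge>N. win X (int i) l < b * l"
    using AE_eventually_win_less by (simp add: AE_all_countable)
  then have "AE X in M. U b X = k \<longleftrightarrow> run b k X 0 \<and> \<not> run b (Suc k) X 0"
    using AE_ex_not_overfull
  proof eventually_elim
    case (elim X)
    then have fo: "full b X (int i) \<longleftrightarrow> overfull b X (int i)" for i
      by (intro full_iff_overfull bdd) auto
    then have U: "U b X = (LEAST k. \<not> overfull b X (int k))" by (simp add: U_def)
    have 1: "\<not> overfull b X (int (U b X))" unfolding U by (rule LeastI_ex[OF elim(2)])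
    have 2: "i < U b X \<Longrightarrow> overfull b X (int i)" for i
      unfolding U using not_less_Least by blast
    have "run b k X 0 \<and> \<not> run b (Suc k) X 0 \<longleftrightarrow> (\<forall>i<k. overfull b X (int i)) \<and> \<not> overfull b X (int k)"
      by (auto simp: run_def less_Suc_eq)
    also have "\<dots> \<longleftrightarrow> U b X = k" using 1 2 by (metis linorder_neqE_nat)
    finally show ?case by blast
  qed
  then have "AE X in M. X \<in> {X. U b X = k} \<longleftrightarrow> X \<in> {X. run b k X 0} - {X. run b (Suc k) X 0}"
    by simp
  then have "prob {X. U b X = k} = prob ({X. run b k X 0} - {X. run b (Suc k) X 0})"
  proof (rule finite_measure_eq_AE)
    have "{X \<in> space M. U b X = k} \<in> events" by measurable
    then show "{X. U b X = k} \<in> events" by simp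
  qed (auto simp: sets.Diff)
  also have "\<dots> = run_prob k - run_prob (Suc k)"
    unfolding run_prob_def
  proof (rule finite_measure_Diff)
    show "{X. run b (Suc k) X 0} \<subseteq> {X. run b k X 0}" by (auto simp: run_def)
  qed auto
  finally show ?thesis .
qed

lemma survival_sums: "(\<lambda>n. survival b \<beta> n) sums (\<Sum>n. survival b \<beta> n)"
  using summable_survival[OF \<beta>0 \<beta>1, of "1::real" b] \<theta>_bounds \<beta>0 survival_nonneg[of \<beta> b]
  by (simp add: summable_sums)

text \<open>The factor \<open>1 - run_prob 1\<close>, the probability that a bucket is not full, is
  determined by total mass 1, so it need not be computed directly.\<close>

lemma prob_U_eq: "prob {X. U b X = k} = survival b \<beta> k / (\<Sum>n. survival b \<beta> n)"
proof -
  have "(\<lambda>k. (1 - run_prob 1) * survival b \<beta> k) sums 1"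
    using run_diff_sums by (simp add: run_prob_diff)
  moreover have "(\<lambda>k. (1 - run_prob 1) * survival b \<beta> k) sums ((1 - run_prob 1) * (\<Sum>n. survival b \<beta> n))"
    by (intro sums_mult survival_sums)
  ultimately have "1 = (1 - run_prob 1) * (\<Sum>n. survival b \<beta> n)" by (rule sums_unique2)
  then have "1 - run_prob 1 = 1 / (\<Sum>n. survival b \<beta> n)"
    by (metis nonzero_eq_divide_eq mult_zero_right zero_neq_one)
  then show ?thesis by (simp add: prob_U run_prob_diff)
qed

end

section \<open>Linear probing on a cycle\<close>

text \<open>Periodic extension to the integers, so that \<open>win\<close>, \<open>overfull\<close>
  and \<open>run\<close> apply to the cycle. Windows longer than \<open>m\<close> count buckets
  repeatedly.\<close>

definition cyc :: "nat \<Rightarrow> (nat \<Rightarrow> nat) \<Rightarrow> int \<Rightarrow> nat" where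
  "cyc m f i = f (nat (i mod int m))"

definition place :: "nat \<Rightarrow> nat \<Rightarrow> (nat \<Rightarrow> nat) \<Rightarrow> nat \<Rightarrow> nat \<Rightarrow> nat" where
  "place b m L h = (let i = (h + (LEAST d. L ((h + d) mod m) < b)) mod m in L(i := Suc (L i)))"

definition loads :: "nat \<Rightarrow> nat \<Rightarrow> nat list \<Rightarrow> nat \<Rightarrow> nat" where
  "loads b m hs = foldl (place b m) (\<lambda>_. 0) hs"

lemma fc_displacements_nth:
  assumes "j < length hs"
  shows "fc_displacements b m L hs ! j =
    (LEAST d. foldl (place b m) L (take j hs) ((hs ! j + d) mod m) < b)"
  using assms
proof (induction hs arbitrary: L j)
  case (Cons h hs)
  then show ?case by (cases j) (auto simp: Let_def place_def)
qed simp

lemma cyc_nat: "m > 0 \<Longrightarrow> cyc m f (int h + int d) = f ((h + d) mod m)"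
  by (simp add: cyc_def nat_mod_as_int)

lemma cyc_residue_unique:
  assumes "m > 0" "i mod int m = (int h + int e) mod int m" "i mod int m = (int h + int e') mod int m"
    "e < m" "e' < m"
  shows "e = e'"
proof -
  have "(int h + int e) mod int m = (int h + int e') mod int m" using assms by simp
  then have "int m dvd (int e - int e')" by (simp add: mod_eq_dvd_iff)
  then have dvd: "int m dvd \<bar>int e - int e'\<bar>" by simp
  have "\<bar>int e - int e'\<bar> < int m" using assms(4,5) by linarith
  then have "\<not> 0 < \<bar>int e - int e'\<bar>" using zdvd_not_zless dvd by blast
  then show ?thesis by simp
qed

text \<open>\<open>Q i\<close> counts the keys that have passed from bucket \<open>i\<close> to the next one.\<close>

definition flow :: "nat \<Rightarrow> nat \<Rightarrow> nat list \<Rightarrow> (nat \<Rightarrow> nat) \<Rightarrow> (nat \<Rightarrow> nat) \<Rightarrow> bool" where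
  "flow b m hs L Q \<longleftrightarrow> (\<forall>i. cyc m L i \<le> b \<and> (cyc m L i < b \<longrightarrow> cyc m Q i = 0) \<and>
     cyc m L i + cyc m Q i = cyc m (count_list hs) i + cyc m Q (i - 1))"

text \<open>The new key passes the full buckets at offsets below \<open>d\<close> and stays at
  offset \<open>d\<close>, so \<open>Q\<close> grows by one on the passed buckets. Since
  \<open>d < m\<close>, no bucket is met twice.\<close>

lemma flow_snoc:
  assumes m: "m > 0" and h: "h < m" and nf: "d0 < m" "L ((h + d0) mod m) < b" and flow: "flow b m hs L Q"
  shows "\<exists>Q'. flow b m (hs @ [h]) (place b m L h) Q'"
proof -
  define d where "d = (LEAST d. L ((h + d) mod m) < b)"
  have d: "L ((h + d) mod m) < b" unfolding d_def by (rule LeastI[of _ d0]) (rule nf)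
  have dm: "d < m" using nf Least_le[of "\<lambda>d. L ((h + d) mod m) < b" d0] by (simp add: d_def)
  have min: "\<not> L ((h + e) mod m) < b" if "e < d" for e
    using not_less_Least that unfolding d_def by blast
  define I where "I i e \<longleftrightarrow> i mod int m = (int h + int e) mod int m" for i e
  define Q' where "Q' n = Q n + (if \<exists>e<d. n = (h + e) mod m then 1 else 0)" for n
  have eqI: "nat (i mod int m) = (h + e) mod m \<longleftrightarrow> I i e" for i e
    using m unfolding I_def by (auto simp: nat_mod_as_int zmod_int nat_eq_iff2)
  have L': "cyc m (place b m L h) i = cyc m L i + (if I i d then 1 else 0)" for i
    using eqI[of i d] by (auto simp: place_def cyc_def d_def[symmetric] Let_def)
  have x': "cyc m (count_list (hs @ [h])) i = cyc m (count_list hs) i + (if I i 0 then 1 else 0)" for i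
    using eqI[of i 0] h by (auto simp: cyc_def)
  have Q'': "cyc m Q' i = cyc m Q i + (if \<exists>e<d. I i e then 1 else 0)" for i
    by (auto simp: cyc_def Q'_def eqI)
  have shift: "I (i - 1) e \<longleftrightarrow> I i (Suc e)" for i e
    unfolding I_def mod_eq_dvd_iff by (simp add: algebra_simps)
  have uniq: "e = e'" if "I i e" "I i e'" "e \<le> d" "e' \<le> d" for i e e'
    using cyc_residue_unique[OF m] that dm unfolding I_def by (meson le_less_trans)
  \<comment> \<open>Balance at bucket \<open>i\<close>: the key stays or leaves there exactly if it
    starts there or arrives from the left neighbour.\<close>
  have count: "(if I i d then 1 else 0) + (if \<exists>e<d. I i e then 1 else 0)
      = (if I i 0 then 1 else (0::nat)) + (if \<exists>e<d. I i (Suc e) then 1 else 0)" for i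
  proof (cases "\<exists>e\<le>d. I i e")
    case True
    then obtain e where e: "e \<le> d" "I i e" by blast
    have 1: "I i e' \<longleftrightarrow> e' = e" if "e' \<le> d" for e'
      using uniq[of i e' e] e that by blast
    have 2: "(\<exists>e'<d. I i e') \<longleftrightarrow> e < d"
    proof
      assume "\<exists>e'<d. I i e'"
      then obtain e' where "e' < d" "I i e'" by blast
      with 1[of e'] show "e < d" by simp
    qed (use e in blast)
    have 3: "(\<exists>e'<d. I i (Suc e')) \<longleftrightarrow> e > 0"
    proof
      assume "\<exists>e'<d. I i (Suc e')"
      then obtain e' where "e' < d" "I i (Suc e')" by blast
      with 1[of "Suc e'"] show "e > 0" by simp
    next
      assume "e > 0"
      then obtain e' where "e = Suc e'" by (cases e) auto
      with e show "\<exists>e'<d. I i (Suc e')" by (intro exI[of _ e']) auto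
    qed
    show ?thesis unfolding 2 3 using 1[of d] 1[of 0] e by auto
  next
    case False
    then have "\<not> I i d" "\<not> I i 0" "\<not> (\<exists>e<d. I i e)" "\<not> (\<exists>e<d. I i (Suc e))" by (auto simp: Suc_le_eq)
    then show ?thesis by simp
  qed
  \<comment> \<open>This preserves the requirement that only full buckets pass keys on.\<close>
  have full: "cyc m L i \<ge> b" if "I i e" "e < d" for i e
    using min[OF that(2)] eqI[of i e] that(1) by (simp add: cyc_def)
  have "flow b m (hs @ [h]) (place b m L h) Q'"
    unfolding flow_def
  proof (intro allI conjI impI)
    fix i
    have f: "cyc m L i \<le> b" "cyc m L i < b \<Longrightarrow> cyc m Q i = 0"
      "cyc m L i + cyc m Q i = cyc m (count_list hs) i + cyc m Q (i - 1)"
      using flow by (auto simp: flow_def)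
    have "I i d \<Longrightarrow> cyc m L i < b" using d eqI[of i d] by (simp add: cyc_def)
    then show "cyc m (place b m L h) i \<le> b" using f(1) by (auto simp: L')
    show "cyc m (place b m L h) i + cyc m Q' i = cyc m (count_list (hs @ [h])) i + cyc m Q' (i - 1)"
      using f(3) count[of i] unfolding L' Q'' x' shift by linarith
    assume less: "cyc m (place b m L h) i < b"
    then have "cyc m L i < b" by (simp add: L' split: if_splits)
    moreover from this have "\<not> (\<exists>e<d. I i e)" using full by fastforce
    ultimately show "cyc m Q' i = 0" using f(2) by (simp add: Q'')
  qed
  then show ?thesis by blast
qed

lemma sum_place:
  assumes "m > 0"
  shows "(\<Sum>i<m. place b m L h i) = Suc (\<Sum>i<m. L i)"
proof -
  define i where "i = (h + (LEAST d. L ((h + d) mod m) < b)) mod m"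
  have i: "i \<in> {..<m}" using assms by (simp add: i_def)
  have "(\<Sum>j<m. (L(i := Suc (L i))) j) = (\<Sum>j<m. L j + (if j = i then 1 else 0))"
    by (rule sum.cong) auto
  also have "\<dots> = Suc (\<Sum>j<m. L j)" using i by (simp add: sum.distrib)
  finally show ?thesis by (simp add: place_def Let_def i_def[symmetric])
qed

lemma loads_snoc: "loads b m (hs @ [h]) = place b m (loads b m hs) h"
  by (simp add: loads_def)

lemma sum_loads: "m > 0 \<Longrightarrow> (\<Sum>i<m. loads b m hs i) = length hs"
  by (induction hs rule: rev_induct) (auto simp: loads_snoc sum_place, simp add: loads_def)

lemma ex_free:
  assumes "m > 0" "length hs < b * m"
  shows "\<exists>i<m. loads b m hs i < b"
proof (rule ccontr)
  assume "\<not> (\<exists>i<m. loads b m hs i < b)"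
  then have "\<And>i. i < m \<Longrightarrow> b \<le> loads b m hs i" by (meson not_less)
  then have "(\<Sum>i<m. b) \<le> (\<Sum>i<m. loads b m hs i)" by (intro sum_mono) simp
  then show False using assms by (simp add: sum_loads mult.commute)
qed

lemma ex_free_offset:
  assumes "m > 0" "length hs < b * m"
  shows "\<exists>N<m. cyc m (loads b m hs) (i - int N) < b" "\<exists>d<m. cyc m (loads b m hs) (i + int d) < b"
proof -
  obtain k where k: "k < m" "loads b m hs k < b" using ex_free[OF assms] by blast
  have "(i - (i - int k) mod int m) mod int m = int k"
    using k assms by (simp add: mod_diff_right_eq)
  then show "\<exists>N<m. cyc m (loads b m hs) (i - int N) < b"
    using k assms by (intro exI[of _ "nat ((i - int k) mod int m)"]) (auto simp: cyc_def nat_less_iff)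
  have "(i + (int k - i) mod int m) mod int m = int k"
    using k assms by (simp add: mod_add_right_eq)
  then show "\<exists>d<m. cyc m (loads b m hs) (i + int d) < b"
    using k assms by (intro exI[of _ "nat ((int k - i) mod int m)"]) (auto simp: cyc_def nat_less_iff)
qed

lemma ex_flow:
  assumes "m > 0" "set hs \<subseteq> {..<m}" "length hs \<le> b * m"
  shows "\<exists>Q. flow b m hs (loads b m hs) Q"
  using assms(2,3)
proof (induction hs rule: rev_induct)
  case Nil
  have "flow b m [] (loads b m []) (\<lambda>_. 0)" by (simp add: flow_def loads_def cyc_def)
  then show ?case by blast
next
  case (snoc h hs)
  then obtain Q where Q: "flow b m hs (loads b m hs) Q" by auto
  obtain d0 where "d0 < m" "cyc m (loads b m hs) (int h + int d0) < b"
    using ex_free_offset(2)[OF assms(1), of hs b "int h"] snoc.prems by auto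
  then show ?case
    unfolding loads_snoc using snoc.prems assms(1) by (intro flow_snoc[OF _ _ _ _ Q]) (auto simp: cyc_nat)
qed

section \<open>Full buckets on the cycle in terms of windows\<close>

locale hashing =
  fixes b m :: nat and hs :: "nat list"
  assumes m: "m > 0" and hs: "set hs \<subseteq> {..<m}" and len: "length hs < b * m"
begin

abbreviation "X \<equiv> cyc m (count_list hs)"
abbreviation "L \<equiv> cyc m (loads b m hs)"

text \<open>The local balances telescope over the window: addresses inside plus inflow from the left
  equal stored keys plus outflow on the right.\<close>

lemma flow_window:
  assumes "flow b m hs (loads b m hs) Q"
  shows "win X i l + cyc m Q (i - int l) = (\<Sum>t<l. L (i - int t)) + cyc m Q i"
proof (induction l)
  case 0
  show ?case by (simp add: win_def past_def)
next
  case (Suc l)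
  have "win X i (Suc l) = win X i l + X (i - int l)"
    using win_add[of X i l 1] by (simp add: win_def past_def)
  moreover have "L (i - int l) + cyc m Q (i - int l) = X (i - int l) + cyc m Q (i - int l - 1)"
    using assms by (simp add: flow_def)
  ultimately show ?case using Suc by (simp add: algebra_simps)
qed

text \<open>A non-full bucket passes nothing on, so every key hashed into a window ending there is
  stored in the window, which still has room.\<close>

lemma not_full_imp: "L i < b \<Longrightarrow> l \<ge> 1 \<Longrightarrow> win X i l < b * l"
proof -
  assume Li: "L i < b" and l: "l \<ge> 1"
  obtain Q where Q: "flow b m hs (loads b m hs) Q" using ex_flow[OF m hs, of b] len by auto
  have "win X i l \<le> (\<Sum>t<l. L (i - int t)) + cyc m Q i" using flow_window[OF Q, of i l] by simp
  also have "\<dots> = (\<Sum>t<l. L (i - int t))" using Q Li by (simp add: flow_def)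
  also have "\<dots> < (\<Sum>t<l. b)"
    using Q Li l by (intro sum_strict_mono_ex1) (auto simp: flow_def intro!: bexI[of _ 0])
  finally show ?thesis by (simp add: mult.commute)
qed

text \<open>Take the block of full buckets back to the nearest non-full one: nothing flows into the
  block, so its \<open>b * N\<close> keys were all hashed into it. Its length is below
  \<open>m\<close> because some bucket is free.\<close>

lemma full_window:
  assumes "\<And>t. t < k \<Longrightarrow> \<not> L (i - int t) < b"
  shows "\<exists>N. k \<le> N \<and> N < m \<and> b * N \<le> win X i N"
proof -
  obtain Q where Q: "flow b m hs (loads b m hs) Q" using ex_flow[OF m hs, of b] len by auto
  define N where "N = (LEAST N. L (i - int N) < b)"
  obtain N0 where N0: "N0 < m" "L (i - int N0) < b" using ex_free_offset(1)[OF m len] by blast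
  have N: "L (i - int N) < b" unfolding N_def by (rule LeastI[of _ N0]) (rule N0)
  have "N < m" using N0 Least_le[of "\<lambda>N. L (i - int N) < b" N0] by (simp add: N_def)
  moreover have "k \<le> N" using assms[of N] N by (cases "k \<le> N") auto
  moreover have full: "L (i - int t) = b" if "t < N" for t
  proof -
    have "\<not> L (i - int t) < b"
      using not_less_Least[of t "\<lambda>N. L (i - int N) < b"] that by (simp add: N_def)
    moreover have "L (i - int t) \<le> b" using Q by (simp add: flow_def)
    ultimately show ?thesis by simp
  qed
  have "(\<Sum>t<N. L (i - int t)) = b * N" by (simp add: full)
  then have "b * N \<le> win X i N" using flow_window[OF Q, of i N] Q N by (simp add: flow_def)
  ultimately show ?thesis by blast
qed

lemma full_iff_overfull: "\<not> L i < b \<longleftrightarrow> overfull b X i"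
proof
  assume "\<not> L i < b"
  then obtain N where "1 \<le> N" "b * N \<le> win X i N" using full_window[of 1 i] by auto
  then show "overfull b X i" by (auto simp: overfull_def)
next
  assume "overfull b X i"
  then show "\<not> L i < b" using not_full_imp unfolding overfull_def by (meson not_less)
qed

text \<open>In contrast to \<open>run_imp_win\<close> the window is shorter than \<open>m\<close>,
  as the Chernoff bound on the cycle demands.\<close>

lemma run_imp_window:
  assumes "run b k X h"
  shows "\<exists>N. k \<le> N \<and> N < m \<and> b * N \<le> win X (h + int k - 1) N"
proof (rule full_window)
  fix t assume t: "t < k"
  have "overfull b X (h + int (k - 1 - t))"
    by (rule assms[unfolded run_def, rule_format]) (use t in simp)
  moreover have "h + int (k - 1 - t) = h + int k - 1 - int t" using t by (simp add: of_nat_diff)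
  ultimately have "overfull b X (h + int k - 1 - int t)" by (simp only:)
  then show "\<not> L (h + int k - 1 - int t) < b" by (simp only: full_iff_overfull)
qed

lemma run_truncation:
  assumes "run b k X h" "\<not> run_upto b T k X h"
  shows "\<exists>i<k. \<exists>N. T < N \<and> N < m \<and> b * N \<le> win X (h + int i) N"
proof -
  obtain i where i: "i < k" "\<not> overfull_upto b T X (h + int i)"
    using assms(2) by (auto simp: run_upto_def)
  then have "\<not> L (h + int i) < b" using assms(1) by (auto simp: run_def full_iff_overfull)
  then obtain N where N: "1 \<le> N" "N < m" "b * N \<le> win X (h + int i) N"
    using full_window[of 1 "h + int i"] by auto
  moreover have "T < N" using i(2) N by (force simp: overfull_upto_def)
  ultimately show ?thesis using i(1) by blast
qed

lemma displacement_iff_run: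
  "(LEAST d. loads b m hs ((h + d) mod m) < b) = k \<longleftrightarrow> run b k X (int h) \<and> \<not> run b (Suc k) X (int h)"
proof -
  let ?P = "\<lambda>d. loads b m hs ((h + d) mod m) < b"
  have P: "?P d \<longleftrightarrow> \<not> overfull b X (int h + int d)" for d
    using full_iff_overfull[of "int h + int d"] unfolding cyc_nat[OF m] by blast
  obtain d where "?P d" using ex_free_offset(2)[OF m len, of "int h"] by (auto simp: cyc_nat[OF m])
  then have 1: "?P (Least ?P)" by (rule LeastI)
  have 2: "i < Least ?P \<Longrightarrow> \<not> ?P i" for i by (rule not_less_Least)
  have "run b k X (int h) \<and> \<not> run b (Suc k) X (int h) \<longleftrightarrow> (\<forall>i<k. \<not> ?P i) \<and> ?P k"
    unfolding P by (auto simp: run_def less_Suc_eq)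
  also have "\<dots> \<longleftrightarrow> Least ?P = k" using 1 2 by (metis linorder_neqE_nat)
  finally show ?thesis by blast
qed

end

section \<open>Random hash addresses\<close>

lemma hash_sequences_0: "hash_sequences m 0 = {[]}"
  by (auto simp: hash_sequences_def)

lemma hash_sequences_Suc: "hash_sequences m (Suc n) = (\<lambda>(h, hs). h # hs) ` ({..<m} \<times> hash_sequences m n)"
  by (auto simp: hash_sequences_def image_iff length_Suc_conv)

lemma finite_hash_sequences [simp]: "finite (hash_sequences m n)"
  by (induction n) (auto simp: hash_sequences_0 hash_sequences_Suc)

lemma card_hash_sequences: "card (hash_sequences m n) = m ^ n"
  unfolding hash_sequences_Suc
  by (induction n) (auto simp: hash_sequences_0 hash_sequences_Suc card_image inj_on_def card_cartesian_product)

lemma hash_sequences_nonempty: "m > 0 \<Longrightarrow> hash_sequences m n \<noteq> {}"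
  using card_hash_sequences[of m n] by (metis card.empty power_not_zero not_less0)

lemma sum_hash_sequences_Suc:
  "(\<Sum>hs\<in>hash_sequences m (Suc n). f hs) = (\<Sum>h<m. \<Sum>hs\<in>hash_sequences m n. f (h # hs))"
  unfolding hash_sequences_Suc
  by (subst sum.reindex) (auto simp: inj_on_def sum.cartesian_product case_prod_unfold)

abbreviation hash_prob :: "nat \<Rightarrow> nat \<Rightarrow> (nat list \<Rightarrow> bool) \<Rightarrow> real" where
  "hash_prob m n P \<equiv> measure_pmf.prob (pmf_of_set (hash_sequences m n)) {hs. P hs}"

lemma hash_prob_eq:
  assumes "m > 0"
  shows "hash_prob m n P = real (card {hs \<in> hash_sequences m n. P hs}) / real m ^ n"
  using assms by (simp add: measure_pmf_of_set hash_sequences_nonempty card_hash_sequences Int_def)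

lemma hash_prob_mono:
  assumes "m > 0" "\<And>hs. hs \<in> hash_sequences m n \<Longrightarrow> P hs \<Longrightarrow> Q hs"
  shows "hash_prob m n P \<le> hash_prob m n Q"
  using assms unfolding hash_prob_eq[OF assms(1)]
  by (intro divide_right_mono of_nat_mono card_mono) auto

lemma hash_prob_cong:
  assumes "m > 0" "\<And>hs. hs \<in> hash_sequences m n \<Longrightarrow> P hs \<longleftrightarrow> Q hs"
  shows "hash_prob m n P = hash_prob m n Q"
  using hash_prob_mono[of m n P Q] hash_prob_mono[of m n Q P] assms by force

text \<open>The unnormalised binomial generating function: each address contributes \<open>z\<close>
  for the elements of \<open>W\<close> and 1 for the others.\<close>

lemma sum_power_length_filter:
  fixes z :: real
  assumes "W \<subseteq> {..<m}"
  shows "(\<Sum>hs\<in>hash_sequences m n. z ^ length (filter (\<lambda>h. h \<in> W) hs)) = (real m + (z - 1) * real (card W)) ^ n"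
proof (induction n)
  case 0
  show ?case by (simp add: hash_sequences_0)
next
  case (Suc n)
  have fin: "finite W" using assms finite_subset by blast
  have "(\<Sum>h<m. (if h \<in> W then z else 1)) = (\<Sum>h<m. 1 + (z - 1) * (if h \<in> W then 1 else 0))"
    by (rule sum.cong) auto
  also have "\<dots> = real m + (z - 1) * (\<Sum>h\<in>{..<m}. if h \<in> W then 1 else 0)"
    by (simp add: sum.distrib sum_distrib_left)
  also have "(\<Sum>h\<in>{..<m}. if h \<in> W then 1 else 0) = real (card W)"
    using assms by (simp add: sum.If_cases Int_absorb1)
  finally have W: "(\<Sum>h<m. (if h \<in> W then z else 1)) = real m + (z - 1) * real (card W)" .
  have "(\<Sum>hs\<in>hash_sequences m (Suc n). z ^ length (filter (\<lambda>h. h \<in> W) hs))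
     = (\<Sum>h<m. (if h \<in> W then z else 1) * (\<Sum>hs\<in>hash_sequences m n. z ^ length (filter (\<lambda>h. h \<in> W) hs)))"
    unfolding sum_hash_sequences_Suc sum_distrib_left by (intro sum.cong refl) auto
  then show ?case unfolding Suc sum_distrib_right[symmetric] W by simp
qed

section \<open>Chernoff bound for windows on the cycle\<close>

lemma inj_cyc_window:
  assumes "N \<le> m"
  shows "inj_on (\<lambda>t. nat ((i - int t) mod int m)) {..<N}"
proof (rule inj_onI)
  fix s t assume st: "s \<in> {..<N}" "t \<in> {..<N}" "nat ((i - int s) mod int m) = nat ((i - int t) mod int m)"
  then have m: "m > 0" using assms by auto
  then have "(i - int s) mod int m = (i - int t) mod int m" using st(3) by (simp add: nat_eq_iff)
  then have "int m dvd \<bar>int t - int s\<bar>" by (simp add: mod_eq_dvd_iff)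
  moreover have "\<bar>int t - int s\<bar> < int m" using st assms by auto
  ultimately have "\<not> 0 < \<bar>int t - int s\<bar>" using zdvd_not_zless by blast
  then show "s = t" by simp
qed

lemma sum_count_list:
  assumes "finite W"
  shows "(\<Sum>w\<in>W. count_list hs w) = length (filter (\<lambda>h. h \<in> W) hs)"
proof (induction hs)
  case (Cons a hs)
  have "(\<Sum>w\<in>W. count_list (a # hs) w) = (\<Sum>w\<in>W. count_list hs w + (if a = w then 1 else 0))"
    by (rule sum.cong) auto
  then show ?case using Cons assms by (simp add: sum.distrib)
qed simp

lemma win_cyc_eq:
  fixes i :: int
  assumes "N \<le> m"
  defines "W \<equiv> (\<lambda>t. nat ((i - int t) mod int m)) ` {..<N}"
  shows "win (cyc m (count_list hs)) i N = length (filter (\<lambda>h. h \<in> W) hs)"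
proof -
  have "win (cyc m (count_list hs)) i N = (\<Sum>t<N. count_list hs (nat ((i - int t) mod int m)))"
    by (simp add: win_def past_def sum_list_sum_nth cyc_def atLeast0LessThan)
  also have "\<dots> = (\<Sum>w\<in>W. count_list hs w)"
    unfolding W_def by (subst sum.reindex[OF inj_cyc_window[OF assms(1)]]) simp
  finally show ?thesis by (simp add: sum_count_list W_def)
qed

text \<open>Chernoff's bound with the same tilt \<open>1 / \<beta>\<close>. By
  \<open>1 + x \<le> exp x\<close> the binomial generating function is at most the Poisson one, so
  the rate is that of the infinite model.\<close>

lemma hash_prob_win_ge:
  assumes \<beta>: "0 < \<beta>" "\<beta> < 1" and m: "m > 0" and N: "N \<le> m" and n: "real n \<le> \<beta> * real (b * m)"
  shows "hash_prob m n (\<lambda>hs. b * N \<le> win (cyc m (count_list hs)) i N) \<le> load_ratio b \<beta> ^ N"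
proof -
  define W where "W = (\<lambda>t. nat ((i - int t) mod int m)) ` {..<N}"
  define z where "z = 1 / \<beta>"
  have z: "z > 1" using \<beta> by (simp add: z_def)
  have W: "W \<subseteq> {..<m}" using m by (auto simp: W_def nat_less_iff)
  have card: "card W = N" unfolding W_def by (simp add: card_image inj_cyc_window N)
  let ?A = "{hs \<in> hash_sequences m n. b * N \<le> win (cyc m (count_list hs)) i N}"
  have "real (card ?A) * z ^ (b * N) = (\<Sum>hs\<in>?A. z ^ (b * N))" by simp
  also have "\<dots> \<le> (\<Sum>hs\<in>?A. z ^ length (filter (\<lambda>h. h \<in> W) hs))"
    using z by (intro sum_mono power_increasing) (auto simp: win_cyc_eq[OF N] W_def)
  also have "\<dots> \<le> (\<Sum>hs\<in>hash_sequences m n. z ^ length (filter (\<lambda>h. h \<in> W) hs))"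
    using z by (intro sum_mono2) auto
  also have "\<dots> = (real m + (z - 1) * real N) ^ n"
    by (simp add: sum_power_length_filter[OF W] card)
  also have "\<dots> = real m ^ n * (1 + (z - 1) * real N / real m) ^ n"
    using m by (simp add: power_mult_distrib[symmetric] field_simps)
  also have "\<dots> \<le> real m ^ n * exp ((z - 1) * real N / real m) ^ n"
    using z m by (intro mult_left_mono power_mono exp_ge_add_one_self add_nonneg_nonneg) auto
  also have "exp ((z - 1) * real N / real m) ^ n = exp ((z - 1) * real N * (real n / real m))"
    by (simp add: exp_of_nat_mult[symmetric] mult_ac)
  also have "\<dots> \<le> exp ((z - 1) * real N * (\<beta> * real b))"
    using z n m by (subst exp_le_cancel_iff, intro mult_left_mono) (auto simp: divide_simps mult_ac)
  also have "\<dots> = exp (\<beta> * real b * (z - 1)) ^ N"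
    by (simp add: exp_of_nat_mult[symmetric] mult_ac)
  finally have "real (card ?A) / real m ^ n * z ^ (b * N) \<le> exp (\<beta> * real b * (z - 1)) ^ N"
    using m by (simp add: field_simps)
  moreover have "load_ratio b \<beta> * z ^ b = exp (\<beta> * real b * (z - 1))"
    using \<beta> unfolding load_ratio_eq_tilt[OF \<beta>(1)] z_def by (simp add: power_one_over)
  then have "load_ratio b \<beta> ^ N * z ^ (b * N) = exp (\<beta> * real b * (z - 1)) ^ N"
    by (simp only: power_mult power_mult_distrib[symmetric])
  ultimately have "real (card ?A) / real m ^ n * z ^ (b * N) \<le> load_ratio b \<beta> ^ N * z ^ (b * N)"
    by simp
  moreover have "0 < z ^ (b * N)" using z by simp
  ultimately show ?thesis
    unfolding hash_prob_eq[OF m] by (rule mult_right_le_imp_le)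
qed

lemma hash_prob_ex_le:
  assumes "finite I"
  shows "hash_prob m n (\<lambda>hs. \<exists>i\<in>I. P i hs) \<le> (\<Sum>i\<in>I. hash_prob m n (P i))"
proof -
  have "{hs. \<exists>i\<in>I. P i hs} = (\<Union>i\<in>I. {hs. P i hs})" by auto
  then show ?thesis using assms by (simp add: measure_pmf.finite_measure_subadditive_finite)
qed

lemma sum_power_le_geometric:
  fixes \<theta> :: real
  assumes "0 \<le> \<theta>" "\<theta> < 1"
  shows "(\<Sum>N\<in>{k..<m}. \<theta> ^ N) \<le> \<theta> ^ k / (1 - \<theta>)"
proof (cases "k < m")
  case True
  then obtain m' where m': "m = Suc m'" "k \<le> m'" by (cases m) auto
  have "(\<Sum>N\<in>{k..<m}. \<theta> ^ N) * (1 - \<theta>) = \<theta> ^ k - \<theta> ^ m"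
    using sum_gp_multiplied[OF m'(2), of \<theta>] by (simp add: m'(1) atLeastLessThanSuc_atLeastAtMost mult.commute)
  then have "(\<Sum>N\<in>{k..<m}. \<theta> ^ N) * (1 - \<theta>) \<le> \<theta> ^ k" using assms by simp
  then show ?thesis using assms by (simp add: field_simps)
qed (use assms in auto)

text \<open>Here \<beta> is an upper bound for the load, not the load itself, so one choice of
  \<beta> serves all stages of the insertion.\<close>

locale exact_model =
  fixes b :: nat and \<beta> :: real and m n :: nat
  assumes b: "b \<ge> 1" and \<beta>0: "0 < \<beta>" and \<beta>1: "\<beta> < 1" and m: "m > 0" and n: "real n \<le> \<beta> * real (b * m)"
begin

lemma n_less: "n < b * m"
proof -
  have "\<beta> * real (b * m) < real (b * m)" using \<beta>1 b m by simp
  with n show ?thesis by linarith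
qed

lemma hashing: "hs \<in> hash_sequences m n \<Longrightarrow> hashing b m hs"
  using m n_less by unfold_locales (auto simp: hash_sequences_def)

lemma theta: "0 < load_ratio b \<beta>" "load_ratio b \<beta> < 1"
  using load_ratio_pos[OF \<beta>0] load_ratio_less_1[OF \<beta>0 \<beta>1 b] by auto

lemma hash_prob_window:
  "hash_prob m n (\<lambda>hs. \<exists>N\<in>{k..<m}. b * N \<le> win (cyc m (count_list hs)) i N)
     \<le> load_ratio b \<beta> ^ k / (1 - load_ratio b \<beta>)"
proof -
  have "hash_prob m n (\<lambda>hs. \<exists>N\<in>{k..<m}. b * N \<le> win (cyc m (count_list hs)) i N)
     \<le> (\<Sum>N\<in>{k..<m}. load_ratio b \<beta> ^ N)"
    by (rule order_trans[OF hash_prob_ex_le sum_mono]) (use hash_prob_win_ge[OF \<beta>0 \<beta>1 m _ n] in auto)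
  also have "\<dots> \<le> load_ratio b \<beta> ^ k / (1 - load_ratio b \<beta>)"
    using theta by (intro sum_power_le_geometric) auto
  finally show ?thesis .
qed

lemma hash_prob_run_le:
  "hash_prob m n (\<lambda>hs. run b k (cyc m (count_list hs)) h) \<le> load_ratio b \<beta> ^ k / (1 - load_ratio b \<beta>)"
proof (rule order_trans[OF hash_prob_mono[OF m] hash_prob_window])
  fix hs assume "hs \<in> hash_sequences m n" "run b k (cyc m (count_list hs)) h"
  then show "\<exists>N\<in>{k..<m}. b * N \<le> win (cyc m (count_list hs)) (h + int k - 1) N"
    using hashing.run_imp_window[OF hashing] by force
qed

lemma hash_prob_run_truncation:
  "\<bar>hash_prob m n (\<lambda>hs. run b k (cyc m (count_list hs)) h)
     - hash_prob m n (\<lambda>hs. run_upto b T k (cyc m (count_list hs)) h)\<bar>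
   \<le> real k * (load_ratio b \<beta> ^ Suc T / (1 - load_ratio b \<beta>))"
proof -
  let ?X = "\<lambda>hs. cyc m (count_list hs)"
  let ?P = "\<lambda>i hs. \<exists>N\<in>{Suc T..<m}. b * N \<le> win (?X hs) (h + int i) N"
  have "hash_prob m n (\<lambda>hs. run_upto b T k (?X hs) h) \<le> hash_prob m n (\<lambda>hs. run b k (?X hs) h)"
    by (rule hash_prob_mono[OF m]) (rule run_upto_imp_run)
  moreover have "hash_prob m n (\<lambda>hs. run b k (?X hs) h)
      \<le> hash_prob m n (\<lambda>hs. run_upto b T k (?X hs) h \<or> (\<exists>i\<in>{..<k}. ?P i hs))"
  proof (rule hash_prob_mono[OF m])
    fix hs assume "hs \<in> hash_sequences m n" "run b k (?X hs) h"
    then show "run_upto b T k (?X hs) h \<or> (\<exists>i\<in>{..<k}. ?P i hs)"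
      using hashing.run_truncation[OF hashing, of hs k h T] by (force simp: Suc_le_eq)
  qed
  moreover have "hash_prob m n (\<lambda>hs. run_upto b T k (?X hs) h \<or> (\<exists>i\<in>{..<k}. ?P i hs))
     \<le> hash_prob m n (\<lambda>hs. run_upto b T k (?X hs) h) + hash_prob m n (\<lambda>hs. \<exists>i\<in>{..<k}. ?P i hs)"
    unfolding Collect_disj_eq by (rule measure_subadditive) auto
  moreover have "hash_prob m n (\<lambda>hs. \<exists>i\<in>{..<k}. ?P i hs) \<le> (\<Sum>i<k. load_ratio b \<beta> ^ Suc T / (1 - load_ratio b \<beta>))"
    by (rule order_trans[OF hash_prob_ex_le sum_mono]) (simp, rule hash_prob_window)
  ultimately show ?thesis by simp
qed

end

section \<open>Poisson limit of the bucket counts\<close>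

definition fall :: "nat \<Rightarrow> nat \<Rightarrow> real" where
  "fall n N = (\<Prod>s<N. real n - real s)"

lemma fall_Suc: "fall (Suc n) (Suc N) = (real n + 1) * fall n N"
  unfolding fall_def by (subst prod.lessThan_Suc_shift) simp

lemma fall_eq_0: "n < N \<Longrightarrow> fall n N = 0"
  by (auto simp: fall_def)

text \<open>A multinomial count with denominators cleared. Induction on the first key, which either
  avoids the \<open>w\<close> given addresses or lowers one of the prescribed counts.\<close>

lemma card_counts:
  assumes "inj_on \<rho> {..<w}" "\<rho> ` {..<w} \<subseteq> {..<m}"
  shows "real (card {hs \<in> hash_sequences m n. \<forall>t<w. count_list hs (\<rho> t) = x t}) * (\<Prod>t<w. fact (x t))
    = fall n (\<Sum>t<w. x t) * real (m - w) ^ (n - (\<Sum>t<w. x t))"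
proof (induction n arbitrary: x)
  case 0
  show ?case
  proof (cases "\<forall>t<w. x t = 0")
    case True
    then have "{hs \<in> hash_sequences m 0. \<forall>t<w. count_list hs (\<rho> t) = x t} = {[]}"
      by (auto simp: hash_sequences_0)
    then show ?thesis using True by (simp add: fall_def)
  next
    case False
    then obtain t where t: "t < w" "x t \<noteq> 0" by blast
    then have e: "{hs \<in> hash_sequences m 0. \<forall>t<w. count_list hs (\<rho> t) = x t} = {}"
      by (auto simp: hash_sequences_0)
    have "x t \<le> (\<Sum>t<w. x t)" using t by (intro member_le_sum) auto
    then have "fall 0 (\<Sum>t<w. x t) = 0" using t by (intro fall_eq_0) simp
    with e show ?thesis by simp
  qed
next
  case (Suc n)
  define C where "C n x = {hs \<in> hash_sequences m n. \<forall>t<w. count_list hs (\<rho> t) = x t}" for n and x :: "nat \<Rightarrow> nat"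
  define N where "N = (\<Sum>t<w. x t)"
  define F where "F x = (\<Prod>t<w. fact (x t) :: real)" for x :: "nat \<Rightarrow> nat"
  have IH: "real (card (C n y)) * F y = fall n (\<Sum>t<w. y t) * real (m - w) ^ (n - (\<Sum>t<w. y t))" for y
    using Suc.IH[of y] by (simp add: C_def F_def)
  have card_img: "card (\<rho> ` {..<w}) = w" using assms(1) by (simp add: card_image)
  have wm: "w \<le> m" using card_mono[OF _ assms(2)] card_img by simp
  have "real (card (C (Suc n) x)) = (\<Sum>hs\<in>hash_sequences m (Suc n). if \<forall>t<w. count_list hs (\<rho> t) = x t then 1 else 0)"
    by (simp add: C_def sum.If_cases Int_def)
  also have "\<dots> = (\<Sum>h<m. \<Sum>hs\<in>hash_sequences m n. if \<forall>t<w. count_list (h # hs) (\<rho> t) = x t then 1 else 0)"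
    by (rule sum_hash_sequences_Suc)
  also have "\<dots> = (\<Sum>h<m. real (card {hs \<in> hash_sequences m n. \<forall>t<w. count_list (h # hs) (\<rho> t) = x t}))"
    by (simp add: sum.If_cases Int_def)
  also have "\<dots> = (\<Sum>h\<in>{..<m} - \<rho> ` {..<w}. real (card {hs \<in> hash_sequences m n. \<forall>t<w. count_list (h # hs) (\<rho> t) = x t}))
     + (\<Sum>h\<in>\<rho> ` {..<w}. real (card {hs \<in> hash_sequences m n. \<forall>t<w. count_list (h # hs) (\<rho> t) = x t}))"
    by (rule sum.subset_diff[OF assms(2)]) simp
  also have "(\<Sum>h\<in>{..<m} - \<rho> ` {..<w}. real (card {hs \<in> hash_sequences m n. \<forall>t<w. count_list (h # hs) (\<rho> t) = x t}))
     = real (m - w) * real (card (C n x))"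
  proof -
    have "{hs \<in> hash_sequences m n. \<forall>t<w. count_list (h # hs) (\<rho> t) = x t} = C n x"
      if "h \<in> {..<m} - \<rho> ` {..<w}" for h
      using that by (auto simp: C_def)
    then show ?thesis using assms(2) card_img by (simp add: card_Diff_subset)
  qed
  also have "(\<Sum>h\<in>\<rho> ` {..<w}. real (card {hs \<in> hash_sequences m n. \<forall>t<w. count_list (h # hs) (\<rho> t) = x t}))
     = (\<Sum>t<w. real (card {hs \<in> hash_sequences m n. \<forall>s<w. count_list (\<rho> t # hs) (\<rho> s) = x s}))"
    by (subst sum.reindex[OF assms(1)]) simp
  also have "\<dots> = (\<Sum>t<w. if x t = 0 then 0 else real (card (C n (x(t := x t - 1)))))"
  proof (rule sum.cong[OF refl])
    fix t assume t: "t \<in> {..<w}"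
    have "count_list (\<rho> t # hs) (\<rho> s) = count_list hs (\<rho> s) + (if s = t then 1 else 0)" if "s < w" for s hs
      using assms(1) t that by (auto simp: inj_on_def)
    then have "{hs \<in> hash_sequences m n. \<forall>s<w. count_list (\<rho> t # hs) (\<rho> s) = x s}
       = {hs \<in> hash_sequences m n. \<forall>s<w. count_list hs (\<rho> s) + (if s = t then 1 else 0) = x s}"
      by auto
    also have "\<dots> = (if x t = 0 then {} else C n (x(t := x t - 1)))"
      using t by (auto simp: C_def)
    finally show "real (card {hs \<in> hash_sequences m n. \<forall>s<w. count_list (\<rho> t # hs) (\<rho> s) = x s})
       = (if x t = 0 then 0 else real (card (C n (x(t := x t - 1)))))" by simp
  qed
  finally have rec: "real (card (C (Suc n) x)) = real (m - w) * real (card (C n x))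
     + (\<Sum>t<w. if x t = 0 then 0 else real (card (C n (x(t := x t - 1)))))" .
  have "real (card (C (Suc n) x)) * F x = real (m - w) * (fall n N * real (m - w) ^ (n - N))
     + (\<Sum>t<w. (if x t = 0 then 0 else real (card (C n (x(t := x t - 1))))) * F x)"
    unfolding rec N_def IH[symmetric] by (simp add: algebra_simps sum_distrib_left)
  also have "(\<Sum>t<w. (if x t = 0 then 0 else real (card (C n (x(t := x t - 1))))) * F x)
     = (\<Sum>t<w. real (x t) * (fall n (N - 1) * real (m - w) ^ (n - (N - 1))))"
  proof (rule sum.cong[OF refl])
    fix t assume t: "t \<in> {..<w}"
    show "(if x t = 0 then 0 else real (card (C n (x(t := x t - 1))))) * F x
       = real (x t) * (fall n (N - 1) * real (m - w) ^ (n - (N - 1)))"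
    proof (cases "x t = 0")
      case False
      have "F x = fact (x t) * (\<Prod>s\<in>{..<w} - {t}. fact (x s))"
        unfolding F_def using t by (subst prod.remove[of _ t]) auto
      moreover have "F (x(t := x t - 1)) = fact (x t - 1) * (\<Prod>s\<in>{..<w} - {t}. fact (x s))"
        unfolding F_def using t by (subst prod.remove[of _ t]) auto
      ultimately have "F x = real (x t) * F (x(t := x t - 1))"
        using False by (simp add: fact_reduce)
      moreover have "(\<Sum>s<w. (x(t := x t - 1)) s) = N - 1"
      proof -
        have "N = x t + (\<Sum>s\<in>{..<w} - {t}. x s)"
          unfolding N_def using t by (subst sum.remove[of _ t]) auto
        moreover have "(\<Sum>s<w. (x(t := x t - 1)) s) = x t - 1 + (\<Sum>s\<in>{..<w} - {t}. x s)"
          using t by (subst sum.remove[of _ t]) auto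
        ultimately show ?thesis using False by simp
      qed
      ultimately show ?thesis using False IH[of "x(t := x t - 1)"] by simp
    qed simp
  qed
  also have "\<dots> = real N * (fall n (N - 1) * real (m - w) ^ (n - (N - 1)))"
    by (simp add: N_def sum_distrib_right)
  \<comment> \<open>This is \<open>fall (Suc n) N = fall n N + N * fall n (N - 1)\<close>. When
    \<open>N > n\<close> an exponent is truncated, but then \<open>fall n N\<close>
    vanishes.\<close>
  also have "real (m - w) * (fall n N * real (m - w) ^ (n - N)) + real N * (fall n (N - 1) * real (m - w) ^ (n - (N - 1)))
     = fall (Suc n) N * real (m - w) ^ (Suc n - N)"
  proof (cases N)
    case 0
    then show ?thesis by (simp add: fall_def)
  next
    case (Suc K)
    have fK: "fall n (Suc K) = fall n K * (real n - real K)" by (simp add: fall_def)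
    show ?thesis
    proof (cases "K < n")
      case True
      then have "n - K = Suc (n - Suc K)" by simp
      then show ?thesis unfolding Suc fall_Suc fK by (simp add: algebra_simps)
    next
      case False
      then consider "n = K" | "n < K" by linarith
      then show ?thesis
        by cases (simp_all add: Suc fall_Suc fK fall_eq_0)
    qed
  qed
  finally show ?case by (simp add: C_def F_def N_def)
qed

lemma hash_prob_past:
  assumes m: "m > 0" and w: "w \<le> m" and len: "length ys = w"
  defines "N \<equiv> sum_list ys"
  shows "hash_prob m n (\<lambda>hs. past (cyc m (count_list hs)) i w = ys)
    = fall n N * real (m - w) ^ (n - N) / (\<Prod>t<w. fact (ys ! t)) / real m ^ n"
proof -
  let ?\<rho> = "\<lambda>t. nat ((i - int t) mod int m)"
  have \<rho>: "?\<rho> ` {..<w} \<subseteq> {..<m}" using m by (auto simp: nat_less_iff)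
  have "past (cyc m (count_list hs)) i w = ys \<longleftrightarrow> (\<forall>t<w. count_list hs (?\<rho> t) = ys ! t)" for hs
    using len by (auto simp: list_eq_iff_nth_eq past_def cyc_def)
  then have "hash_prob m n (\<lambda>hs. past (cyc m (count_list hs)) i w = ys)
     = real (card {hs \<in> hash_sequences m n. \<forall>t<w. count_list hs (?\<rho> t) = ys ! t}) / real m ^ n"
    by (simp add: hash_prob_eq[OF m])
  also have "real (card {hs \<in> hash_sequences m n. \<forall>t<w. count_list hs (?\<rho> t) = ys ! t})
     = fall n N * real (m - w) ^ (n - N) / (\<Prod>t<w. fact (ys ! t))"
  proof (subst nonzero_eq_divide_eq)
    have "N = (\<Sum>t<w. ys ! t)"
      using len by (simp add: N_def sum_list_sum_nth atLeast0LessThan)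
    then show "real (card {hs \<in> hash_sequences m n. \<forall>t<w. count_list hs (?\<rho> t) = ys ! t}) * (\<Prod>t<w. fact (ys ! t))
        = fall n N * real (m - w) ^ (n - N)"
      using card_counts[OF inj_cyc_window[OF w, of i] \<rho>, of n "\<lambda>t. ys ! t"] by simp
  qed simp
  finally show ?thesis .
qed

section \<open>From multinomial probabilities to independent Poisson counts\<close>

lemma fall_tendsto:
  fixes m n :: "nat \<Rightarrow> nat"
  assumes m: "filterlim m at_top sequentially" and lim: "(\<lambda>i. real (n i) / real (m i)) \<longlonglongrightarrow> c"
  shows "(\<lambda>i. fall (n i) N / real (m i) ^ N) \<longlonglongrightarrow> c ^ N"
proof -
  have minv: "(\<lambda>i. inverse (real (m i))) \<longlonglongrightarrow> 0"
    by (intro tendsto_inverse_0_at_top filterlim_compose[OF filterlim_real_sequentially m])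
  have "(\<lambda>i. \<Prod>s<N. real (n i) / real (m i) - real s * inverse (real (m i))) \<longlonglongrightarrow> (\<Prod>s<N. c - real s * 0)"
    by (intro tendsto_intros lim minv)
  moreover have "(\<Prod>s<N. real (n i) / real (m i) - real s * inverse (real (m i))) = fall (n i) N / real (m i) ^ N" for i
    by (simp add: fall_def divide_inverse[symmetric] diff_divide_distrib[symmetric] prod_dividef)
  ultimately show ?thesis by simp
qed

text \<open>Replacing the exponent \<open>n i\<close> by the truncated \<open>n i - N\<close>
  changes the power by at most the factor \<open>(1 - w / m i) ^ N\<close>, which tends to
  1.\<close>

lemma power_tendsto_exp:
  fixes m n :: "nat \<Rightarrow> nat"
  assumes m: "filterlim m at_top sequentially" and lim: "(\<lambda>i. real (n i) / real (m i)) \<longlonglongrightarrow> c"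
  shows "(\<lambda>i. (1 - real w / real (m i)) ^ (n i - N)) \<longlonglongrightarrow> exp (- (c * real w))"
proof -
  have rm: "filterlim (\<lambda>i. real (m i)) at_top sequentially"
    by (rule filterlim_compose[OF filterlim_real_sequentially m])
  have minv: "(\<lambda>i. inverse (real (m i))) \<longlonglongrightarrow> 0"
    by (rule tendsto_inverse_0_at_top[OF rm])
  have "(\<lambda>i. 1 - real w * inverse (real (m i))) \<longlonglongrightarrow> 1 - real w * 0" by (intro tendsto_intros minv)
  then have wlim: "(\<lambda>i. 1 - real w / real (m i)) \<longlonglongrightarrow> 1" by (simp add: divide_inverse)
  have ev: "\<forall>\<^sub>F i in sequentially. real w + 1 < real (m i)"
    using rm by (auto simp: filterlim_at_top_dense)
  have "((\<lambda>x. ln (1 - real w * x) / x) \<longlongrightarrow> - real w) (at_right 0)"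
    by real_asymp
  moreover have "filterlim (\<lambda>i. inverse (real (m i))) (at_right 0) sequentially"
    using minv ev by (auto simp: filterlim_at elim!: eventually_mono)
  ultimately have "(\<lambda>i. ln (1 - real w * inverse (real (m i))) / inverse (real (m i))) \<longlonglongrightarrow> - real w"
    by (rule filterlim_compose)
  then have "(\<lambda>i. real (n i) / real (m i) * (ln (1 - real w * inverse (real (m i))) / inverse (real (m i)))) \<longlonglongrightarrow> c * - real w"
    by (rule tendsto_mult[OF lim])
  then have "(\<lambda>i. exp (real (n i) / real (m i) * (ln (1 - real w * inverse (real (m i))) / inverse (real (m i))))) \<longlonglongrightarrow> exp (c * - real w)"
    by (rule tendsto_exp)
  moreover have "\<forall>\<^sub>F i in sequentially. exp (real (n i) / real (m i) * (ln (1 - real w * inverse (real (m i))) / inverse (real (m i))))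
     = (1 - real w / real (m i)) ^ n i"
    using ev
  proof eventually_elim
    case (elim i)
    then have pos: "1 - real w / real (m i) > 0" by (simp add: field_simps)
    have "real (n i) / real (m i) * (ln (1 - real w * inverse (real (m i))) / inverse (real (m i))) = real (n i) * ln (1 - real w / real (m i))"
      using elim by (simp add: field_simps)
    then show ?case using pos by (simp add: exp_of_nat_mult)
  qed
  ultimately have full: "(\<lambda>i. (1 - real w / real (m i)) ^ n i) \<longlonglongrightarrow> exp (- (c * real w))"
    by (simp add: tendsto_cong)
  have low: "(\<lambda>i. (1 - real w / real (m i)) ^ n i / (1 - real w / real (m i)) ^ N) \<longlonglongrightarrow> exp (- (c * real w)) / 1 ^ N"
    by (intro tendsto_intros full wlim) simp
  show ?thesis
  proof (rule tendsto_sandwich[OF _ _ full])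
    show "(\<lambda>i. (1 - real w / real (m i)) ^ n i / (1 - real w / real (m i)) ^ N) \<longlonglongrightarrow> exp (- (c * real w))"
      using low by simp
    show "\<forall>\<^sub>F i in sequentially. (1 - real w / real (m i)) ^ n i \<le> (1 - real w / real (m i)) ^ (n i - N)"
      using ev
    proof eventually_elim
      case (elim i)
      then show ?case by (intro power_decreasing) (auto simp: field_simps)
    qed
    show "\<forall>\<^sub>F i in sequentially. (1 - real w / real (m i)) ^ (n i - N) \<le> (1 - real w / real (m i)) ^ n i / (1 - real w / real (m i)) ^ N"
      using ev
    proof eventually_elim
      case (elim i)
      let ?q = "1 - real w / real (m i)"
      have q: "0 < ?q" "?q \<le> 1" using elim by (auto simp: field_simps)
      have "?q ^ (n i - N) * ?q ^ N = ?q ^ (n i - N + N)" by (simp add: power_add)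
      also have "\<dots> \<le> ?q ^ n i" using q by (intro power_decreasing) auto
      finally show ?case using q by (simp add: field_simps)
    qed
  qed
qed

lemma eventually_gt_nat:
  fixes m :: "nat \<Rightarrow> nat"
  assumes "filterlim m at_top F"
  shows "\<forall>\<^sub>F i in F. w < m i"
proof -
  have "\<forall>\<^sub>F i in F. Suc w \<le> m i" using assms by (auto simp: filterlim_at_top)
  then show ?thesis by (simp add: Suc_le_eq)
qed

text \<open>Scheffe's lemma. Finite subsets of \<open>A\<close> give the lower bound; applied to the
  complement it gives the upper bound, since the limit has total mass 1.\<close>

lemma measure_pmf_tendsto:
  fixes p :: "nat \<Rightarrow> 'a::countable pmf"
  assumes lim: "\<And>x. (\<lambda>i. pmf (p i) x) \<longlonglongrightarrow> pmf q x"
  shows "(\<lambda>i. measure_pmf.prob (p i) A) \<longlonglongrightarrow> measure_pmf.prob q A"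
proof -
  have lower: "\<forall>\<^sub>F i in sequentially. measure_pmf.prob q A - e < measure_pmf.prob (p i) A" if e: "e > 0" for A and e :: real
  proof -
    have "(\<lambda>k. measure_pmf.prob q (A \<inter> {x. to_nat x < k})) \<longlonglongrightarrow> measure_pmf.prob q (\<Union>k. A \<inter> {x. to_nat x < k})"
      by (rule measure_pmf.finite_Lim_measure_incseq) (auto simp: incseq_def)
    also have "(\<Union>k. A \<inter> {x. to_nat x < k}) = A" by auto
    finally have "\<forall>\<^sub>F k in sequentially. measure_pmf.prob q A - e < measure_pmf.prob q (A \<inter> {x. to_nat x < k})"
      using e by (intro order_tendstoD(1)) auto
    then obtain k where k: "measure_pmf.prob q A - e < measure_pmf.prob q (A \<inter> {x. to_nat x < k})"
      by (auto simp: eventually_sequentially)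
    define F where "F = A \<inter> {x. to_nat x < k}"
    have "finite {x::'a. to_nat x < k}"
      by (rule finite_imageD[of to_nat, OF finite_subset[of _ "{..<k}"]]) auto
    then have F: "finite F" by (simp add: F_def)
    have "(\<lambda>i. \<Sum>x\<in>F. pmf (p i) x) \<longlonglongrightarrow> (\<Sum>x\<in>F. pmf q x)"
      by (intro tendsto_sum lim)
    then have "\<forall>\<^sub>F i in sequentially. measure_pmf.prob q A - e < (\<Sum>x\<in>F. pmf (p i) x)"
      using k F by (intro order_tendstoD(1)) (auto simp: F_def[symmetric] measure_measure_pmf_finite)
    then show ?thesis
    proof eventually_elim
      case (elim i)
      have "(\<Sum>x\<in>F. pmf (p i) x) = measure_pmf.prob (p i) F" using F by (simp add: measure_measure_pmf_finite)
      also have "\<dots> \<le> measure_pmf.prob (p i) A"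
        by (rule measure_pmf.finite_measure_mono) (auto simp: F_def)
      finally show ?case using elim by simp
    qed
  qed
  show ?thesis
  proof (rule order_tendstoI)
    fix a assume "a < measure_pmf.prob q A"
    then show "\<forall>\<^sub>F i in sequentially. a < measure_pmf.prob (p i) A"
      using lower[of "measure_pmf.prob q A - a" A] by (auto elim!: eventually_mono)
  next
    fix a assume a: "a > measure_pmf.prob q A"
    have "\<forall>\<^sub>F i in sequentially. measure_pmf.prob q (- A) - (a - measure_pmf.prob q A) < measure_pmf.prob (p i) (- A)"
      using a by (intro lower) simp
    then show "\<forall>\<^sub>F i in sequentially. a > measure_pmf.prob (p i) A"
    proof eventually_elim
      case (elim i)
      have "measure_pmf.prob r (- A) = 1 - measure_pmf.prob r A" for r :: "'a pmf"
        using measure_pmf.prob_compl[of A r] by (simp add: Compl_eq_Diff_UNIV)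
      with elim show ?case by simp
    qed
  qed
qed

text \<open>The position \<open>h i\<close> may vary with \<open>i\<close>, because the
  probabilities in \<open>hash_prob_past\<close> do not depend on it. This later yields uniformity
  over all addresses.\<close>

lemma hash_prob_past_tendsto:
  fixes m n :: "nat \<Rightarrow> nat" and h :: "nat \<Rightarrow> int"
  assumes m: "filterlim m at_top sequentially" and lim: "(\<lambda>i. real (n i) / real (m i)) \<longlonglongrightarrow> c" and c: "c > 0"
  shows "(\<lambda>i. hash_prob (m i) (n i) (\<lambda>hs. P (past (cyc (m i) (count_list hs)) (h i) w)))
     \<longlonglongrightarrow> measure_pmf.prob (replicate_pmf w (poisson_pmf c)) {ys. P ys}"
proof -
  define p where "p i = map_pmf (\<lambda>hs. past (cyc (m i) (count_list hs)) (h i) w) (pmf_of_set (hash_sequences (m i) (n i)))" for i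
  have ev: "\<forall>\<^sub>F i in sequentially. m i > w" by (rule eventually_gt_nat[OF m])
  have pmf_p: "pmf (p i) ys = hash_prob (m i) (n i) (\<lambda>hs. past (cyc (m i) (count_list hs)) (h i) w = ys)" for i ys
    by (simp add: p_def pmf_map vimage_def)
  have "(\<lambda>i. pmf (p i) ys) \<longlonglongrightarrow> pmf (replicate_pmf w (poisson_pmf c)) ys" for ys
  proof (cases "length ys = w")
    case False
    then have "{hs. past (cyc (m i) (count_list hs)) (h i) w = ys} = {}" for i by auto
    then show ?thesis using False by (simp add: pmf_p pmf_replicate_pmf)
  next
    case True
    define N where "N = sum_list ys"
    have N: "N = (\<Sum>t<w. ys ! t)"
      using True by (simp add: N_def sum_list_sum_nth atLeast0LessThan)
    have "(\<lambda>i. fall (n i) N / real (m i) ^ N * (1 - real w / real (m i)) ^ (n i - N) / (\<Prod>t<w. fact (ys ! t)))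
       \<longlonglongrightarrow> c ^ N * exp (- (c * real w)) / (\<Prod>t<w. fact (ys ! t))"
      by (intro tendsto_intros fall_tendsto power_tendsto_exp m lim) simp
    moreover have "\<forall>\<^sub>F i in sequentially. fall (n i) N / real (m i) ^ N * (1 - real w / real (m i)) ^ (n i - N) / (\<Prod>t<w. fact (ys ! t))
        = pmf (p i) ys"
      using ev
    proof eventually_elim
      case (elim i)
      show ?case
      proof (cases "n i < N")
        case False
        have "1 - real w / real (m i) = real (m i - w) / real (m i)" using elim by (simp add: field_simps of_nat_diff)
        moreover have "real (m i) ^ n i = real (m i) ^ N * real (m i) ^ (n i - N)"
          using False by (simp add: power_add[symmetric])
        ultimately show ?thesis
          using elim True unfolding pmf_p by (subst hash_prob_past) (auto simp: N_def power_divide)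
      qed (use elim True in \<open>simp add: pmf_p hash_prob_past N_def[symmetric] fall_eq_0\<close>)
    qed
    moreover have "c ^ N * exp (- (c * real w)) / (\<Prod>t<w. fact (ys ! t)) = pmf (replicate_pmf w (poisson_pmf c)) ys"
      using True c by (simp add: pmf_replicate_pmf prod.distrib prod_dividef power_sum N exp_of_nat_mult[symmetric] mult.commute)
    ultimately show ?thesis by (simp add: tendsto_cong)
  qed
  from measure_pmf_tendsto[OF this, of "{ys. P ys}"] show ?thesis
    by (simp add: p_def vimage_def)
qed

context poisson_buckets
begin

text \<open>Truncating the windows at length \<open>T\<close> costs \<open>O(\<theta>\<^sup>T)\<close> in both models, and truncated events only see
  finitely many buckets.\<close>

lemma hash_prob_run_tendsto:
  fixes m n :: "nat \<Rightarrow> nat" and h :: "nat \<Rightarrow> int"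
  assumes m: "filterlim m at_top sequentially" and lim: "(\<lambda>i. real (n i) / real (b * m i)) \<longlonglongrightarrow> \<beta>"
  shows "(\<lambda>i. hash_prob (m i) (n i) (\<lambda>hs. run b k (cyc (m i) (count_list hs)) (h i))) \<longlonglongrightarrow> run_prob k"
proof (rule LIMSEQ_I)
  fix e :: real assume e: "e > 0"
  \<comment> \<open>Before the limit the load may exceed \<beta>; \<beta>' is eventually an upper
    bound for it and still below 1.\<close>
  define \<beta>' where "\<beta>' = (\<beta> + 1) / 2"
  have \<beta>': "\<beta> < \<beta>'" "\<beta>' < 1" "0 < \<beta>'" using \<beta>0 \<beta>1 by (auto simp: \<beta>'_def)
  let ?err = "\<lambda>\<theta> T. real k * (\<theta> ^ Suc T / (1 - \<theta>)) :: real"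
  have small: "\<forall>\<^sub>F T in sequentially. ?err \<theta> T < e / 3" if "0 < \<theta>" "\<theta> < 1" for \<theta>
  proof -
    have "(\<lambda>T. \<theta> ^ Suc T) \<longlonglongrightarrow> 0" using that by (intro LIMSEQ_Suc LIMSEQ_realpow_zero) auto
    then have "(\<lambda>T. ?err \<theta> T) \<longlonglongrightarrow> real k * (0 / (1 - \<theta>))" using that by (intro tendsto_intros) auto
    then show ?thesis using e by (intro order_tendstoD(2)) auto
  qed
  have "\<forall>\<^sub>F T in sequentially. ?err \<theta> T < e / 3 \<and> ?err (load_ratio b \<beta>') T < e / 3"
    using small[OF \<theta>_bounds] small[OF load_ratio_pos[OF \<beta>'(3)] load_ratio_less_1[OF \<beta>'(3,2) b]]
    by (rule eventually_conj)
  \<comment> \<open>Two thirds of \<open>e\<close> pay for truncation in the two models, the last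
    third for the convergence of the truncated event.\<close>
  then obtain T where T: "?err \<theta> T < e / 3" "?err (load_ratio b \<beta>') T < e / 3"
    by (auto simp: eventually_sequentially)
  have "(\<lambda>i. real b * (real (n i) / real (b * m i))) \<longlonglongrightarrow> real b * \<beta>"
    by (intro tendsto_intros lim)
  then have lim': "(\<lambda>i. real (n i) / real (m i)) \<longlonglongrightarrow> \<beta> * real b"
    using b by (simp add: mult.commute)
  have "(\<lambda>i. hash_prob (m i) (n i) (\<lambda>hs. run_upto b T k (cyc (m i) (count_list hs)) (h i)))
     \<longlonglongrightarrow> prob {X. run_upto b T k X 0}"
    unfolding run_upto_iff_list_run prob_past
    by (rule hash_prob_past_tendsto[OF m lim']) (use \<beta>0 b in simp)
  then have "\<forall>\<^sub>F i in sequentially. dist (hash_prob (m i) (n i) (\<lambda>hs. run_upto b T k (cyc (m i) (count_list hs)) (h i)))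
     (prob {X. run_upto b T k X 0}) < e / 3"
    using e by (intro tendstoD) auto
  moreover have "\<forall>\<^sub>F i in sequentially. real (n i) / real (b * m i) < \<beta>'"
    by (rule order_tendstoD(2)[OF lim \<beta>'(1)])
  moreover have "\<forall>\<^sub>F i in sequentially. m i > 0"
    by (rule eventually_gt_nat[OF m])
  ultimately have "\<forall>\<^sub>F i in sequentially. norm (hash_prob (m i) (n i) (\<lambda>hs. run b k (cyc (m i) (count_list hs)) (h i)) - run_prob k) < e"
  proof eventually_elim
    case (elim i)
    then have "exact_model b \<beta>' (m i) (n i)"
      using b \<beta>' by unfold_locales (auto simp: field_simps)
    from exact_model.hash_prob_run_truncation[OF this, of k "h i" T]
    have 1: "\<bar>hash_prob (m i) (n i) (\<lambda>hs. run b k (cyc (m i) (count_list hs)) (h i))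
     - hash_prob (m i) (n i) (\<lambda>hs. run_upto b T k (cyc (m i) (count_list hs)) (h i))\<bar> < e / 3"
      using T(2) by linarith
    have "prob {X. run_upto b T k X 0} \<le> run_prob k"
      unfolding run_prob_def by (rule finite_measure_mono) (auto intro: run_upto_imp_run)
    then have "\<bar>run_prob k - prob {X. run_upto b T k X 0}\<bar> < e / 3"
      using run_prob_truncation[of k T] T(1) by linarith
    then show ?case
      using 1 elim(1)[unfolded dist_real_def] unfolding real_norm_def by linarith
  qed
  then show "\<exists>N. \<forall>i\<ge>N. norm (hash_prob (m i) (n i) (\<lambda>hs. run b k (cyc (m i) (count_list hs)) (h i)) - run_prob k) < e"
    by (simp add: eventually_sequentially)
qed

end

text \<open>As long as there is room, the probability that one more key, with uniform address, is
  displaced by at least \<open>k\<close> after \<open>n\<close> keys have been inserted.\<close>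

definition mean_run :: "nat \<Rightarrow> nat \<Rightarrow> nat \<Rightarrow> nat \<Rightarrow> real" where
  "mean_run b m n k = (\<Sum>h<m. hash_prob m n (\<lambda>hs. run b k (cyc m (count_list hs)) (int h))) / real m"

text \<open>No rotation invariance is needed: the average is off by at most the error at the worst
  address \<open>h i\<close>, and \<open>hash_prob_run_tendsto\<close> permits an address that
  varies with \<open>i\<close>.\<close>

lemma (in poisson_buckets) mean_run_tendsto:
  fixes m n :: "nat \<Rightarrow> nat"
  assumes m: "filterlim m at_top sequentially" and lim: "(\<lambda>i. real (n i) / real (b * m i)) \<longlonglongrightarrow> \<beta>"
  shows "(\<lambda>i. mean_run b (m i) (n i) k) \<longlonglongrightarrow> run_prob k"
proof -
  define f where "f i h = hash_prob (m i) (n i) (\<lambda>hs. run b k (cyc (m i) (count_list hs)) (int h))" for i h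
  define h where "h i = (SOME h. h < m i \<and> (\<forall>h'<m i. \<bar>f i h' - run_prob k\<bar> \<le> \<bar>f i h - run_prob k\<bar>))" for i
  have h: "h i < m i" "h' < m i \<Longrightarrow> \<bar>f i h' - run_prob k\<bar> \<le> \<bar>f i (h i) - run_prob k\<bar>" if "m i > 0" for i h'
  proof -
    define S where "S = (\<lambda>h. \<bar>f i h - run_prob k\<bar>) ` {..<m i}"
    have S: "finite S" "S \<noteq> {}" using that by (auto simp: S_def)
    then obtain h0 where "h0 < m i" "Max S = \<bar>f i h0 - run_prob k\<bar>"
      using Max_in[OF S] unfolding S_def by (elim imageE) simp
    then have "h0 < m i \<and> (\<forall>h'<m i. \<bar>f i h' - run_prob k\<bar> \<le> \<bar>f i h0 - run_prob k\<bar>)"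
      using Max_ge[OF S(1)] by (auto simp: S_def)
    then have "\<exists>h. h < m i \<and> (\<forall>h'<m i. \<bar>f i h' - run_prob k\<bar> \<le> \<bar>f i h - run_prob k\<bar>)" by blast
    from someI_ex[OF this] show "h i < m i" "h' < m i \<Longrightarrow> \<bar>f i h' - run_prob k\<bar> \<le> \<bar>f i (h i) - run_prob k\<bar>"
      unfolding h_def by auto
  qed
  have lim0: "(\<lambda>i. f i (h i) - run_prob k) \<longlonglongrightarrow> 0"
    unfolding f_def using hash_prob_run_tendsto[OF m lim, of k "\<lambda>i. int (h i)"] by (simp add: LIM_zero)
  have "(\<lambda>i. mean_run b (m i) (n i) k - run_prob k) \<longlonglongrightarrow> 0"
  proof (rule Lim_null_comparison[OF _ tendsto_rabs_zero[OF lim0]])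
    have "\<forall>\<^sub>F i in sequentially. m i > 0" by (rule eventually_gt_nat[OF m])
    then show "\<forall>\<^sub>F i in sequentially. norm (mean_run b (m i) (n i) k - run_prob k) \<le> \<bar>f i (h i) - run_prob k\<bar>"
    proof eventually_elim
      case (elim i)
      have "mean_run b (m i) (n i) k - run_prob k = (\<Sum>h<m i. f i h - run_prob k) / real (m i)"
        using elim by (simp add: mean_run_def f_def sum_subtractf diff_divide_distrib)
      also have "norm \<dots> \<le> (\<Sum>h<m i. \<bar>f i h - run_prob k\<bar>) / real (m i)"
        using elim by (simp add: divide_right_mono)
      also have "\<dots> \<le> (\<Sum>h'<m i. \<bar>f i (h i) - run_prob k\<bar>) / real (m i)"
        using h(2)[OF elim] by (intro divide_right_mono sum_mono) auto
      finally show ?case using elim by simp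
    qed
  qed
  then show ?thesis by (rule LIM_zero_cancel)
qed

text \<open>The address of a key is independent of those of its \<open>j\<close> predecessors; later
  keys contribute the factor \<open>m ^ (n - Suc j)\<close>, which cancels.\<close>

lemma hash_prob_split:
  assumes m: "m > 0" and j: "j < n"
  shows "hash_prob m n (\<lambda>hs. P (take j hs) (hs ! j)) = (\<Sum>h<m. hash_prob m j (\<lambda>hs. P hs h)) / real m"
proof -
  let ?f = "\<lambda>(xs, h, ys). xs @ h # ys :: nat list"
  let ?S = "SIGMA xs:hash_sequences m j. {h. h < m \<and> P xs h} \<times> hash_sequences m (n - Suc j)"
  have inj: "inj_on ?f ?S" by (auto simp: inj_on_def hash_sequences_def)
  have "{hs \<in> hash_sequences m n. P (take j hs) (hs ! j)} = ?f ` ?S"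
  proof (intro equalityI subsetI)
    fix hs assume "hs \<in> {hs \<in> hash_sequences m n. P (take j hs) (hs ! j)}"
    then have hs: "length hs = n" "set hs \<subseteq> {..<m}" "P (take j hs) (hs ! j)" by (auto simp: hash_sequences_def)
    then have "hs = ?f (take j hs, hs ! j, drop (Suc j) hs)" using j by (simp add: id_take_nth_drop)
    moreover have "(take j hs, hs ! j, drop (Suc j) hs) \<in> ?S"
      using hs j set_take_subset[of j hs] set_drop_subset[of "Suc j" hs] nth_mem[of j hs]
      by (auto simp: hash_sequences_def simp del: nth_mem)
    ultimately show "hs \<in> ?f ` ?S" by (rule image_eqI)
  qed (use j in \<open>auto simp: hash_sequences_def nth_append\<close>)
  then have "card {hs \<in> hash_sequences m n. P (take j hs) (hs ! j)} = card ?S"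
    using card_image[OF inj] by simp
  also have "\<dots> = (\<Sum>xs\<in>hash_sequences m j. card {h. h < m \<and> P xs h} * m ^ (n - Suc j))"
    by (subst card_SigmaI) (auto simp: card_cartesian_product card_hash_sequences)
  also have "real \<dots> = (\<Sum>xs\<in>hash_sequences m j. \<Sum>h<m. if P xs h then 1 else 0) * real m ^ (n - Suc j)"
    by (simp add: sum_distrib_right sum.If_cases Int_def)
  also have "(\<Sum>xs\<in>hash_sequences m j. \<Sum>h<m. if P xs h then 1 else 0)
      = (\<Sum>h<m. real (card {xs \<in> hash_sequences m j. P xs h}))"
    by (subst sum.swap) (simp add: sum.If_cases Int_def)
  finally have "real (card {hs \<in> hash_sequences m n. P (take j hs) (hs ! j)})
     = (\<Sum>h<m. real (card {xs \<in> hash_sequences m j. P xs h})) * real m ^ (n - Suc j)" .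
  moreover have "real m ^ n = real m ^ j * real m * real m ^ (n - Suc j)"
  proof -
    have e: "Suc (j + (n - Suc j)) = n" using j by simp
    have "real m ^ Suc (j + (n - Suc j)) = real m ^ j * real m * real m ^ (n - Suc j)"
      by (simp add: power_add)
    then show ?thesis unfolding e .
  qed
  ultimately show ?thesis
    using m by (simp add: hash_prob_eq sum_divide_distrib[symmetric])
qed

lemma pmf_D_FC:
  assumes b: "b \<ge> 1" and m: "m > 0" and n: "n \<ge> 1" "n \<le> b * m"
  shows "pmf (D_FC b m n) k = (\<Sum>j<n. mean_run b m j k - mean_run b m j (Suc k)) / real n"
proof -
  let ?D = "\<lambda>hs j. fc_displacements b m (\<lambda>_. 0) hs ! j"
  \<comment> \<open>Choosing the key before the addresses makes the law an average over the position
    \<open>j\<close> in the order of insertion.\<close>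
  have "D_FC b m n = bind_pmf (pmf_of_set {..<n}) (\<lambda>j. map_pmf (\<lambda>hs. ?D hs j) (pmf_of_set (hash_sequences m n)))"
    unfolding D_FC_def map_pmf_def by (rule bind_commute_pmf)
  then have "pmf (D_FC b m n) k = pmf (bind_pmf (pmf_of_set {..<n}) (\<lambda>j. map_pmf (\<lambda>hs. ?D hs j) (pmf_of_set (hash_sequences m n)))) k"
    by simp
  then have "pmf (D_FC b m n) k = (\<Sum>j<n. pmf (map_pmf (\<lambda>hs. ?D hs j) (pmf_of_set (hash_sequences m n))) k) / real n"
    using n by (subst (asm) pmf_bind_pmf_of_set) (auto simp: lessThan_empty_iff)
  also have "(\<Sum>j<n. pmf (map_pmf (\<lambda>hs. ?D hs j) (pmf_of_set (hash_sequences m n))) k)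
     = (\<Sum>j<n. mean_run b m j k - mean_run b m j (Suc k))"
  proof (rule sum.cong[OF refl])
    fix j assume "j \<in> {..<n}"
    then have j: "j < n" by simp
    have hashing: "hashing b m hs" if "hs \<in> hash_sequences m j" for hs
      using that m n j by unfold_locales (auto simp: hash_sequences_def)
    let ?P = "\<lambda>xs h. (LEAST d. loads b m xs ((h + d) mod m) < b) = k"
    have "pmf (map_pmf (\<lambda>hs. ?D hs j) (pmf_of_set (hash_sequences m n))) k = hash_prob m n (\<lambda>hs. ?D hs j = k)"
      by (simp add: pmf_map vimage_def)
    also have "\<dots> = hash_prob m n (\<lambda>hs. ?P (take j hs) (hs ! j))"
      using j by (intro hash_prob_cong[OF m]) (simp add: fc_displacements_nth loads_def hash_sequences_def)
    also have "\<dots> = (\<Sum>h<m. hash_prob m j (\<lambda>xs. ?P xs h)) / real m"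
      by (rule hash_prob_split[OF m j])
    also have "(\<Sum>h<m. hash_prob m j (\<lambda>xs. ?P xs h))
       = (\<Sum>h<m. hash_prob m j (\<lambda>xs. run b k (cyc m (count_list xs)) (int h))
            - hash_prob m j (\<lambda>xs. run b (Suc k) (cyc m (count_list xs)) (int h)))"
    proof (rule sum.cong[OF refl])
      fix h
      let ?R = "\<lambda>k xs. run b k (cyc m (count_list xs)) (int h)"
      have "hash_prob m j (\<lambda>xs. ?P xs h) = hash_prob m j (\<lambda>xs. ?R k xs \<and> \<not> ?R (Suc k) xs)"
        by (intro hash_prob_cong[OF m] hashing.displacement_iff_run hashing)
      also have "{xs. ?R k xs \<and> \<not> ?R (Suc k) xs} = {xs. ?R k xs} - {xs. ?R (Suc k) xs}" by auto
      also have "measure_pmf.prob (pmf_of_set (hash_sequences m j)) \<dots> = hash_prob m j (?R k) - hash_prob m j (?R (Suc k))"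
        by (rule measure_pmf.finite_measure_Diff) (auto simp: run_def)
      finally show "hash_prob m j (\<lambda>xs. ?P xs h) = hash_prob m j (?R k) - hash_prob m j (?R (Suc k))" .
    qed
    finally show "pmf (map_pmf (\<lambda>hs. ?D hs j) (pmf_of_set (hash_sequences m n))) k = mean_run b m j k - mean_run b m j (Suc k)"
      by (simp add: mean_run_def sum_subtractf diff_divide_distrib)
  qed
  finally show ?thesis .
qed

section \<open>Bounds for the exact law\<close>

lemma mean_run_nonneg: "0 \<le> mean_run b m n k"
  by (auto simp: mean_run_def intro!: divide_nonneg_nonneg sum_nonneg)

lemma mean_run_le_1: "mean_run b m n k \<le> 1"
proof (cases "m = 0")
  case False
  have "(\<Sum>h<m. hash_prob m n (\<lambda>hs. run b k (cyc m (count_list hs)) (int h))) \<le> (\<Sum>h<m. 1)"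
    by (intro sum_mono) auto
  then show ?thesis using False by (simp add: mean_run_def divide_le_eq)
qed (simp add: mean_run_def)

lemma mean_run_antimono: "mean_run b m n (Suc k) \<le> mean_run b m n k"
  unfolding mean_run_def
  by (intro divide_right_mono sum_mono measure_pmf.finite_measure_mono) (auto simp: run_def)

lemma (in exact_model) mean_run_le: "mean_run b m n k \<le> load_ratio b \<beta> ^ k / (1 - load_ratio b \<beta>)"
proof -
  have "(\<Sum>h<m. hash_prob m n (\<lambda>hs. run b k (cyc m (count_list hs)) (int h)))
     \<le> (\<Sum>h<m. load_ratio b \<beta> ^ k / (1 - load_ratio b \<beta>))"
    by (intro sum_mono hash_prob_run_le)
  then show ?thesis using m by (simp add: mean_run_def divide_le_eq mult.commute)
qed

lemma pmf_D_FC_le: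
  assumes b: "b \<ge> 1" and \<beta>: "0 < \<beta>" "\<beta> < 1" and m: "m > 0" and n: "n \<ge> 1" "real n \<le> \<beta> * real (b * m)"
  shows "pmf (D_FC b m n) k \<le> load_ratio b \<beta> ^ k / (1 - load_ratio b \<beta>)"
proof -
  have ex: "exact_model b \<beta> m j" if "j \<le> n" for j
    using assms that by unfold_locales auto
  have "pmf (D_FC b m n) k = (\<Sum>j<n. mean_run b m j k - mean_run b m j (Suc k)) / real n"
    using exact_model.n_less[OF ex[OF order_refl]] by (intro pmf_D_FC b m n(1)) simp
  also have "\<dots> \<le> (\<Sum>j<n. load_ratio b \<beta> ^ k / (1 - load_ratio b \<beta>)) / real n"
  proof (intro divide_right_mono sum_mono)
    fix j assume "j \<in> {..<n}"
    then show "mean_run b m j k - mean_run b m j (Suc k) \<le> load_ratio b \<beta> ^ k / (1 - load_ratio b \<beta>)"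
      using exact_model.mean_run_le[OF ex[of j], of k] mean_run_nonneg[of b m j "Suc k"] by simp
  qed simp
  finally show ?thesis using n by simp
qed

section \<open>The limiting displacement\<close>

text \<open>The law of \<open>U\<close> for \<open>0 < \<beta> < 1\<close>, written through
  \<open>survival\<close> so that measurability in \<beta> is at hand.\<close>

definition law_U :: "nat \<Rightarrow> real \<Rightarrow> nat \<Rightarrow> real" where
  "law_U b \<beta> k = survival b \<beta> k / (\<Sum>n. survival b \<beta> n)"

lemma law_U_measurable [measurable]: "(\<lambda>\<beta>. law_U b \<beta> k) \<in> borel_measurable borel"
  unfolding law_U_def by measurable

lemma nat_pmf_expectation:
  fixes f :: "nat \<Rightarrow> 'a::{banach, second_countable_topology}"
  assumes "summable (\<lambda>k. norm (pmf p k *\<^sub>R f k))"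
  shows "integrable (measure_pmf p) f" "measure_pmf.expectation p f = (\<Sum>k. pmf p k *\<^sub>R f k)"
proof -
  have "integrable (count_space UNIV) (\<lambda>k. pmf p k *\<^sub>R f k)"
    using assms by (simp add: integrable_count_space_nat_iff)
  then show "integrable (measure_pmf p) f"
    by (simp add: measure_pmf_eq_density integrable_density)
  have "measure_pmf.expectation p f = (LINT k|count_space UNIV. pmf p k *\<^sub>R f k)"
    by (simp add: measure_pmf_eq_density integral_density)
  also have "\<dots> = (\<Sum>k. pmf p k *\<^sub>R f k)"
    by (rule integral_count_space_nat) fact
  finally show "measure_pmf.expectation p f = (\<Sum>k. pmf p k *\<^sub>R f k)" .
qed

context poisson_buckets
begin

lemma prob_U_law: "prob {X. U b X = k} = law_U b \<beta> k"
  by (simp add: law_U_def prob_U_eq)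

lemma sum_survival_ge_1: "1 \<le> (\<Sum>n. survival b \<beta> n)"
proof -
  have "survival b \<beta> 0 \<le> (\<Sum>n. survival b \<beta> n)"
    using sum_le_suminf[OF sums_summable[OF survival_sums], of "{0}"] survival_nonneg[of \<beta> b] \<beta>0 by simp
  then show ?thesis using \<beta>0 by (simp add: survival_0)
qed

lemma law_U_sums: "law_U b \<beta> sums 1"
  using run_diff_sums by (simp add: prob_U[symmetric] prob_U_law)

lemma law_U_nonneg: "0 \<le> law_U b \<beta> k"
  by (simp add: prob_U_law[symmetric])

lemma law_U_le_1: "law_U b \<beta> k \<le> 1"
  by (simp add: prob_U_law[symmetric])

lemma psi_U_eq:
  assumes "summable (\<lambda>k. norm (of_real (law_U b \<beta> k) * q ^ k))"
  shows "psi_U b q \<beta> = (\<Sum>k. of_real (law_U b \<beta> k) * q ^ k)"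
proof -
  define Q where "Q = embed_pmf (law_U b \<beta>)"
  have "(\<integral>\<^sup>+k. ennreal (law_U b \<beta> k) \<partial>count_space UNIV) = 1"
    using suminf_ennreal_eq[OF law_U_nonneg law_U_sums] by (simp add: nn_integral_count_space_nat)
  then have Q: "pmf Q k = law_U b \<beta> k" for k
    unfolding Q_def by (intro pmf_embed_pmf law_U_nonneg)
  have "distr M (count_space UNIV) (U b) = measure_pmf Q"
  proof (rule measure_eqI_countable[where A = UNIV])
    fix k
    have "emeasure (distr M (count_space UNIV) (U b)) {k} = emeasure M {X. U b X = k}"
      by (subst emeasure_distr) (auto intro!: arg_cong[where f = "emeasure M"])
    then show "emeasure (distr M (count_space UNIV) (U b)) {k} = emeasure Q {k}"
      by (simp add: emeasure_eq_measure prob_U_law emeasure_pmf_single Q)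
  qed auto
  then have "psi_U b q \<beta> = measure_pmf.expectation Q (\<lambda>k. q ^ k)"
    unfolding psi_U_def by (subst integral_distr[OF U_measurable, symmetric]) auto
  also have "\<dots> = (\<Sum>k. pmf Q k *\<^sub>R q ^ k)"
    by (rule nat_pmf_expectation) (use assms in \<open>simp add: Q scaleR_conv_of_real\<close>)
  finally show ?thesis by (simp add: Q scaleR_conv_of_real)
qed

lemma law_U_gf:
  fixes w :: complex
  assumes w: "norm w < exp (\<beta> - 1) / \<beta>"
  shows "summable (\<lambda>k. norm (of_real (law_U b \<beta> k) * (w ^ b) ^ k))"
    and "(1 - w ^ b) * (\<Sum>k. of_real (law_U b \<beta> k) * (w ^ b) ^ k)
      = (\<Prod>l<b. 1 - tree_T (omega b ^ l * of_real (\<beta> * exp (- \<beta>)) * w) / of_real \<beta>) / of_real (\<Sum>n. survival b \<beta> n)"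
proof -
  define V where "V = (\<Sum>n. survival b \<beta> n)"
  note P = survival_gf_product[OF \<beta>0 \<beta>1 b w]
  have sm: "summable (\<lambda>n. norm (of_real (survival b \<beta> n) * (w ^ b) ^ n))"
    by (rule summable_survival[OF \<beta>0 \<beta>1 P(1)])
  have eq: "of_real (law_U b \<beta> k) * (w ^ b) ^ k = of_real (survival b \<beta> k) * (w ^ b) ^ k / of_real V" for k
    by (simp add: law_U_def V_def)
  show "summable (\<lambda>k. norm (of_real (law_U b \<beta> k) * (w ^ b) ^ k))"
    unfolding eq norm_divide by (rule summable_divide[OF sm])
  have "(\<Sum>k. of_real (law_U b \<beta> k) * (w ^ b) ^ k) = (\<Sum>n. of_real (survival b \<beta> n) * (w ^ b) ^ n) / of_real V"
    unfolding eq by (rule suminf_divide[OF summable_norm_cancel[OF sm]])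
  then show "(1 - w ^ b) * (\<Sum>k. of_real (law_U b \<beta> k) * (w ^ b) ^ k)
      = (\<Prod>l<b. 1 - tree_T (omega b ^ l * of_real (\<beta> * exp (- \<beta>)) * w) / of_real \<beta>) / of_real (\<Sum>n. survival b \<beta> n)"
    unfolding P(2)[symmetric] by (simp only: V_def times_divide_eq_right)
qed

lemma psi_U_product:
  assumes r: "\<And>q. r q ^ b = q" "r 1 = 1" and q: "norm (r q) < exp (\<beta> - 1) / \<beta>" "q \<noteq> 1"
  shows "psi_U b q \<beta> = T0 b r (real b * \<beta>) / (1 - q) * (\<Prod>l<b. 1 - zeta b r l q \<beta>)"
    and "psi_U b q \<beta> = of_real (real b * (1 - \<beta>)) * (\<Prod>l<b. 1 - zeta b r l q \<beta>)
          / ((1 - q) * (\<Prod>l=1..<b. 1 - zeta b r l 1 \<beta>))"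
proof -
  define V where "V = (\<Sum>n. survival b \<beta> n)"
  have V: "V \<ge> 1" unfolding V_def by (rule sum_survival_ge_1)
  have sR: "(\<Sum>n. complex_of_real (survival b \<beta> n)) = of_real V"
    unfolding V_def by (rule suminf_of_real[OF sums_summable[OF survival_sums], symmetric])
  have zeta1: "(\<Prod>l=1..<b. 1 - zeta b r l 1 \<beta>) = of_real (real b * (1 - \<beta>)) * of_real V"
    using survival_sum_eq[OF \<beta>0 \<beta>1 b] unfolding sR by (simp add: zeta_def r(2))
  have nz: "of_real (real b * (1 - \<beta>)) \<noteq> (0::complex)" using b \<beta>1 by (simp only: of_real_eq_0_iff) simp
  \<comment> \<open>So \<open>T0\<close> is the reciprocal of the mean of \<tau>.\<close>
  have T0: "T0 b r (real b * \<beta>) = 1 / of_real V"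
    unfolding T0_def Let_def using b nz zeta1 by (simp del: of_real_mult of_real_diff)
  have "psi_U b q \<beta> = (\<Sum>k. of_real (law_U b \<beta> k) * q ^ k)"
    using psi_U_eq[of q] law_U_gf(1)[OF q(1)] by (simp add: r(1))
  moreover have "(1 - q) * (\<Sum>k. of_real (law_U b \<beta> k) * q ^ k) = (\<Prod>l<b. 1 - zeta b r l q \<beta>) / of_real V"
    using law_U_gf(2)[OF q(1)] by (simp add: r(1) zeta_def V_def)
  ultimately have "psi_U b q \<beta> * (1 - q) = (\<Prod>l<b. 1 - zeta b r l q \<beta>) / of_real V"
    by (simp add: mult.commute)
  then have *: "psi_U b q \<beta> = (\<Prod>l<b. 1 - zeta b r l q \<beta>) / of_real V / (1 - q)"
    using q(2) by (subst nonzero_eq_divide_eq) auto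
  show "psi_U b q \<beta> = T0 b r (real b * \<beta>) / (1 - q) * (\<Prod>l<b. 1 - zeta b r l q \<beta>)"
    unfolding T0 * by simp
  show "psi_U b q \<beta> = of_real (real b * (1 - \<beta>)) * (\<Prod>l<b. 1 - zeta b r l q \<beta>)
          / ((1 - q) * (\<Prod>l=1..<b. 1 - zeta b r l 1 \<beta>))"
    unfolding zeta1 * using nz by (simp del: of_real_mult of_real_diff)
qed

end

definition radius :: "nat \<Rightarrow> real \<Rightarrow> real" where
  "radius b \<alpha> = (exp (\<alpha> - 1) / \<alpha>) ^ b"

section \<open>The mixture over \<beta> and bounds uniform in \<beta>\<close>

locale limit_law =
  fixes b :: nat and \<alpha> :: real
  assumes b: "b \<ge> 1" and \<alpha>0: "0 < \<alpha>" and \<alpha>1: "\<alpha> < 1"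
begin

lemma buckets: "\<beta> \<in> {0<..<\<alpha>} \<Longrightarrow> poisson_buckets b \<beta>"
  using b \<alpha>1 by unfold_locales auto

abbreviation "R \<equiv> radius b \<alpha>"

lemma base_gt_1: "exp (\<alpha> - 1) / \<alpha> > 1"
  using mult_exp_one_minus_less_1[OF \<alpha>0 \<alpha>1] \<alpha>0 by (simp add: exp_diff field_simps)

lemma R_gt_1: "R > 1"
  unfolding radius_def using base_gt_1 b by (intro one_less_power) auto

text \<open>Strictness is what admits the closed disc \<open>norm q \<le> R\<close>: for every
  \<open>\<beta> < \<alpha>\<close> it lies inside the open disc of the product formula.\<close>

lemma base_less:
  assumes "\<beta> \<in> {0<..<\<alpha>}"
  shows "exp (\<alpha> - 1) / \<alpha> < exp (\<beta> - 1) / \<beta>"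
proof -
  have "\<beta> * exp (- \<beta>) < \<alpha> * exp (- \<alpha>)" using assms \<alpha>1 by (intro mult_exp_neg_strict_mono) auto
  then have "exp \<alpha> * \<beta> < exp \<beta> * \<alpha>" by (simp add: exp_minus field_simps)
  then show ?thesis using assms \<alpha>0 by (simp add: exp_diff field_simps)
qed

lemma norm_root_less:
  assumes "\<beta> \<in> {0<..<\<alpha>}" "norm (w ^ b) \<le> R"
  shows "norm (w :: complex) < exp (\<beta> - 1) / \<beta>"
proof -
  have "norm w ^ b \<le> (exp (\<alpha> - 1) / \<alpha>) ^ b" using assms by (simp add: norm_power radius_def)
  then have "norm w \<le> exp (\<alpha> - 1) / \<alpha>"
    using b base_gt_1 by (subst (asm) power_mono_iff) auto
  then show ?thesis using base_less[OF assms(1)] by simp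
qed

text \<open>The numerator bounds \<open>b\<close> factors \<open>1 - \<zeta>\<close> by the linear
  estimate of the tree function; the denominator comes from \<open>1 - q\<close> at
  \<open>q = R\<close>.\<close>

definition moment_bound :: real where
  "moment_bound = (1 + exp 1 * (exp (\<alpha> - 1) / \<alpha>)) ^ b / (R - 1)"

text \<open>The geometric bound on \<open>survival\<close> would only give
  \<open>1 / (1 - load_ratio b \<beta> * R)\<close>, which behaves like
  \<open>1 / (\<alpha> - \<beta>)\<close> near \<alpha> and is not integrable. The product formula
  at \<open>q = R\<close>, where the series has nonnegative terms, is bounded uniformly in
  \<beta>.\<close>

lemma sum_law_U_le:
  assumes \<beta>: "\<beta> \<in> {0<..<\<alpha>}"
  shows "(\<Sum>k<K. law_U b \<beta> k * R ^ k) \<le> moment_bound"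
proof -
  interpret poisson_buckets b \<beta> by (rule buckets[OF \<beta>])
  define w where "w = complex_of_real (exp (\<alpha> - 1) / \<alpha>)"
  have nw: "norm w = exp (\<alpha> - 1) / \<alpha>" unfolding w_def norm_of_real using \<alpha>0 by simp
  have w: "norm w < exp (\<beta> - 1) / \<beta>" unfolding nw by (rule base_less[OF \<beta>])
  have wR: "w ^ b = of_real R" by (simp add: w_def radius_def)
  have termeq: "of_real (law_U b \<beta> k) * (w ^ b) ^ k = complex_of_real (law_U b \<beta> k * R ^ k)" for k
    by (simp add: wR)
  have nonneg: "0 \<le> law_U b \<beta> k * R ^ k" for k using law_U_nonneg R_gt_1 by simp
  have sm: "summable (\<lambda>k. law_U b \<beta> k * R ^ k)"
    using law_U_gf(1)[OF w] nonneg unfolding termeq norm_of_real by simp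
  define S where "S = (\<Sum>k. law_U b \<beta> k * R ^ k)"
  define Z where "Z = (\<Prod>l<b. 1 - tree_T (omega b ^ l * of_real (\<beta> * exp (- \<beta>)) * w) / of_real \<beta>)"
  have "(1 - of_real R) * complex_of_real S = Z / of_real (\<Sum>n. survival b \<beta> n)"
    using law_U_gf(2)[OF w] unfolding termeq Z_def S_def suminf_of_real[OF sm] by (simp only: wR)
  then have "norm ((1 - of_real R) * complex_of_real S) = norm Z / (\<Sum>n. survival b \<beta> n)"
    using sum_survival_ge_1 by (simp add: norm_divide)
  also have "norm ((1 - of_real R) * complex_of_real S) = (R - 1) * S"
  proof -
    have "0 \<le> S" unfolding S_def by (intro suminf_nonneg sm nonneg)
    then have "norm (complex_of_real ((1 - R) * S)) = (R - 1) * S"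
      unfolding norm_of_real using R_gt_1 by (simp add: abs_mult)
    then show ?thesis by simp
  qed
  also have "norm Z / (\<Sum>n. survival b \<beta> n) \<le> norm Z"
    using sum_survival_ge_1 by (simp add: divide_le_eq mult_left_le mult_le_cancel_left1)
  also have "norm Z \<le> (\<Prod>l<b. 1 + exp 1 * (exp (\<alpha> - 1) / \<alpha>))"
    unfolding Z_def prod_norm[symmetric]
  proof (rule prod_mono, safe)
    fix l
    let ?W = "omega b ^ l * complex_of_real (\<beta> * exp (- \<beta>)) * w"
    have nW: "norm ?W = \<beta> * exp (- \<beta>) * (exp (\<alpha> - 1) / \<alpha>)"
      unfolding norm_mult norm_omega_power norm_of_real nw using \<beta>0 by simp
    also have "\<dots> < \<beta> * exp (- \<beta>) * (exp (\<beta> - 1) / \<beta>)"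
      using \<beta>0 base_less[OF \<beta>] by (intro mult_strict_left_mono) auto
    also have "\<dots> = exp (-1)" using \<beta>0 by (simp add: exp_add[symmetric])
    finally have "norm (tree_T ?W) \<le> exp 1 * norm ?W" by (rule norm_tree_T_less_1(2))
    also have "\<dots> \<le> exp 1 * (\<beta> * 1 * (exp (\<alpha> - 1) / \<alpha>))"
      unfolding nW using \<beta>0 \<alpha>0 by (intro mult_left_mono mult_right_mono) auto
    finally have "norm (tree_T ?W / of_real \<beta>) \<le> exp 1 * (exp (\<alpha> - 1) / \<alpha>)"
      using \<beta>0 by (simp add: norm_divide field_simps)
    then show "norm (1 - tree_T ?W / of_real \<beta>) \<le> 1 + exp 1 * (exp (\<alpha> - 1) / \<alpha>)"
      using norm_triangle_ineq4[of 1 "tree_T ?W / of_real \<beta>"] by simp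
  qed auto
  finally have "S \<le> moment_bound"
    using R_gt_1 by (simp add: moment_bound_def field_simps)
  moreover have "(\<Sum>k<K. law_U b \<beta> k * R ^ k) \<le> S"
    unfolding S_def using nonneg by (intro sum_le_suminf sm) auto
  ultimately show ?thesis by simp
qed

definition lim_pmf :: "nat \<Rightarrow> real" where
  "lim_pmf k = (1 / \<alpha>) * (LINT \<beta>:{0<..<\<alpha>}|lborel. law_U b \<beta> k)"

lemma interval_integral_eq:
  fixes f :: "real \<Rightarrow> 'a::{banach, second_countable_topology}"
  shows "(LBINT \<beta>=0..\<alpha>. f \<beta>) = (LINT \<beta>:{0<..<\<alpha>}|lborel. f \<beta>)"
    and "interval_lebesgue_integrable lborel 0 \<alpha> f \<longleftrightarrow> set_integrable lborel {0<..<\<alpha>} f"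
proof -
  have "einterval 0 (ereal \<alpha>) = {0<..<\<alpha>}" using einterval_eq(1)[of 0 \<alpha>] by (simp add: zero_ereal_def)
  then show "(LBINT \<beta>=0..\<alpha>. f \<beta>) = (LINT \<beta>:{0<..<\<alpha>}|lborel. f \<beta>)"
    and "interval_lebesgue_integrable lborel 0 \<alpha> f \<longleftrightarrow> set_integrable lborel {0<..<\<alpha>} f"
    using \<alpha>0 by (simp_all add: interval_lebesgue_integral_def interval_lebesgue_integrable_def)
qed

lemma law_U_integrable: "set_integrable lborel {0<..<\<alpha>} (\<lambda>\<beta>. law_U b \<beta> k)"
  unfolding set_integrable_def
proof (rule Bochner_Integration.integrable_bound[of _ "indicator {0<..<\<alpha>} :: real \<Rightarrow> real"])
  show "integrable lborel (indicator {0<..<\<alpha>} :: real \<Rightarrow> real)"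
    using \<alpha>0 by (intro integrable_real_indicator) auto
  show "AE \<beta> in lborel. norm (indicator {0<..<\<alpha>} \<beta> *\<^sub>R law_U b \<beta> k) \<le> norm (indicator {0<..<\<alpha>} \<beta> :: real)"
    using poisson_buckets.law_U_nonneg[OF buckets] poisson_buckets.law_U_le_1[OF buckets]
    by (auto simp: indicator_def)
qed measurable

lemma lim_pmf_nonneg: "0 \<le> lim_pmf k"
  unfolding lim_pmf_def set_lebesgue_integral_def
  using \<alpha>0 poisson_buckets.law_U_nonneg[OF buckets]
  by (intro mult_nonneg_nonneg integral_nonneg) (auto simp: indicator_def)

text \<open>Interchange of the sum over \<open>k\<close> with the integral over \<beta>; a bound
  uniform in \<beta> suffices on a bounded interval. The weights will be 1, powers of
  \<open>q\<close>, and powers of \<open>k\<close>.\<close>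

lemma weighted_lim_pmf:
  fixes c :: "nat \<Rightarrow> 'a::{banach, second_countable_topology}"
  assumes B: "\<And>\<beta> K. \<beta> \<in> {0<..<\<alpha>} \<Longrightarrow> (\<Sum>k<K. law_U b \<beta> k * norm (c k)) \<le> B"
  shows "\<beta> \<in> {0<..<\<alpha>} \<Longrightarrow> summable (\<lambda>k. norm (law_U b \<beta> k *\<^sub>R c k))"
    and "summable (\<lambda>k. norm (lim_pmf k *\<^sub>R c k))"
    and "set_integrable lborel {0<..<\<alpha>} (\<lambda>\<beta>. \<Sum>k. law_U b \<beta> k *\<^sub>R c k)"
    and "(\<Sum>k. lim_pmf k *\<^sub>R c k) = (1 / \<alpha>) *\<^sub>R (LINT \<beta>:{0<..<\<alpha>}|lborel. \<Sum>k. law_U b \<beta> k *\<^sub>R c k)"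
proof -
  let ?I = "{0<..<\<alpha>}"
  define f where "f k \<beta> = indicator ?I \<beta> *\<^sub>R (law_U b \<beta> k *\<^sub>R c k)" for k \<beta>
  have nf: "norm (f k \<beta>) = indicator ?I \<beta> *\<^sub>R (law_U b \<beta> k) * norm (c k)" for k \<beta>
    using poisson_buckets.law_U_nonneg[OF buckets] by (auto simp: f_def indicator_def)
  show sm: "summable (\<lambda>k. norm (law_U b \<beta> k *\<^sub>R c k))" if "\<beta> \<in> ?I" for \<beta>
  proof (rule bounded_imp_summable)
    fix n
    show "(\<Sum>k\<le>n. norm (law_U b \<beta> k *\<^sub>R c k)) \<le> B"
      using B[OF that, of "Suc n"] poisson_buckets.law_U_nonneg[OF buckets[OF that]]
      by (simp add: lessThan_Suc_atMost del: sum.lessThan_Suc)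
  qed simp
  have int0: "integrable lborel (\<lambda>\<beta>. indicator ?I \<beta> *\<^sub>R law_U b \<beta> k)" for k
    using law_U_integrable by (simp add: set_integrable_def)
  have f_eq: "f k = (\<lambda>\<beta>. (indicator ?I \<beta> *\<^sub>R law_U b \<beta> k) *\<^sub>R c k)" for k
    by (simp add: f_def fun_eq_iff)
  have fint: "integrable lborel (f k)" for k
    unfolding f_eq by (intro integrable_scaleR_left int0)
  have Inf: "(LINT \<beta>|lborel. norm (f k \<beta>)) = \<alpha> * lim_pmf k * norm (c k)" for k
    using \<alpha>0 unfolding nf by (simp add: lim_pmf_def set_lebesgue_integral_def)
  have smI: "summable (\<lambda>k. LINT \<beta>|lborel. norm (f k \<beta>))"
  proof (rule bounded_imp_summable)
    fix n
    have "(\<Sum>k\<le>n. LINT \<beta>|lborel. norm (f k \<beta>)) = (LINT \<beta>|lborel. (\<Sum>k\<le>n. norm (f k \<beta>)))"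
      by (rule Bochner_Integration.integral_sum[symmetric]) (intro integrable_norm fint)
    also have "\<dots> \<le> (LINT \<beta>|lborel. indicator ?I \<beta> *\<^sub>R B)"
    proof (rule integral_mono)
      show "integrable lborel (\<lambda>\<beta>. indicator ?I \<beta> *\<^sub>R B)"
        using \<alpha>0 by (intro integrable_scaleR_left integrable_real_indicator) auto
      show "(\<Sum>k\<le>n. norm (f k \<beta>)) \<le> indicator ?I \<beta> *\<^sub>R B" for \<beta>
        unfolding nf using B[of \<beta> "Suc n"] by (auto simp: indicator_def lessThan_Suc_atMost)
    qed (intro Bochner_Integration.integrable_sum integrable_norm fint)
    finally show "(\<Sum>k\<le>n. LINT \<beta>|lborel. norm (f k \<beta>)) \<le> (LINT \<beta>|lborel. indicator ?I \<beta> *\<^sub>R B)" .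
  qed simp
  have AE: "AE \<beta> in lborel. summable (\<lambda>k. norm (f k \<beta>))"
    using sm by (intro AE_I2) (auto simp: f_def indicator_def)
  have eq: "(\<Sum>k. f k \<beta>) = indicator ?I \<beta> *\<^sub>R (\<Sum>k. law_U b \<beta> k *\<^sub>R c k)" for \<beta>
    by (auto simp: f_def indicator_def)
  have "summable (\<lambda>k. (1 / \<alpha>) * (LINT \<beta>|lborel. norm (f k \<beta>)))"
    by (rule summable_mult[OF smI])
  then show "summable (\<lambda>k. norm (lim_pmf k *\<^sub>R c k))"
    using \<alpha>0 lim_pmf_nonneg by (simp add: Inf)
  show "set_integrable lborel {0<..<\<alpha>} (\<lambda>\<beta>. \<Sum>k. law_U b \<beta> k *\<^sub>R c k)"
    using integrable_suminf[OF fint AE smI] by (simp add: set_integrable_def eq)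
  have "(LINT \<beta>|lborel. (\<Sum>k. f k \<beta>)) = (\<Sum>k. LINT \<beta>|lborel. f k \<beta>)"
    by (rule integral_suminf[OF fint AE smI])
  also have "(\<lambda>k. LINT \<beta>|lborel. f k \<beta>) = (\<lambda>k. \<alpha> *\<^sub>R (lim_pmf k *\<^sub>R c k))"
  proof
    fix k
    have "(LINT \<beta>|lborel. f k \<beta>) = (LINT \<beta>|lborel. indicator ?I \<beta> *\<^sub>R law_U b \<beta> k) *\<^sub>R c k"
      unfolding f_eq by (rule integral_scaleR_left) (rule int0)
    then show "(LINT \<beta>|lborel. f k \<beta>) = \<alpha> *\<^sub>R (lim_pmf k *\<^sub>R c k)"
      using \<alpha>0 by (simp add: lim_pmf_def set_lebesgue_integral_def)
  qed
  also have "(\<Sum>k. \<alpha> *\<^sub>R (lim_pmf k *\<^sub>R c k)) = \<alpha> *\<^sub>R (\<Sum>k. lim_pmf k *\<^sub>R c k)"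
    by (rule suminf_scaleR_right[symmetric]) (rule summable_norm_cancel, fact)
  finally show "(\<Sum>k. lim_pmf k *\<^sub>R c k) = (1 / \<alpha>) *\<^sub>R (LINT \<beta>:{0<..<\<alpha>}|lborel. \<Sum>k. law_U b \<beta> k *\<^sub>R c k)"
    using \<alpha>0 by (simp add: set_lebesgue_integral_def eq)
qed

lemma lim_pmf_sums: "lim_pmf sums 1"
proof -
  have B: "(\<Sum>k<K. law_U b \<beta> k * norm (1::real)) \<le> 1" if "\<beta> \<in> {0<..<\<alpha>}" for \<beta> K
  proof -
    interpret poisson_buckets b \<beta> by (rule buckets[OF that])
    show ?thesis using sum_le_suminf[OF sums_summable[OF law_U_sums], of "{..<K}"] law_U_nonneg law_U_sums
      by (simp add: sums_iff)
  qed
  have "(\<Sum>k. lim_pmf k *\<^sub>R 1) = (1 / \<alpha>) *\<^sub>R (LINT \<beta>:{0<..<\<alpha>}|lborel. \<Sum>k. law_U b \<beta> k *\<^sub>R (1::real))"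
    by (rule weighted_lim_pmf(4)[OF B])
  also have "(LINT \<beta>:{0<..<\<alpha>}|lborel. \<Sum>k. law_U b \<beta> k *\<^sub>R (1::real)) = (LINT \<beta>:{0<..<\<alpha>}|lborel. 1)"
    using poisson_buckets.law_U_sums[OF buckets]
    by (intro set_lebesgue_integral_cong) (auto simp: sums_iff)
  also have "\<dots> = \<alpha>" using \<alpha>0 by (simp add: set_lebesgue_integral_def)
  finally have "(\<Sum>k. lim_pmf k) = 1" using \<alpha>0 by simp
  then show ?thesis using weighted_lim_pmf(2)[OF B] lim_pmf_nonneg by (simp add: sums_iff)
qed

lemma lim_pmf_eq: "lim_pmf k = (1 / \<alpha>) * (LBINT \<beta>=0..\<alpha>. \<P>(X in poisson_model b \<beta>. U b X = k))"
proof -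
  have "(LINT \<beta>:{0<..<\<alpha>}|lborel. law_U b \<beta> k) = (LINT \<beta>:{0<..<\<alpha>}|lborel. \<P>(X in poisson_model b \<beta>. U b X = k))"
  proof (rule set_lebesgue_integral_cong)
    show "\<forall>\<beta>. \<beta> \<in> {0<..<\<alpha>} \<longrightarrow> law_U b \<beta> k = \<P>(X in poisson_model b \<beta>. U b X = k)"
    proof (intro allI impI)
      fix \<beta> assume "\<beta> \<in> {0<..<\<alpha>}"
      then interpret poisson_buckets b \<beta> by (rule buckets)
      show "law_U b \<beta> k = \<P>(X in poisson_model b \<beta>. U b X = k)" using prob_U_law by simp
    qed
  qed simp
  then show ?thesis by (simp add: lim_pmf_def interval_integral_eq)
qed

lemma pmf_D_FC_lim: "pmf (D_FC_lim b \<alpha>) k = lim_pmf k"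
proof -
  have "D_FC_lim b \<alpha> = embed_pmf lim_pmf"
    unfolding D_FC_lim_def lim_pmf_eq[symmetric] ..
  moreover have "(\<integral>\<^sup>+k. ennreal (lim_pmf k) \<partial>count_space UNIV) = 1"
    using suminf_ennreal_eq[OF lim_pmf_nonneg lim_pmf_sums] by (simp add: nn_integral_count_space_nat)
  ultimately show ?thesis by (simp add: pmf_embed_pmf lim_pmf_nonneg)
qed

lemma weights_le:
  fixes c :: "nat \<Rightarrow> 'a::{banach, second_countable_topology}"
  assumes "\<And>k. norm (c k) \<le> A * R ^ k" "\<beta> \<in> {0<..<\<alpha>}"
  shows "(\<Sum>k<K. law_U b \<beta> k * norm (c k)) \<le> A * moment_bound"
proof -
  have "0 \<le> A" using assms(1)[of 0] order_trans[OF norm_ge_zero] by fastforce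
  have "(\<Sum>k<K. law_U b \<beta> k * norm (c k)) \<le> (\<Sum>k<K. A * (law_U b \<beta> k * R ^ k))"
    using assms(1) poisson_buckets.law_U_nonneg[OF buckets[OF assms(2)]]
    by (intro sum_mono) (metis mult.left_commute mult_left_mono)
  also have "\<dots> \<le> A * moment_bound"
    unfolding sum_distrib_left[symmetric] by (intro mult_left_mono sum_law_U_le assms(2)) fact
  finally show ?thesis .
qed

lemma pgf_lim:
  assumes q: "norm q \<le> R"
  shows "integrable (measure_pmf (D_FC_lim b \<alpha>)) (\<lambda>k. q ^ k)"
    and "interval_lebesgue_integrable lborel 0 \<alpha> (\<lambda>\<beta>. psi_U b q \<beta>)"
    and "psi_FC b q \<alpha> = (1 / of_real \<alpha>) * (LBINT \<beta>=0..\<alpha>. psi_U b q \<beta>)"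
    and "summable (\<lambda>k. of_real (lim_pmf k) * q ^ k)"
    and "psi_FC b q \<alpha> = (\<Sum>k. of_real (lim_pmf k) * q ^ k)"
proof -
  have B: "(\<Sum>k<K. law_U b \<beta> k * norm (q ^ k)) \<le> 1 * moment_bound" if "\<beta> \<in> {0<..<\<alpha>}" for \<beta> K
    using that q by (intro weights_le) (auto simp: norm_power intro!: power_mono)
  have psi: "(\<Sum>k. law_U b \<beta> k *\<^sub>R q ^ k) = psi_U b q \<beta>" if "\<beta> \<in> {0<..<\<alpha>}" for \<beta>
    using poisson_buckets.psi_U_eq[OF buckets[OF that], of q] weighted_lim_pmf(1)[OF B that]
    by (simp add: scaleR_conv_of_real)
  have sm: "summable (\<lambda>k. norm (pmf (D_FC_lim b \<alpha>) k *\<^sub>R q ^ k))"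
    using weighted_lim_pmf(2)[OF B] by (simp add: pmf_D_FC_lim)
  show "integrable (measure_pmf (D_FC_lim b \<alpha>)) (\<lambda>k. q ^ k)"
    by (rule nat_pmf_expectation(1)[OF sm])
  have e: "psi_FC b q \<alpha> = (\<Sum>k. lim_pmf k *\<^sub>R q ^ k)"
    unfolding psi_FC_def pgf_def using nat_pmf_expectation(2)[OF sm] by (simp add: pmf_D_FC_lim)
  show "summable (\<lambda>k. of_real (lim_pmf k) * q ^ k)" "psi_FC b q \<alpha> = (\<Sum>k. of_real (lim_pmf k) * q ^ k)"
    using summable_norm_cancel[OF sm] e by (simp_all add: pmf_D_FC_lim scaleR_conv_of_real)
  have "set_integrable lborel {0<..<\<alpha>} (\<lambda>\<beta>. \<Sum>k. law_U b \<beta> k *\<^sub>R q ^ k)"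
    by (rule weighted_lim_pmf(3)[OF B])
  also have "?this \<longleftrightarrow> set_integrable lborel {0<..<\<alpha>} (\<lambda>\<beta>. psi_U b q \<beta>)"
    by (rule set_integrable_cong) (auto simp: psi)
  finally show "interval_lebesgue_integrable lborel 0 \<alpha> (\<lambda>\<beta>. psi_U b q \<beta>)"
    by (simp add: interval_integral_eq)
  have "psi_FC b q \<alpha> = (1 / \<alpha>) *\<^sub>R (LINT \<beta>:{0<..<\<alpha>}|lborel. \<Sum>k. law_U b \<beta> k *\<^sub>R q ^ k)"
    unfolding e by (rule weighted_lim_pmf(4)[OF B])
  also have "(LINT \<beta>:{0<..<\<alpha>}|lborel. \<Sum>k. law_U b \<beta> k *\<^sub>R q ^ k) = (LINT \<beta>:{0<..<\<alpha>}|lborel. psi_U b q \<beta>)"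
    by (rule set_lebesgue_integral_cong) (auto simp: psi)
  finally show "psi_FC b q \<alpha> = (1 / of_real \<alpha>) * (LBINT \<beta>=0..\<alpha>. psi_U b q \<beta>)"
    by (simp add: interval_integral_eq scaleR_conv_of_real)
qed

lemma pgf_lim_product:
  assumes r: "\<And>q. r q ^ b = q" "r 1 = 1" and q: "norm q \<le> R" "q \<noteq> 1"
  shows "interval_lebesgue_integrable lborel 0 \<alpha>
          (\<lambda>\<beta>. T0 b r (real b * \<beta>) / (1 - q) * (\<Prod>l<b. 1 - zeta b r l q \<beta>))"
    and "psi_FC b q \<alpha> = (1 / of_real \<alpha>) * (LBINT \<beta>=0..\<alpha>.
          T0 b r (real b * \<beta>) / (1 - q) * (\<Prod>l<b. 1 - zeta b r l q \<beta>))"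
    and "psi_FC b q \<alpha> = (1 / of_real \<alpha>) * (LBINT \<beta>=0..\<alpha>.
          of_real (real b * (1 - \<beta>)) * (\<Prod>l<b. 1 - zeta b r l q \<beta>)
          / ((1 - q) * (\<Prod>l=1..<b. 1 - zeta b r l 1 \<beta>)))"
proof -
  have "norm (r q) < exp (\<beta> - 1) / \<beta>" if "\<beta> \<in> {0<..<\<alpha>}" for \<beta>
    by (rule norm_root_less[OF that]) (simp add: r(1) q(1))
  note P = poisson_buckets.psi_U_product[OF buckets r this q(2)]
  have "set_integrable lborel {0<..<\<alpha>} (\<lambda>\<beta>. psi_U b q \<beta>)"
    using pgf_lim(2)[OF q(1)] by (simp add: interval_integral_eq)
  also have "?this \<longleftrightarrow> set_integrable lborel {0<..<\<alpha>}
      (\<lambda>\<beta>. T0 b r (real b * \<beta>) / (1 - q) * (\<Prod>l<b. 1 - zeta b r l q \<beta>))"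
    by (rule set_integrable_cong) (auto simp: P(1))
  finally show "interval_lebesgue_integrable lborel 0 \<alpha>
          (\<lambda>\<beta>. T0 b r (real b * \<beta>) / (1 - q) * (\<Prod>l<b. 1 - zeta b r l q \<beta>))"
    by (simp add: interval_integral_eq)
  have "(LINT \<beta>:{0<..<\<alpha>}|lborel. psi_U b q \<beta>)
      = (LINT \<beta>:{0<..<\<alpha>}|lborel. T0 b r (real b * \<beta>) / (1 - q) * (\<Prod>l<b. 1 - zeta b r l q \<beta>))"
    by (rule set_lebesgue_integral_cong) (auto simp: P(1))
  then show "psi_FC b q \<alpha> = (1 / of_real \<alpha>) * (LBINT \<beta>=0..\<alpha>.
          T0 b r (real b * \<beta>) / (1 - q) * (\<Prod>l<b. 1 - zeta b r l q \<beta>))"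
    by (simp add: pgf_lim(3)[OF q(1)] interval_integral_eq)
  have "(LINT \<beta>:{0<..<\<alpha>}|lborel. psi_U b q \<beta>)
      = (LINT \<beta>:{0<..<\<alpha>}|lborel. of_real (real b * (1 - \<beta>)) * (\<Prod>l<b. 1 - zeta b r l q \<beta>)
          / ((1 - q) * (\<Prod>l=1..<b. 1 - zeta b r l 1 \<beta>)))"
    by (rule set_lebesgue_integral_cong) (simp, use P(2) in blast)
  then show "psi_FC b q \<alpha> = (1 / of_real \<alpha>) * (LBINT \<beta>=0..\<alpha>.
          of_real (real b * (1 - \<beta>)) * (\<Prod>l<b. 1 - zeta b r l q \<beta>)
          / ((1 - q) * (\<Prod>l=1..<b. 1 - zeta b r l 1 \<beta>)))"
    by (simp only: pgf_lim(3)[OF q(1)] interval_integral_eq)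
qed

text \<open>The product expression is \<open>0 / 0\<close> at \<open>q = 1\<close>, but the power
  series converges at \<open>R > 1\<close> and is therefore continuous at 1.\<close>

lemma psi_FC_tendsto_1: "((\<lambda>q. psi_FC b q \<alpha>) \<longlongrightarrow> psi_FC b 1 \<alpha>) (at 1)"
proof -
  have "isCont (\<lambda>q. \<Sum>k. complex_of_real (lim_pmf k) * q ^ k) 1"
  proof (rule isCont_powser)
    show "summable (\<lambda>k. complex_of_real (lim_pmf k) * complex_of_real R ^ k)"
      by (rule pgf_lim(4)) (use R_gt_1 in simp)
    show "norm (1::complex) < norm (complex_of_real R)" using R_gt_1 by simp
  qed
  then have "((\<lambda>q. \<Sum>k. complex_of_real (lim_pmf k) * q ^ k) \<longlongrightarrow> psi_FC b 1 \<alpha>) (at 1)"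
    using pgf_lim(5)[of 1] R_gt_1 by (simp add: isCont_def)
  moreover have "\<forall>\<^sub>F q in at (1::complex). norm q \<le> R"
  proof -
    have "\<forall>\<^sub>F q in at (1::complex). q \<in> ball 0 R" using R_gt_1 by (intro eventually_at_in_open') (auto simp: dist_norm)
    then show ?thesis by eventually_elim simp
  qed
  then have "\<forall>\<^sub>F q in at 1. (\<Sum>k. complex_of_real (lim_pmf k) * q ^ k) = psi_FC b q \<alpha>"
    by eventually_elim (simp add: pgf_lim(5))
  ultimately show ?thesis by (simp add: tendsto_cong)
qed

end

section \<open>Convergence of the exact model\<close>

lemma summable_power_times_power:
  fixes \<theta> :: real
  assumes "0 < \<theta>" "\<theta> < 1"
  shows "summable (\<lambda>k. real k ^ p * \<theta> ^ k)"
  using assms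
proof (induction p arbitrary: \<theta>)
  case 0
  then show ?case by (simp add: summable_geometric)
next
  case (Suc p)
  \<comment> \<open>Half of the exponential decay absorbs one factor \<open>k\<close>; the other
    half is left for the induction hypothesis.\<close>
  define s where "s = sqrt \<theta>"
  have s: "0 < s" "s < 1" "s * s = \<theta>" using Suc.prems by (auto simp: s_def)
  have "(\<lambda>k. real k * s ^ k) \<longlonglongrightarrow> 0"
    using powser_times_n_limit_0[of s] s by simp
  then have "Bseq (\<lambda>k. real k * s ^ k)" by (intro convergent_imp_Bseq convergentI)
  then obtain B where B: "\<And>k. norm (real k * s ^ k) \<le> B" by (auto simp: Bseq_def)
  show ?case
  proof (rule summable_comparison_test[OF exI[of _ 0]])
    show "summable (\<lambda>k. B * (real k ^ p * s ^ k))" by (intro summable_mult Suc.IH s)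
    show "\<forall>k\<ge>0. norm (real k ^ Suc p * \<theta> ^ k) \<le> B * (real k ^ p * s ^ k)"
    proof safe
      fix k
      have "norm (real k ^ Suc p * \<theta> ^ k) = norm (real k * s ^ k) * (real k ^ p * s ^ k)"
        using s by (simp add: s(3)[symmetric] power_mult_distrib)
      also have "\<dots> \<le> B * (real k ^ p * s ^ k)" using B s by (intro mult_right_mono) auto
      finally show "norm (real k ^ Suc p * \<theta> ^ k) \<le> B * (real k ^ p * s ^ k)" .
    qed
  qed
qed

lemma floor_mult_eq_iff:
  assumes "n > 0" "0 \<le> u"
  shows "u \<in> {real j / real n..<real (Suc j) / real n} \<longleftrightarrow> j = nat \<lfloor>real n * u\<rfloor>"
proof -
  have "u \<in> {real j / real n..<real (Suc j) / real n} \<longleftrightarrow> real j \<le> real n * u \<and> real n * u < real j + 1"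
    using assms by (auto simp: field_simps)
  also have "\<dots> \<longleftrightarrow> \<lfloor>real n * u\<rfloor> = int j" by (simp add: floor_eq_iff)
  also have "\<dots> \<longleftrightarrow> j = nat \<lfloor>real n * u\<rfloor>" using assms by auto
  finally show ?thesis .
qed

text \<open>The average becomes the integral of a step function on the fixed interval
  \<open>{0..<1}\<close>, where dominated convergence is available.\<close>

lemma average_eq_integral:
  fixes g :: "nat \<Rightarrow> real"
  assumes n: "n > 0"
  shows "(\<lambda>u. indicator {0..<1} u * g (nat \<lfloor>real n * u\<rfloor>)) \<in> borel_measurable borel"
    and "(\<Sum>j<n. g j) / real n = (LINT u|lborel. indicator {0..<1} u * g (nat \<lfloor>real n * u\<rfloor>))"
proof -
  let ?I = "\<lambda>j. {real j / real n..<real (Suc j) / real n}"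
  have eq: "indicator {0..<1} u * g (nat \<lfloor>real n * u\<rfloor>) = (\<Sum>j<n. indicator (?I j) u * g j)" for u :: real
  proof (cases "0 \<le> u \<and> u < 1")
    case True
    have "indicator (?I j) u = (if j = nat \<lfloor>real n * u\<rfloor> then 1 else (0::real))" for j
      unfolding indicator_def floor_mult_eq_iff[OF n conjunct1[OF True]] by simp
    then have "(\<Sum>j<n. indicator (?I j) u * g j) = (\<Sum>j<n. if j = nat \<lfloor>real n * u\<rfloor> then g j else 0)"
      by (intro sum.cong) (simp_all only: split: if_splits, simp_all)
    moreover have "nat \<lfloor>real n * u\<rfloor> < n" using True n by (simp add: nat_less_iff floor_less_iff)
    ultimately show ?thesis using True by simp
  next
    case False
    have "u \<notin> ?I j" if "j < n" for j
    proof
      assume "u \<in> ?I j"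
      then have "real j \<le> real n * u" "real n * u < real (Suc j)" using n by (auto simp: field_simps)
      moreover have "real (Suc j) \<le> real n" using that by simp
      ultimately have nu: "0 \<le> real n * u" "real n * u < real n * 1" by linarith+
      have "u < 1" by (rule mult_left_less_imp_less[OF nu(2)]) simp
      moreover have "0 \<le> u" using nu(1) n by (simp add: zero_le_mult_iff)
      ultimately show False using False by simp
    qed
    then show ?thesis using False by simp
  qed
  show "(\<lambda>u. indicator {0..<1} u * g (nat \<lfloor>real n * u\<rfloor>)) \<in> borel_measurable borel"
    unfolding eq by measurable
  have "(LINT u|lborel. indicator (?I j) u * g j) = g j / real n" for j
  proof -
    have "(LINT u|lborel. indicator (?I j) u * g j) = measure lborel (?I j) * g j"
      by simp
    also have "measure lborel (?I j) = 1 / real n"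
      using n by (simp add: divide_right_mono diff_divide_distrib[symmetric])
    finally show ?thesis by simp
  qed
  moreover have "integrable lborel (\<lambda>u. indicator (?I j) u * g j)" for j
    using n by (intro integrable_mult_left integrable_real_indicator) (auto simp: divide_right_mono)
  ultimately show "(\<Sum>j<n. g j) / real n = (LINT u|lborel. indicator {0..<1} u * g (nat \<lfloor>real n * u\<rfloor>))"
    unfolding eq by (subst Bochner_Integration.integral_sum) (simp_all add: sum_divide_distrib)
qed

text \<open>Rescaling time by the number of keys turns the average over insertion times into an integral over
  the load factor.\<close>

lemma (in limit_law) pmf_D_FC_tendsto:
  fixes m n :: "nat \<Rightarrow> nat"
  assumes m: "filterlim m at_top sequentially" and n: "filterlim n at_top sequentially"
    and le: "\<And>i. n i \<le> b * m i" and lim: "(\<lambda>i. real (n i) / real (b * m i)) \<longlonglongrightarrow> \<alpha>"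
  shows "(\<lambda>i. pmf (D_FC b (m i) (n i)) k) \<longlonglongrightarrow> lim_pmf k"
proof -
  define g where "g i j = mean_run b (m i) j k - mean_run b (m i) j (Suc k)" for i j
  define F where "F i u = indicator {0..<1} u * g i (nat \<lfloor>real (n i) * u\<rfloor>)" for i and u :: real
  define f where "f u = indicator {0<..<1} u * law_U b (\<alpha> * u) k" for u :: real
  have evm: "\<forall>\<^sub>F i in sequentially. 0 < m i" and evn: "\<forall>\<^sub>F i in sequentially. 0 < n i"
    by (rule eventually_gt_nat[OF m], rule eventually_gt_nat[OF n])
  have g: "\<bar>g i j\<bar> \<le> 1" for i j
    using mean_run_nonneg[of b "m i" j "Suc k"] mean_run_antimono[of b "m i" j k] mean_run_le_1[of b "m i" j k]
    by (simp add: g_def)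
  have [measurable]: "F i \<in> borel_measurable borel" for i
  proof (cases "n i = 0")
    case True
    then show ?thesis by (simp add: F_def[abs_def])
  qed (simp add: F_def[abs_def] average_eq_integral(1))
  have [measurable]: "f \<in> borel_measurable borel"
    unfolding f_def[abs_def] by measurable
  have "(\<lambda>i. LINT u|lborel. F i u) \<longlonglongrightarrow> (LINT u|lborel. f u)"
  proof (rule integral_dominated_convergence[where w = "indicator {0..<1}"])
    show "integrable lborel (indicator {0..<1::real} :: real \<Rightarrow> real)"
      by (intro integrable_real_indicator) auto
    show "AE u in lborel. norm (F i u) \<le> indicator {0..<1} u" for i
      using g by (auto simp: F_def indicator_def)
    \<comment> \<open>The point \<open>u = 0\<close> would mean load 0, outside the range of the
      Poisson model treated here; it is a null set.\<close>
    have "(\<lambda>i. F i u) \<longlonglongrightarrow> f u" if u: "u \<noteq> 0" for u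
    proof (cases "u \<in> {0<..<1}")
      case False
      then have "u \<notin> {0..<1}" using u by auto
      then have "F i u = 0" for i by (auto simp: F_def)
      moreover have "f u = 0" using False by (auto simp: f_def)
      ultimately show ?thesis by simp
    next
      case True
      interpret poisson_buckets b "\<alpha> * u"
        using b \<alpha>0 \<alpha>1 True mult_strict_mono[of \<alpha> 1 u 1] by unfold_locales auto
      have minv: "(\<lambda>i. inverse (real (b * m i))) \<longlonglongrightarrow> 0"
      proof (intro tendsto_inverse_0_at_top filterlim_compose[OF filterlim_real_sequentially])
        show "filterlim (\<lambda>i. b * m i) at_top sequentially"
          by (rule filterlim_at_top_mono[OF m]) (use b in \<open>auto intro!: always_eventually\<close>)
      qed
      have "(\<lambda>i. real (nat \<lfloor>real (n i) * u\<rfloor>) / real (b * m i)) \<longlonglongrightarrow> \<alpha> * u"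
      proof (rule tendsto_sandwich[where f = "\<lambda>i. real (n i) / real (b * m i) * u - inverse (real (b * m i))"
            and h = "\<lambda>i. real (n i) / real (b * m i) * u"])
        show "(\<lambda>i. real (n i) / real (b * m i) * u) \<longlonglongrightarrow> \<alpha> * u" by (intro tendsto_intros lim)
        have "(\<lambda>i. real (n i) / real (b * m i) * u - inverse (real (b * m i))) \<longlonglongrightarrow> \<alpha> * u - 0"
          by (intro tendsto_intros lim minv)
        then show "(\<lambda>i. real (n i) / real (b * m i) * u - inverse (real (b * m i))) \<longlonglongrightarrow> \<alpha> * u" by simp
        have fl: "real (n i) * u - 1 \<le> real (nat \<lfloor>real (n i) * u\<rfloor>)" "real (nat \<lfloor>real (n i) * u\<rfloor>) \<le> real (n i) * u" for i
        proof -
          have "0 \<le> real (n i) * u" using True by simp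
          then show "real (n i) * u - 1 \<le> real (nat \<lfloor>real (n i) * u\<rfloor>)" "real (nat \<lfloor>real (n i) * u\<rfloor>) \<le> real (n i) * u"
            by linarith+
        qed
        show "\<forall>\<^sub>F i in sequentially. real (nat \<lfloor>real (n i) * u\<rfloor>) / real (b * m i) \<le> real (n i) / real (b * m i) * u"
          using fl(2) by (intro always_eventually allI) (simp add: divide_right_mono)
        have "real (n i) / real (b * m i) * u - inverse (real (b * m i)) = (real (n i) * u - 1) / real (b * m i)" for i
          by (simp add: diff_divide_distrib inverse_eq_divide)
        then show "\<forall>\<^sub>F i in sequentially. real (n i) / real (b * m i) * u - inverse (real (b * m i)) \<le> real (nat \<lfloor>real (n i) * u\<rfloor>) / real (b * m i)"
          using fl(1) by (intro always_eventually allI) (simp only:, rule divide_right_mono, auto)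
      qed
      from tendsto_diff[OF mean_run_tendsto[OF m this, of k] mean_run_tendsto[OF m this, of "Suc k"]]
      have "(\<lambda>i. g i (nat \<lfloor>real (n i) * u\<rfloor>)) \<longlonglongrightarrow> law_U b (\<alpha> * u) k"
        by (simp add: g_def prob_U_law[symmetric] prob_U)
      then show ?thesis using True by (simp add: F_def f_def)
    qed
    then show "AE u in lborel. (\<lambda>i. F i u) \<longlonglongrightarrow> f u"
      using AE_lborel_singleton[of "0::real"] by (auto elim!: eventually_mono)
  qed auto
  also have "(LINT u|lborel. f u) = lim_pmf k"
  proof -
    \<comment> \<open>The substitution \<open>\<beta> = \<alpha> * u\<close> produces the factor
      \<open>1 / \<alpha>\<close> of the mixture.\<close>
    have "indicator {0<..<\<alpha>} (0 + \<alpha> * u) *\<^sub>R law_U b (0 + \<alpha> * u) k = f u" for u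
      using \<alpha>0 by (auto simp: f_def indicator_def zero_less_mult_iff mult_less_cancel_left1)
    then show ?thesis
      using lborel_integral_real_affine[of \<alpha> "\<lambda>\<beta>. indicator {0<..<\<alpha>} \<beta> *\<^sub>R law_U b \<beta> k" 0] \<alpha>0
      by (simp only: lim_pmf_def set_lebesgue_integral_def) simp
  qed
  finally have "(\<lambda>i. LINT u|lborel. F i u) \<longlonglongrightarrow> lim_pmf k" .
  moreover have "\<forall>\<^sub>F i in sequentially. (LINT u|lborel. F i u) = pmf (D_FC b (m i) (n i)) k"
    using evm evn
  proof eventually_elim
    case (elim i)
    have "(LINT u|lborel. F i u) = (\<Sum>j<n i. g i j) / real (n i)"
      unfolding F_def by (rule average_eq_integral(2)[OF elim(2), symmetric])
    also have "\<dots> = pmf (D_FC b (m i) (n i)) k"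
      unfolding g_def using elim b le[of i] by (intro pmf_D_FC[symmetric]) auto
    finally show ?case .
  qed
  ultimately show ?thesis by (simp add: tendsto_cong)
qed

text \<open>Tannery's theorem for the distance weighted by \<open>g\<close>. This distance controls
  the expectations of all functions dominated by \<open>g\<close> at once, whence the uniformity in
  \<open>q\<close>.\<close>

lemma geometric_tail_convergence:
  fixes p :: "nat \<Rightarrow> nat pmf" and q :: "nat pmf" and g :: "nat \<Rightarrow> real"
  assumes lim: "\<And>k. (\<lambda>i. pmf (p i) k) \<longlonglongrightarrow> pmf q k"
    and ev: "\<forall>\<^sub>F i in sequentially. \<forall>k. pmf (p i) k \<le> C * \<theta> ^ k"
    and g: "\<And>k. 0 \<le> g k" and sm: "summable (\<lambda>k. \<theta> ^ k * g k)"
  shows "summable (\<lambda>k. pmf q k * g k)"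
    and "\<forall>\<^sub>F i in sequentially. summable (\<lambda>k. pmf (p i) k * g k)"
    and "(\<lambda>i. \<Sum>k. \<bar>pmf (p i) k - pmf q k\<bar> * g k) \<longlonglongrightarrow> 0"
    and "\<forall>\<^sub>F i in sequentially. summable (\<lambda>k. \<bar>pmf (p i) k - pmf q k\<bar> * g k)"
proof -
  \<comment> \<open>The limit inherits the geometric bound, so differences are dominated as
    well.\<close>
  have q: "pmf q k \<le> C * \<theta> ^ k" for k
    by (rule tendsto_upperbound[OF lim]) (use ev in \<open>auto elim: eventually_mono\<close>)
  have sm': "summable (\<lambda>k. C * \<theta> ^ k * g k)" using summable_mult[OF sm, of C] by (simp add: mult.assoc)
  have dom: "summable (\<lambda>k. pmf r k * g k)" if "\<And>k. pmf r k \<le> C * \<theta> ^ k" for r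
    by (rule summable_comparison_test[OF exI[of _ 0] sm']) (use that g in \<open>auto simp: abs_mult intro!: mult_right_mono\<close>)
  show "summable (\<lambda>k. pmf q k * g k)" by (rule dom[OF q])
  show "\<forall>\<^sub>F i in sequentially. summable (\<lambda>k. pmf (p i) k * g k)"
    using ev by eventually_elim (auto intro: dom)
  have "(\<forall>\<^sub>F i in sequentially. summable (\<lambda>k. norm (\<bar>pmf (p i) k - pmf q k\<bar> * g k))) \<and>
     summable (\<lambda>k. norm (\<bar>pmf q k - pmf q k\<bar> * g k)) \<and>
     ((\<lambda>i. \<Sum>k. \<bar>pmf (p i) k - pmf q k\<bar> * g k) \<longlonglongrightarrow> (\<Sum>k. \<bar>pmf q k - pmf q k\<bar> * g k))"
  proof (rule tannerys_theorem)
    show "(\<lambda>i. \<bar>pmf (p i) k - pmf q k\<bar> * g k) \<longlonglongrightarrow> \<bar>pmf q k - pmf q k\<bar> * g k" for k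
      by (intro tendsto_intros lim)
    obtain N where N: "\<And>i k. i \<ge> N \<Longrightarrow> pmf (p i) k \<le> C * \<theta> ^ k"
      using ev by (auto simp: eventually_sequentially)
    have "norm (\<bar>pmf (p i) k - pmf q k\<bar> * g k) \<le> C * \<theta> ^ k * g k" if "i \<ge> N" for i k
    proof -
      have "\<bar>pmf (p i) k - pmf q k\<bar> \<le> C * \<theta> ^ k"
        using N[OF that, of k] q[of k] pmf_nonneg[of "p i" k] pmf_nonneg[of q k] by linarith
      then show ?thesis using g by (simp add: abs_mult mult_right_mono)
    qed
    then show "\<forall>\<^sub>F (k, i) in sequentially \<times>\<^sub>F sequentially. norm (\<bar>pmf (p i) k - pmf q k\<bar> * g k) \<le> C * \<theta> ^ k * g k"
      unfolding eventually_prod_sequentially by (intro exI[of _ N]) auto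
  qed (use sm' in auto)
  then show "(\<lambda>i. \<Sum>k. \<bar>pmf (p i) k - pmf q k\<bar> * g k) \<longlonglongrightarrow> 0"
    and "\<forall>\<^sub>F i in sequentially. summable (\<lambda>k. \<bar>pmf (p i) k - pmf q k\<bar> * g k)"
    using g by (simp_all add: abs_mult)
qed

lemma expectation_diff_le:
  fixes f :: "nat \<Rightarrow> 'a::{banach, second_countable_topology}"
  assumes f: "\<And>k. norm (f k) \<le> g k" and "summable (\<lambda>k. pmf p k * g k)" "summable (\<lambda>k. pmf q k * g k)"
    "summable (\<lambda>k. \<bar>pmf p k - pmf q k\<bar> * g k)"
  shows "norm (measure_pmf.expectation p f - measure_pmf.expectation q f) \<le> (\<Sum>k. \<bar>pmf p k - pmf q k\<bar> * g k)"
proof -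
  have sm: "summable (\<lambda>k. norm (pmf r k *\<^sub>R f k))" if "summable (\<lambda>k. pmf r k * g k)" for r
    by (rule summable_comparison_test[OF exI[of _ 0] that]) (auto intro!: mult_left_mono f)
  have smd: "summable (\<lambda>k. norm ((pmf p k - pmf q k) *\<^sub>R f k))"
    by (rule summable_comparison_test[OF exI[of _ 0] assms(4)]) (auto intro!: mult_left_mono f)
  have "measure_pmf.expectation p f - measure_pmf.expectation q f = (\<Sum>k. (pmf p k - pmf q k) *\<^sub>R f k)"
    unfolding nat_pmf_expectation(2)[OF sm[OF assms(2)]] nat_pmf_expectation(2)[OF sm[OF assms(3)]] scaleR_diff_left
    by (rule suminf_diff[OF summable_norm_cancel[OF sm[OF assms(2)]] summable_norm_cancel[OF sm[OF assms(3)]]])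
  also have "norm \<dots> \<le> (\<Sum>k. norm ((pmf p k - pmf q k) *\<^sub>R f k))" by (rule summable_norm[OF smd])
  also have "\<dots> \<le> (\<Sum>k. \<bar>pmf p k - pmf q k\<bar> * g k)"
    by (rule suminf_le[OF _ smd assms(4)]) (auto intro!: mult_left_mono f)
  finally show ?thesis .
qed

lemma weak_conv_real_law:
  assumes "\<And>k. (\<lambda>i. pmf (p i) k) \<longlonglongrightarrow> pmf q k"
  shows "weak_conv_m (\<lambda>i. real_law (p i)) (real_law q)"
proof -
  have "cdf (real_law r) x = measure_pmf.prob r {k. real k \<le> x}" for r x
    unfolding cdf_def real_law_def by (subst measure_distr) (auto simp: vimage_def)
  then show ?thesis
    unfolding weak_conv_m_def weak_conv_def by (auto intro!: measure_pmf_tendsto assms)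
qed

section \<open>Moments and generating functions in the limit\<close>

context limit_law
begin

lemma moments_integrable: "integrable (measure_pmf (D_FC_lim b \<alpha>)) (\<lambda>k. real k ^ p)"
proof -
  have "(\<lambda>k. real k ^ p * (1 / R) ^ k) \<longlonglongrightarrow> 0"
    using R_gt_1 by (intro summable_LIMSEQ_zero summable_power_times_power) auto
  then have "Bseq (\<lambda>k. real k ^ p * (1 / R) ^ k)" by (intro convergent_imp_Bseq convergentI)
  then obtain A where A: "\<And>k. norm (real k ^ p * (1 / R) ^ k) \<le> A" by (auto simp: Bseq_def)
  have "norm (real k ^ p) \<le> A * R ^ k" for k
    using A[of k] R_gt_1 by (simp add: power_one_over field_simps)
  from weighted_lim_pmf(2)[OF weights_le[OF this]] show ?thesis
    by (intro nat_pmf_expectation(1)) (simp add: pmf_D_FC_lim)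
qed

text \<open>A load strictly between \<alpha> and 1: eventually it exceeds
  \<open>n i / (b * m i)\<close>, so the single rate \<open>\<theta>'\<close> serves all large
  \<open>i\<close>.\<close>

definition \<beta>' :: real where "\<beta>' = (\<alpha> + 1) / 2"

abbreviation "\<theta>' \<equiv> load_ratio b \<beta>'"

lemma \<beta>': "\<alpha> < \<beta>'" "0 < \<beta>'" "\<beta>' < 1"
  using \<alpha>0 \<alpha>1 by (auto simp: \<beta>'_def)

lemma \<theta>': "0 < \<theta>'" "\<theta>' < 1"
  using load_ratio_pos[OF \<beta>'(2)] load_ratio_less_1[OF \<beta>'(2,3) b] by auto

lemma pmf_D_FC_geometric:
  fixes m n :: "nat \<Rightarrow> nat"
  assumes m: "filterlim m at_top sequentially" and n: "filterlim n at_top sequentially"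
    and lim: "(\<lambda>i. real (n i) / real (b * m i)) \<longlonglongrightarrow> \<alpha>"
  shows "\<forall>\<^sub>F i in sequentially. \<forall>k. pmf (D_FC b (m i) (n i)) k \<le> (1 / (1 - \<theta>')) * \<theta>' ^ k"
  using eventually_gt_nat[OF m, of 0] eventually_gt_nat[OF n, of 0] order_tendstoD(2)[OF lim \<beta>'(1)]
proof eventually_elim
  case (elim i)
  then have "real (n i) \<le> \<beta>' * real (b * m i)" using b by (simp add: divide_less_eq)
  then show ?case using pmf_D_FC_le[OF b \<beta>'(2,3), of "m i" "n i"] elim by simp
qed

text \<open>The index set \<open>S\<close> lets one statement cover a single moment, with a
  singleton \<open>S\<close>, and the generating functions on a disc.\<close>

lemma expectation_tendsto:
  fixes m n :: "nat \<Rightarrow> nat" and f :: "'q \<Rightarrow> nat \<Rightarrow> 'a::{banach, second_countable_topology}"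
  assumes m: "filterlim m at_top sequentially" and n: "filterlim n at_top sequentially"
    and le: "\<And>i. n i \<le> b * m i" and lim: "(\<lambda>i. real (n i) / real (b * m i)) \<longlonglongrightarrow> \<alpha>"
    and f: "\<And>q k. q \<in> S \<Longrightarrow> norm (f q k) \<le> g k" and g: "\<And>k. 0 \<le> g k" and sm: "summable (\<lambda>k. \<theta>' ^ k * g k)"
  shows "uniform_limit S (\<lambda>i q. measure_pmf.expectation (D_FC b (m i) (n i)) (f q))
     (\<lambda>q. measure_pmf.expectation (D_FC_lim b \<alpha>) (f q)) sequentially"
proof (rule uniform_limitI)
  fix e :: real assume e: "e > 0"
  have "(\<lambda>i. pmf (D_FC b (m i) (n i)) k) \<longlonglongrightarrow> pmf (D_FC_lim b \<alpha>) k" for k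
    unfolding pmf_D_FC_lim by (rule pmf_D_FC_tendsto[OF m n le lim])
  note T = geometric_tail_convergence[OF this pmf_D_FC_geometric[OF m n lim] g sm]
  have "\<forall>\<^sub>F i in sequentially. (\<Sum>k. \<bar>pmf (D_FC b (m i) (n i)) k - pmf (D_FC_lim b \<alpha>) k\<bar> * g k) < e"
    by (rule order_tendstoD(2)[OF T(3) e])
  with T(2,4) show "\<forall>\<^sub>F i in sequentially. \<forall>q\<in>S. dist (measure_pmf.expectation (D_FC b (m i) (n i)) (f q))
     (measure_pmf.expectation (D_FC_lim b \<alpha>) (f q)) < e"
  proof eventually_elim
    case (elim i)
    then show ?case
      using expectation_diff_le[OF f elim(1) T(1) elim(2)] unfolding dist_norm by (meson order_le_less_trans)
  qed
qed

lemma exact_convergence: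
  "\<exists>\<delta>>0. \<forall>m n :: nat \<Rightarrow> nat.
        filterlim m at_top sequentially \<and> filterlim n at_top sequentially
      \<and> (\<forall>i. n i \<le> b * m i)
      \<and> (\<lambda>i. real (n i) / real (b * m i)) \<longlonglongrightarrow> \<alpha> \<longrightarrow>
        weak_conv_m (\<lambda>i. real_law (D_FC b (m i) (n i))) (real_law (D_FC_lim b \<alpha>))
      \<and> (\<forall>p. (\<lambda>i. measure_pmf.expectation (D_FC b (m i) (n i)) (\<lambda>k. real k ^ p))
              \<longlonglongrightarrow> measure_pmf.expectation (D_FC_lim b \<alpha>) (\<lambda>k. real k ^ p))
      \<and> uniform_limit (cball 0 (1 + \<delta>))
          (\<lambda>i q. pgf (D_FC b (m i) (n i)) q) (\<lambda>q. psi_FC b q \<alpha>) sequentially"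
proof -
  \<comment> \<open>Chosen so that \<open>\<theta>' * (1 + \<delta>)\<close> is the midpoint of
    \<open>\<theta>'\<close> and 1. It depends on \<open>b\<close> and \<alpha> only, not on the
    sequences \<open>m\<close> and \<open>n\<close>.\<close>
  define \<delta> where "\<delta> = (1 / \<theta>' - 1) / 2"
  have \<delta>: "\<delta> > 0" using \<theta>' by (simp add: \<delta>_def)
  have "\<theta>' * (1 + \<delta>) = (1 + \<theta>') / 2" using \<theta>' by (simp add: \<delta>_def field_simps)
  then have small: "\<theta>' * (1 + \<delta>) < 1" using \<theta>' by simp
  have "weak_conv_m (\<lambda>i. real_law (D_FC b (m i) (n i))) (real_law (D_FC_lim b \<alpha>))
      \<and> (\<forall>p. (\<lambda>i. measure_pmf.expectation (D_FC b (m i) (n i)) (\<lambda>k. real k ^ p))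
              \<longlonglongrightarrow> measure_pmf.expectation (D_FC_lim b \<alpha>) (\<lambda>k. real k ^ p))
      \<and> uniform_limit (cball 0 (1 + \<delta>))
          (\<lambda>i q. pgf (D_FC b (m i) (n i)) q) (\<lambda>q. psi_FC b q \<alpha>) sequentially"
    if "filterlim m at_top sequentially \<and> filterlim n at_top sequentially
      \<and> (\<forall>i. n i \<le> b * m i) \<and> (\<lambda>i. real (n i) / real (b * m i)) \<longlonglongrightarrow> \<alpha>" for m n :: "nat \<Rightarrow> nat"
  proof (intro conjI allI)
    from that have m: "filterlim m at_top sequentially" and n: "filterlim n at_top sequentially"
      and le: "\<And>i. n i \<le> b * m i" and lim: "(\<lambda>i. real (n i) / real (b * m i)) \<longlonglongrightarrow> \<alpha>" by auto
    show "weak_conv_m (\<lambda>i. real_law (D_FC b (m i) (n i))) (real_law (D_FC_lim b \<alpha>))"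
      by (rule weak_conv_real_law) (unfold pmf_D_FC_lim, rule pmf_D_FC_tendsto[OF m n le lim])
    show "(\<lambda>i. measure_pmf.expectation (D_FC b (m i) (n i)) (\<lambda>k. real k ^ p))
              \<longlonglongrightarrow> measure_pmf.expectation (D_FC_lim b \<alpha>) (\<lambda>k. real k ^ p)" for p
    proof -
      have "uniform_limit {()} (\<lambda>i q. measure_pmf.expectation (D_FC b (m i) (n i)) (\<lambda>k. real k ^ p))
        (\<lambda>q. measure_pmf.expectation (D_FC_lim b \<alpha>) (\<lambda>k. real k ^ p)) sequentially"
      proof (rule expectation_tendsto[OF m n le lim])
        show "norm (real k ^ p) \<le> real k ^ p" for k by simp
        show "summable (\<lambda>k. \<theta>' ^ k * real k ^ p)"
          using summable_power_times_power[OF \<theta>', of p] by (simp add: mult.commute)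
      qed auto
      then show ?thesis by (auto dest: tendsto_uniform_limitI)
    qed
    show "uniform_limit (cball 0 (1 + \<delta>)) (\<lambda>i q. pgf (D_FC b (m i) (n i)) q) (\<lambda>q. psi_FC b q \<alpha>) sequentially"
      unfolding pgf_def psi_FC_def
    proof (rule expectation_tendsto[OF m n le lim])
      show "norm (q ^ k) \<le> (1 + \<delta>) ^ k" if "q \<in> cball 0 (1 + \<delta>)" for q :: complex and k
        using that by (simp add: norm_power power_mono)
      show "summable (\<lambda>k. \<theta>' ^ k * (1 + \<delta>) ^ k)"
        unfolding power_mult_distrib[symmetric] using small \<delta> \<theta>' by (intro summable_geometric) (simp add: abs_mult)
    qed (use \<delta> in auto)
  qed
  then show ?thesis using \<delta> by blast
qed

end

text \<open>At \<open>q = 1\<close> the product expressions read \<open>0 / 0\<close>, so they are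
  stated for \<open>q \<noteq> 1\<close> and completed by a limit. Integrability is asserted along
  with the integrals because a non-integrable function would be given the integral 0.\<close>

theorem theorem12p7:
  fixes b :: nat and \<alpha> :: real and r :: "complex \<Rightarrow> complex"
  assumes "b \<ge> 1" and "0 < \<alpha>" and "\<alpha> < 1"
    and "\<And>q. r q ^ b = q" and "r 1 = 1"
  shows
    "(\<forall>k. pmf (D_FC_lim b \<alpha>) k =
        (1 / \<alpha>) * (LBINT \<beta>=0..\<alpha>. \<P>(X in poisson_model b \<beta>. U b X = k)))
   \<and> (\<forall>q. norm q \<le> (exp (\<alpha> - 1) / \<alpha>) ^ b \<longrightarrow>
        integrable (measure_pmf (D_FC_lim b \<alpha>)) (\<lambda>k. q ^ k)
      \<and> interval_lebesgue_integrable lborel 0 \<alpha> (\<lambda>\<beta>. psi_U b q \<beta>)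
      \<and> psi_FC b q \<alpha> = (1 / of_real \<alpha>) * (LBINT \<beta>=0..\<alpha>. psi_U b q \<beta>))
   \<and> (\<forall>q. norm q \<le> (exp (\<alpha> - 1) / \<alpha>) ^ b \<and> q \<noteq> 1 \<longrightarrow>
        interval_lebesgue_integrable lborel 0 \<alpha>
          (\<lambda>\<beta>. T0 b r (real b * \<beta>) / (1 - q) * (\<Prod>l<b. 1 - zeta b r l q \<beta>))
      \<and> psi_FC b q \<alpha> = (1 / of_real \<alpha>) * (LBINT \<beta>=0..\<alpha>.
          T0 b r (real b * \<beta>) / (1 - q) * (\<Prod>l<b. 1 - zeta b r l q \<beta>))
      \<and> psi_FC b q \<alpha> = (1 / of_real \<alpha>) * (LBINT \<beta>=0..\<alpha>.
          of_real (real b * (1 - \<beta>)) * (\<Prod>l<b. 1 - zeta b r l q \<beta>)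
          / ((1 - q) * (\<Prod>l=1..<b. 1 - zeta b r l 1 \<beta>))))
   \<and> ((\<lambda>q. (1 / of_real \<alpha>) * (LBINT \<beta>=0..\<alpha>.
          of_real (real b * (1 - \<beta>)) * (\<Prod>l<b. 1 - zeta b r l q \<beta>)
          / ((1 - q) * (\<Prod>l=1..<b. 1 - zeta b r l 1 \<beta>)))) \<longlongrightarrow> psi_FC b 1 \<alpha>) (at 1)
   \<and> (\<forall>p. integrable (measure_pmf (D_FC_lim b \<alpha>)) (\<lambda>k. real k ^ p))
   \<and> (\<exists>\<delta>>0. \<forall>m n :: nat \<Rightarrow> nat.
        filterlim m at_top sequentially \<and> filterlim n at_top sequentially
      \<and> (\<forall>i. n i \<le> b * m i)
      \<and> (\<lambda>i. real (n i) / real (b * m i)) \<longlonglongrightarrow> \<alpha> \<longrightarrow>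
        weak_conv_m (\<lambda>i. real_law (D_FC b (m i) (n i))) (real_law (D_FC_lim b \<alpha>))
      \<and> (\<forall>p. (\<lambda>i. measure_pmf.expectation (D_FC b (m i) (n i)) (\<lambda>k. real k ^ p))
              \<longlonglongrightarrow> measure_pmf.expectation (D_FC_lim b \<alpha>) (\<lambda>k. real k ^ p))
      \<and> uniform_limit (cball 0 (1 + \<delta>))
          (\<lambda>i q. pgf (D_FC b (m i) (n i)) q) (\<lambda>q. psi_FC b q \<alpha>) sequentially)"
proof -
  interpret limit_law b \<alpha>
    using assms by unfold_locales
  note R = radius_def[of b \<alpha>, symmetric]
  note product = pgf_lim_product[OF assms(4,5)]
  have "((\<lambda>q. (1 / of_real \<alpha>) * (LBINT \<beta>=0..\<alpha>.
          of_real (real b * (1 - \<beta>)) * (\<Prod>l<b. 1 - zeta b r l q \<beta>)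
          / ((1 - q) * (\<Prod>l=1..<b. 1 - zeta b r l 1 \<beta>)))) \<longlongrightarrow> psi_FC b 1 \<alpha>) (at 1)"
  proof (rule Lim_transform_eventually[OF psi_FC_tendsto_1])
    have "\<forall>\<^sub>F q in at (1::complex). q \<in> ball 0 R - {1}"
      using R_gt_1 by (intro eventually_at_in_open) (auto simp: dist_norm)
    then show "\<forall>\<^sub>F q in at 1. psi_FC b q \<alpha> = (1 / of_real \<alpha>) * (LBINT \<beta>=0..\<alpha>.
          of_real (real b * (1 - \<beta>)) * (\<Prod>l<b. 1 - zeta b r l q \<beta>)
          / ((1 - q) * (\<Prod>l=1..<b. 1 - zeta b r l 1 \<beta>)))"
      by eventually_elim (rule product(3); simp)
  qed
  note limit = this
  show ?thesis
    unfolding R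
  proof (intro conjI)
    show "\<forall>k. pmf (D_FC_lim b \<alpha>) k =
        (1 / \<alpha>) * (LBINT \<beta>=0..\<alpha>. \<P>(X in poisson_model b \<beta>. U b X = k))"
      by (rule allI) (rule trans[OF pmf_D_FC_lim lim_pmf_eq])
  qed ((intro allI impI conjI; erule pgf_lim), (intro allI impI conjI; elim conjE; rule product; assumption),
      rule limit, (rule allI, rule moments_integrable), rule exact_convergence)
qed

end
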